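(* For every integer $d\ge 3$ the signature of the $d$-cube $C_d=[0,1]^d$ is bounded from below by \[ \sigma(C_d)\;\ge\; \begin{cases} 2^{\frac{d+1}{2}}\left(\frac{d-1}{2}\right)! & \text{if } d\equiv 1 \bmod 2,\\[2pt] \left(\frac{d}{2}\right)! & \text{if } d\equiv 0\bmod 4,\\[2pt] \frac{2}{3}\left(\frac{d}{2}\right)! & \text{if } d\equiv 2\bmod 4. \end{cases} \]
   Context: A triangulation $K$ of an $m$-dimensional lattice polytope $P\subset\mathbb{R}^m$ (vertices in $\mathbb{Z}^m$) is: regular if it is the subdivision of $P$ induced by the lower convex hull of $\{(v,\lambda(v)): v\text{ a vertex of }K\}\subset\mathbb{R}^{m+1}$ for some lifting function $\lambda$; dense if its vertex set is $P\cap\mathbb{Z}^m$; foldable if its $1$-skeleton has a proper vertex coloring with $m+1$ colors. An rdf-triangulation is one that is regular, dense and foldable. The dual graph of a foldable triangulation of $P$ (nodes: the $m$-simplices, called facets; adjacent if they share an $(m-1)$-face) is connected and bipartite; call the two classes black and white. A lattice $m$-simplex is odd if its normalized volume ($m!$ times its volume) is odd. The signature of an rdf-triangulation is the absolute value of the difference between the numbers of odd black facets and odd white facets. The signature $\sigma(P)$ of a lattice polytope $P$ is the maximum of the signatures of all rdf-triangulations of $P$ (undefined if there are none; cubes do have rdf-triangulations). *)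

theory Defs
  imports "HOL-Analysis.Analysis"
begin

text \<open>
  The integer lattice is the one spanned by the standard basis, i.e. the points of
  \<open>real ^ 'n\<close> with integer coordinates. In all definitions the polytope is full-dimensional,
  so its dimension m is \<open>DIM('a)\<close>.
\<close>

definition integer_lattice :: "'a::euclidean_space set" where
  "integer_lattice = {x. \<forall>b\<in>Basis. x \<bullet> b \<in> \<int>}"

definition lattice_polytope :: "'a::euclidean_space set \<Rightarrow> bool" where
  "lattice_polytope P \<longleftrightarrow>
     (\<exists>V. finite V \<and> V \<subseteq> integer_lattice \<and> P = convex hull V) \<and> aff_dim P = int DIM('a)"

text \<open>
  As in the library's \<^const>\<open>simplicial_complex\<close>, a triangulation contains the faces of all
  dimensions, the empty face included.
\<close>

definition polytope_triangulation :: "'a::euclidean_space set \<Rightarrow> 'a set set \<Rightarrow> bool" where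
  "polytope_triangulation P K \<longleftrightarrow> lattice_polytope P \<and> simplicial_complex K \<and> \<Union>K = P"

definition vertices :: "'a::euclidean_space set set \<Rightarrow> 'a set" where
  "vertices K = {v. {v} \<in> K}"

definition facets :: "'a::euclidean_space set set \<Rightarrow> 'a set set" where
  "facets K = {S \<in> K. int DIM('a) simplex S}"

text \<open>
  A lower face is the set of minimizers of a linear functional whose coefficient at the last
  (height) coordinate is positive, normalized here to 1. For \<open>b\<close> below the minimum this yields
  the empty face, in accordance with the convention above.
\<close>

definition lower_face :: "('a::euclidean_space \<times> real) set \<Rightarrow> ('a \<times> real) set \<Rightarrow> bool" where
  "lower_face F Q \<longleftrightarrow>
     (\<exists>a b. Q \<subseteq> {(x, t). b \<le> a \<bullet> x + t} \<and> F = Q \<inter> {(x, t). a \<bullet> x + t = b})"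

definition lifted_polytope :: "('a::euclidean_space \<Rightarrow> real) \<Rightarrow> 'a set \<Rightarrow> ('a \<times> real) set" where
  "lifted_polytope h V = convex hull ((\<lambda>v. (v, h v)) ` V)"

definition induced_subdivision :: "('a::euclidean_space \<Rightarrow> real) \<Rightarrow> 'a set \<Rightarrow> 'a set set" where
  "induced_subdivision h V = {fst ` F | F. lower_face F (lifted_polytope h V)}"

definition regular_triangulation :: "'a::euclidean_space set set \<Rightarrow> bool" where
  "regular_triangulation K \<longleftrightarrow> (\<exists>h. K = induced_subdivision h (vertices K))"

definition dense_triangulation :: "'a::euclidean_space set \<Rightarrow> 'a set set \<Rightarrow> bool" where
  "dense_triangulation P K \<longleftrightarrow> vertices K = P \<inter> integer_lattice"

definition foldable_triangulation :: "'a::euclidean_space set set \<Rightarrow> bool" where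
  "foldable_triangulation K \<longleftrightarrow>
     (\<exists>c :: 'a \<Rightarrow> nat. (\<forall>v\<in>vertices K. c v < DIM('a) + 1) \<and>
        (\<forall>u\<in>vertices K. \<forall>v\<in>vertices K. u \<noteq> v \<and> closed_segment u v \<in> K \<longrightarrow> c u \<noteq> c v))"

definition rdf_triangulation :: "'a::euclidean_space set \<Rightarrow> 'a set set \<Rightarrow> bool" where
  "rdf_triangulation P K \<longleftrightarrow>
     polytope_triangulation P K \<and> regular_triangulation K \<and> dense_triangulation P K \<and>
     foldable_triangulation K"

definition adjacent_facets :: "'a::euclidean_space set \<Rightarrow> 'a set \<Rightarrow> bool" where
  "adjacent_facets S T \<longleftrightarrow> S \<noteq> T \<and> (int DIM('a) - 1) simplex (S \<inter> T)"

text \<open>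
  \<open>B\<close> and \<open>W\<close> are the black and the white facets. The dual graph of a foldable triangulation is
  connected and bipartite, so that this determines the two classes up to interchanging them;
  the signature below is symmetric in \<open>B\<close> and \<open>W\<close>.
\<close>

definition dual_bipartition ::
    "'a::euclidean_space set set \<Rightarrow> 'a set set \<Rightarrow> 'a set set \<Rightarrow> bool" where
  "dual_bipartition K B W \<longleftrightarrow>
     B \<union> W = facets K \<and> B \<inter> W = {} \<and>
     (\<forall>S\<in>facets K. \<forall>T\<in>facets K. adjacent_facets S T \<longrightarrow> (S \<in> B \<longleftrightarrow> T \<in> W))"

definition normalized_volume :: "'a::euclidean_space set \<Rightarrow> real" where
  "normalized_volume S = fact DIM('a) * measure lborel S"

definition odd_simplex :: "'a::euclidean_space set \<Rightarrow> bool" where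
  "odd_simplex S \<longleftrightarrow> (\<exists>k::int. odd k \<and> normalized_volume S = of_int k)"

definition bipartition_signature ::
    "'a::euclidean_space set set \<Rightarrow> 'a set set \<Rightarrow> int" where
  "bipartition_signature B W =
     \<bar>int (card {S \<in> B. odd_simplex S}) - int (card {S \<in> W. odd_simplex S})\<bar>"

text \<open>
  The value is meaningful only for polytopes that have an rdf-triangulation: otherwise the set
  is empty and \<^term>\<open>Max\<close> is unspecified. The set is finite, as a dense triangulation
  is determined by which sets of lattice points of \<open>P\<close> span its simplices.
\<close>

definition polytope_signature :: "'a::euclidean_space set \<Rightarrow> int" where
  "polytope_signature P =
     Max {bipartition_signature B W | K B W. rdf_triangulation P K \<and> dual_bipartition K B W}"

end

theory Submission
  imports Defs "Jordan_Normal_Form.Determinant"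
begin

text \<open>
  List the vertices of every facet in the order of their colours. Adjacent facets then differ in a single
  position, and their determinants have opposite signs; so the signature is the absolute value of the sum
  of the signs of the odd determinants. That facets with supporting functions of the heights
  cover the cube follows from the sum of their volumes.

  Given such a triangulation of \<open>[0,1]\<^sup>m\<close> and a triangulation of \<open>\<Delta>\<^sub>m \<times> [0,1]\<^sup>n\<close>, replace each cell
  \<open>S \<times> [0,1]\<^sup>n\<close> by a copy of the latter, identifying the vertices of \<open>S\<close> with those of \<open>\<Delta>\<^sub>m\<close> by colour.
  Determinants multiply, and hence so do the signed sums. For \<open>n = 2\<close> and odd \<open>m\<close>, staircases over
  the two triangles of the square, with vertices ranked along a zigzag, have signed sum \<open>m + 1\<close>; for \<open>n = 4\<close> and
  even \<open>m\<close>, staircases over a triangulation of the 4-cube with signature 2 have signed sum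
  \<open>(m/2 + 1) (m/2 + 2)\<close>. The inductions start with the 3-cube (signature 4), the 4-cube (signature 2) and the
  6-cube (signature 4), the last one being obtained from the 4-cube and a triangulation of
  \<open>\<Delta>\<^sub>4 \<times> [0,1]\<^sup>2\<close> with signed sum 2.
\<close>

section \<open>Families of simplices with supporting functions\<close>

no_notation Matrix.vec_index (infixl "$" 100)
no_notation Matrix.scalar_prod (infix "\<bullet>" 70)

text \<open>The two-dimensional step fails for even \<open>m\<close>: the sign
  \<open>(-1) ^ (t * (m + 2))\<close> is then 1, and the two oppositely oriented triangles of the
  square cancel. Hence even dimensions advance by four, from one base case for each even residue
  modulo 4. The steps reproduce the growth of the bound exactly: for \<open>m = 2 * k + 3\<close>
  the factor \<open>m + 1 = 2 * (k + 2)\<close> turns \<open>2 ^ (k + 2) * fact (k + 1)\<close> into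
  the next term, and for \<open>m = 2 * j\<close> the factor \<open>(j + 1) * (j + 2)\<close> turns
  \<open>fact j\<close> into \<open>fact (j + 2)\<close>. So the constants come from the base cases
  alone: 4 = 2^2 * 1!, 2 = 2! and 4 = 2/3 * 3!. The induction changes the dimension, which a type
  \<open>real ^ 'n\<close> fixes; so the constructions use integer lists and a natural number as
  dimension, and the passage to \<open>real ^ 'n\<close> is made once at the end. The inductive
  steps carry only supporting functions; that simplices meet in common faces is derived from these
  once, for the final triangulation.\<close>

definition lin :: "nat \<Rightarrow> (nat \<Rightarrow> real) \<Rightarrow> (nat \<Rightarrow> int) \<Rightarrow> real" where
  "lin N a x = (\<Sum>j<N. a j * of_int (x j))"

text \<open>The rows are homogeneous coordinates; for points of the cube, with leading entry 1, the
  absolute value is the normalized volume. The order of the list carries the orientation.\<close>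

definition detp :: "('v \<Rightarrow> nat \<Rightarrow> int) \<Rightarrow> nat \<Rightarrow> 'v list \<Rightarrow> int" where
  "detp p N F = Determinant.det (Matrix.mat N N (\<lambda>(k, j). p (F ! k) j))"

text \<open>In homogeneous coordinates an affine function is a functional \<open>lin N a\<close>, so
  that one definition serves cubes and prisms. Equality exactly on \<open>set F\<close> leaves a
  positive gap at every other vertex; these gaps later absorb added finer heights.\<close>

definition regular_family ::
    "('v \<Rightarrow> nat \<Rightarrow> int) \<Rightarrow> nat \<Rightarrow> 'v set \<Rightarrow> ('v \<Rightarrow> real) \<Rightarrow> 'v list set \<Rightarrow> bool" where
  "regular_family p N V h \<Phi> \<longleftrightarrow> finite V \<and> finite \<Phi> \<and>
     (\<forall>F\<in>\<Phi>. length F = N \<and> set F \<subseteq> V \<and> detp p N F \<noteq> 0 \<and>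
       (\<exists>a. \<forall>v\<in>V. lin N a (p v) \<le> h v \<and> (lin N a (p v) = h v \<longleftrightarrow> v \<in> set F)))"

definition coloured :: "('v \<Rightarrow> nat) \<Rightarrow> nat \<Rightarrow> 'v list set \<Rightarrow> bool" where
  "coloured c N \<Phi> \<longleftrightarrow> (\<forall>F\<in>\<Phi>. \<forall>k<N. c (F ! k) = k)"

text \<open>
  The contribution to the signature of a facet with determinant \<open>x\<close>.
\<close>

definition osgn :: "int \<Rightarrow> int" where
  "osgn x = (if odd x then sgn x else 0)"

lemma osgn_mult: "osgn (x * y) = osgn x * osgn y"
  by (simp add: osgn_def sgn_mult)

lemma osgn_unit: "\<bar>x\<bar> = 1 \<Longrightarrow> osgn x = x"
  by (auto simp: osgn_def abs_if split: if_splits)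

lemma lin_add_scaled:
  "lin N (\<lambda>j. r * a j + b j) x = r * lin N a x + lin N b x"
  by (simp add: lin_def sum.distrib sum_distrib_left algebra_simps)

lemma lin_sum:
  "lin N (\<lambda>j. \<Sum>l\<in>L. y l * B l j) x = (\<Sum>l\<in>L. y l * lin N (B l) x)"
  unfolding lin_def sum_distrib_left sum_distrib_right
  by (subst sum.swap) (simp add: mult.assoc)

text \<open>The coefficients of the \<open>l\<close>-th functional are column \<open>l\<close> of
  the adjugate divided by the determinant; the two claims are the products of the matrix with its
  adjugate in either order. For points of the cube these are the barycentric coordinates with
  respect to \<open>F\<close>.\<close>

lemma dual_basis:
  assumes "detp p N F \<noteq> 0"
  obtains B where "\<And>k l. k < N \<Longrightarrow> l < N \<Longrightarrow> lin N (B l) (p (F ! k)) = (if k = l then 1 else 0)"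
    and "\<And>y x. x < N \<Longrightarrow> real_of_int (y x) = (\<Sum>j<N. lin N (B j) y * of_int (p (F ! j) x))"
proof -
  define A where "A = Matrix.mat N N (\<lambda>(k, j). p (F ! k) j)"
  have A: "A \<in> carrier_mat N N" by (simp add: A_def)
  define d where "d = detp p N F"
  have d: "Determinant.det A = d" by (simp add: A_def d_def detp_def)
  have d0: "real_of_int d \<noteq> 0" using assms d_def by simp
  note adj = adj_mat[OF A]
  define B where "B = (\<lambda>l j. of_int (adj_mat A $$ (j, l)) / of_int d :: real)"
  have 1: "lin N (B l) (p (F ! k)) = (if k = l then 1 else 0)" if "k < N" "l < N" for k l
  proof -
    have "(A * adj_mat A) $$ (k, l) = (\<Sum>j<N. p (F ! k) j * adj_mat A $$ (j, l))"
      using that adj(1) A by (auto simp: scalar_prod_def A_def intro!: sum.cong)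
    moreover have "(A * adj_mat A) $$ (k, l) = (if k = l then d else 0)"
      unfolding adj(2) d using that by simp
    ultimately have eq: "(\<Sum>j<N. p (F ! k) j * adj_mat A $$ (j, l)) = (if k = l then d else 0)"
      by simp
    have "lin N (B l) (p (F ! k)) = of_int (\<Sum>j<N. p (F ! k) j * adj_mat A $$ (j, l)) / of_int d"
      by (simp add: lin_def B_def sum_divide_distrib mult.commute)
    then show ?thesis unfolding eq using d0 by auto
  qed
  have 2: "real_of_int (y x) = (\<Sum>j<N. lin N (B j) y * of_int (p (F ! j) x))" if x: "x < N" for y x
  proof -
    have inv: "(\<Sum>j<N. B j i * of_int (p (F ! j) x)) = (if i = x then 1 else 0)" if i: "i < N" for i
    proof -
      have "(adj_mat A * A) $$ (i, x) = (\<Sum>j<N. adj_mat A $$ (i, j) * p (F ! j) x)"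
        using i x adj(1) A by (auto simp: scalar_prod_def A_def intro!: sum.cong)
      moreover have "(adj_mat A * A) $$ (i, x) = (if i = x then d else 0)"
        unfolding adj(3) d using i x by simp
      ultimately have eq: "(\<Sum>j<N. adj_mat A $$ (i, j) * p (F ! j) x) = (if i = x then d else 0)"
        by simp
      have "(\<Sum>j<N. B j i * of_int (p (F ! j) x)) =
          of_int (\<Sum>j<N. adj_mat A $$ (i, j) * p (F ! j) x) / of_int d"
        by (simp add: B_def sum_divide_distrib)
      then show ?thesis unfolding eq using d0 by auto
    qed
    have "(\<Sum>j<N. lin N (B j) y * of_int (p (F ! j) x)) =
        (\<Sum>i<N. of_int (y i) * (\<Sum>j<N. B j i * of_int (p (F ! j) x)))"
      unfolding lin_def sum_distrib_left sum_distrib_right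
      by (subst sum.swap) (simp add: mult_ac)
    also have "\<dots> = (\<Sum>i<N. if i = x then of_int (y i) else 0)"
      by (rule sum.cong) (auto simp: inv)
    finally show ?thesis using x by simp
  qed
  show thesis by (rule that[OF 1 2])
qed

lemma interpolation:
  assumes "detp p N F \<noteq> 0"
  obtains B where "\<And>k l. k < N \<Longrightarrow> l < N \<Longrightarrow> lin N (B l) (p (F ! k)) = (if k = l then 1 else 0)"
  using dual_basis[OF assms] by metis

section \<open>Determinants by factorisation of the rows\<close>

lemma det_as_product:
  assumes "\<And>k x. k < N \<Longrightarrow> x < N \<Longrightarrow> f k x = (\<Sum>l<N. r k l * b l x)"
  shows "Determinant.det (Matrix.mat N N (\<lambda>(k, x). f k x)) =
    Determinant.det (Matrix.mat N N (\<lambda>(k, x). r k x)) *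
    Determinant.det (Matrix.mat N N (\<lambda>(k, x). b k x) :: 'a::comm_ring_1 mat)"
proof -
  have "Matrix.mat N N (\<lambda>(k, x). f k x) =
      Matrix.mat N N (\<lambda>(k, x). r k x) * Matrix.mat N N (\<lambda>(k, x). b k x)"
    by (rule eq_matI)
      (auto simp: scalar_prod_def assms simp flip: atLeast0LessThan intro!: sum.cong)
  then show ?thesis by (simp add: Determinant.det_mult[where n = N])
qed

lemma det_block_upper:
  fixes f :: "nat \<Rightarrow> nat \<Rightarrow> 'a::idom"
  assumes "\<And>k x. m \<le> k \<Longrightarrow> k < m + n \<Longrightarrow> x < m \<Longrightarrow> f k x = 0"
  shows "Determinant.det (Matrix.mat (m + n) (m + n) (\<lambda>(k, x). f k x)) =
    Determinant.det (Matrix.mat m m (\<lambda>(k, x). f k x)) *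
    Determinant.det (Matrix.mat n n (\<lambda>(k, x). f (m + k) (m + x)))"
proof -
  have "Matrix.mat (m + n) (m + n) (\<lambda>(k, x). f k x) =
     four_block_mat (Matrix.mat m m (\<lambda>(k, x). f k x)) (Matrix.mat m n (\<lambda>(k, x). f k (m + x)))
       (0\<^sub>m n m) (Matrix.mat n n (\<lambda>(k, x). f (m + k) (m + x)))"
    by (rule eq_matI) (auto simp: assms four_block_mat_def Let_def)
  then show ?thesis
    by (simp add: det_four_block_mat_lower_left_zero[where n = m and m = n])
qed

lemma det_unitriangular:
  fixes f :: "nat \<Rightarrow> nat \<Rightarrow> 'a::idom"
  assumes "\<And>k x. k < x \<Longrightarrow> x < n \<Longrightarrow> f k x = 0" "\<And>k. k < n \<Longrightarrow> f k k = 1"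
  shows "Determinant.det (Matrix.mat n n (\<lambda>(k, x). f k x)) = 1"
proof -
  have "Determinant.det (Matrix.mat n n (\<lambda>(k, x). f k x)) =
      prod_list (diag_mat (Matrix.mat n n (\<lambda>(k, x). f k x)))"
    by (rule det_lower_triangular[where n = n]) (auto simp: assms)
  also have "diag_mat (Matrix.mat n n (\<lambda>(k, x). f k x)) = replicate n 1"
    by (rule nth_equalityI) (auto simp: diag_mat_def assms)
  finally show ?thesis by simp
qed

lemma det_id_mat_fun:
  "Determinant.det (Matrix.mat n n (\<lambda>(k, x). if k = x then 1 else 0 :: 'a::idom)) = 1"
  by (rule det_unitriangular) auto

text \<open>The shift is multiplication by the cyclic permutation matrix \<open>C\<close>, whose
  first column has its only entry in the last row, with the identity as complementary minor.\<close>

lemma detp_rotate1: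
  assumes "length F = Suc N"
  shows "detp p (Suc N) (rotate1 F) = (-1) ^ N * detp p (Suc N) F"
proof -
  define C where "C = (\<lambda>k l. if l = Suc k mod Suc N then 1 else 0 :: int)"
  let ?C = "Matrix.mat (Suc N) (Suc N) (\<lambda>(k, x). C k x)"
  have "detp p (Suc N) (rotate1 F) = Determinant.det ?C * detp p (Suc N) F"
    unfolding detp_def
  proof (rule det_as_product)
    fix k x assume "k < Suc N" "x < Suc N"
    then have "rotate1 F ! k = F ! (Suc k mod Suc N)"
      using assms nth_rotate[of k F 1] by simp
    moreover have "Suc k mod Suc N < Suc N" by (rule mod_less_divisor) simp
    ultimately show "p (rotate1 F ! k) x = (\<Sum>l<Suc N. C k l * p (F ! l) x)"
      unfolding C_def by (simp add: if_distrib[of "\<lambda>z. z * _"] del: sum.lessThan_Suc mod_Suc_eq cong: if_cong)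
  qed
  moreover have "Determinant.det ?C = (-1) ^ N"
  proof -
    have "Determinant.det ?C = (\<Sum>i<Suc N. ?C $$ (i, 0) * cofactor ?C i 0)"
      by (rule laplace_expansion_column) auto
    also have "\<dots> = (\<Sum>i<Suc N. if i = N then cofactor ?C N 0 else 0)"
      by (rule sum.cong) (auto simp: C_def mod_Suc)
    also have "\<dots> = (-1) ^ N * Determinant.det (mat_delete ?C N 0)"
      by (simp add: cofactor_def)
    also have "mat_delete ?C N 0 = Matrix.mat N N (\<lambda>(k, x). if k = x then 1 else 0)"
      by (rule eq_matI) (auto simp: mat_delete_def C_def mod_Suc)
    finally show ?thesis by (simp add: det_id_mat_fun)
  qed
  ultimately show ?thesis by simp
qed

lemma detp_rotate:
  assumes "length F = Suc N"
  shows "detp p (Suc N) (rotate r F) = (-1) ^ (N * r) * detp p (Suc N) F"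
proof (induction r)
  case (Suc r)
  then show ?case
    using detp_rotate1[of "rotate r F" N p] assms by (simp add: power_add)
qed simp

text \<open>A large multiple of a strict gap beats any error on a finite set. Every refinement of
  heights below rests on this.\<close>

lemma scale_dominates:
  assumes "finite X" "\<And>x. x \<in> X \<Longrightarrow> 0 < f x"
  obtains M :: real where "\<And>x. x \<in> X \<Longrightarrow> e x < M * f x"
proof -
  have "\<exists>M. \<forall>x\<in>X. e x < M * f x" using assms
  proof (induction X rule: finite_induct)
    case (insert y X)
    then obtain M where M: "\<forall>x\<in>X. e x < M * f x" by auto
    have y: "0 < f y" using insert by simp
    show ?case
    proof (intro exI[of _ "max M (e y / f y + 1)"] ballI)
      fix x assume x: "x \<in> insert y X"
      show "e x < max M (e y / f y + 1) * f x"
      proof (cases "x = y")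
        case True
        have "e y < (e y / f y + 1) * f y" using y by (simp add: field_simps)
        also have "\<dots> \<le> max M (e y / f y + 1) * f y" using y by (intro mult_right_mono) auto
        finally show ?thesis using True by simp
      next
        case False
        then have "e x < M * f x" using M x by auto
        also have "\<dots> \<le> max M (e y / f y + 1) * f x"
          using insert.prems[of x] x by (intro mult_right_mono) auto
        finally show ?thesis .
      qed
    qed
  qed simp
  then show thesis using that by blast
qed

section \<open>Substituting a triangulation of a prism\<close>

definition cube :: "nat \<Rightarrow> int list set" where
  "cube n = {v. length v = n \<and> set v \<subseteq> {0, 1}}"

definition cpt :: "int list \<Rightarrow> nat \<Rightarrow> int" where
  "cpt v j = (1 # v) ! j"

text \<open>
  The vertex \<open>(e\<^sub>i, w)\<close> of \<open>\<Delta>\<^sub>m \<times> [0,1]\<^sup>n\<close> has the homogeneous coordinates \<open>e\<^sub>i @ w\<close> with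
  \<open>e\<^sub>i\<close> of length \<open>m + 1\<close>. The sum of the determinants is then \<open>(m + n)!\<close> times
  the volume \<open>1 / m!\<close>.
\<close>

definition spt :: "nat \<Rightarrow> nat \<times> int list \<Rightarrow> nat \<Rightarrow> int" where
  "spt m = (\<lambda>(i, w) j. if j \<le> m then if j = i then 1 else 0 else w ! (j - Suc m))"

definition cube_family ::
    "nat \<Rightarrow> (int list \<Rightarrow> real) \<Rightarrow> (int list \<Rightarrow> nat) \<Rightarrow> int list list set \<Rightarrow> int \<Rightarrow> bool" where
  "cube_family m h c \<Phi> u \<longleftrightarrow> regular_family cpt (Suc m) (cube m) h \<Phi> \<and> coloured c (Suc m) \<Phi> \<and>
     (\<Sum>F\<in>\<Phi>. \<bar>detp cpt (Suc m) F\<bar>) = fact m \<and> (\<Sum>F\<in>\<Phi>. osgn (detp cpt (Suc m) F)) = u"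

definition prism_family ::
    "nat \<Rightarrow> nat \<Rightarrow> (nat \<times> int list \<Rightarrow> real) \<Rightarrow> (nat \<times> int list \<Rightarrow> nat) \<Rightarrow>
      (nat \<times> int list) list set \<Rightarrow> int \<Rightarrow> bool" where
  "prism_family m n g \<gamma> \<Psi> u \<longleftrightarrow>
     regular_family (spt m) (Suc (m + n)) ({..m} \<times> cube n) g \<Psi> \<and> coloured \<gamma> (Suc (m + n)) \<Psi> \<and>
     fact m * (\<Sum>F\<in>\<Psi>. \<bar>detp (spt m) (Suc (m + n)) F\<bar>) = fact (m + n) \<and>
     (\<Sum>F\<in>\<Psi>. osgn (detp (spt m) (Suc (m + n)) F)) = u"

lemma finite_cube: "finite (cube n)"
  using finite_lists_length_eq[of "{0, 1 :: int}" n] by (simp add: cube_def conj_commute)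

lemma cpt_append:
  assumes "length v = m"
  shows "cpt (v @ w) j = (if j \<le> m then cpt v j else w ! (j - Suc m))"
  using assms nth_append[of "1 # v" w j] by (auto simp: cpt_def)

lemma append_mem_cube: "v \<in> cube m \<Longrightarrow> w \<in> cube n \<Longrightarrow> v @ w \<in> cube (m + n)"
  by (auto simp: cube_def)

lemma mem_cube_add:
  assumes "x \<in> cube (m + n)"
  shows "take m x \<in> cube m" "drop m x \<in> cube n"
  using assms by (auto simp: cube_def dest: in_set_takeD in_set_dropD)

lemma sum_lessThan_Suc_add:
  fixes f :: "nat \<Rightarrow> 'a::comm_monoid_add"
  shows "(\<Sum>j<Suc (m + n). f j) = (\<Sum>j\<le>m. f j) + (\<Sum>j<n. f (Suc (m + j)))"
proof (induction n)
  case 0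
  then show ?case by (simp add: lessThan_Suc_atMost)
next
  case (Suc n)
  then show ?case by (simp add: add.assoc)
qed

lemma lin_spt:
  assumes "i \<le> m"
  shows "lin (Suc (m + n)) a (spt m (i, w)) = a i + (\<Sum>j<n. a (Suc (m + j)) * of_int (w ! j))"
  unfolding lin_def sum_lessThan_Suc_add
  using assms by (simp add: spt_def if_distrib[of "\<lambda>z. _ * real_of_int z"] cong: if_cong)

lemma lin_cpt_append:
  assumes "length v = m"
  shows "lin (Suc (m + n)) a (cpt (v @ w)) =
    lin (Suc m) a (cpt v) + (\<Sum>j<n. a (Suc (m + j)) * of_int (w ! j))"
  unfolding lin_def sum_lessThan_Suc_add
  by (simp add: cpt_append[OF assms] lessThan_Suc_atMost)

text \<open>The image of \<open>F\<close> under the affine map of the prism onto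
  \<open>conv S x [0,1]^n\<close> that sends \<open>e_i\<close> to \<open>S ! i\<close>.\<close>

definition subst_facet :: "int list list \<Rightarrow> (nat \<times> int list) list \<Rightarrow> int list list" where
  "subst_facet S F = map (\<lambda>(i, w). S ! i @ w) F"

text \<open>In homogeneous coordinates this map is the block diagonal matrix \<open>b\<close>, with
  the vertices of \<open>S\<close> as rows of one block and the identity as the other.\<close>

lemma detp_subst_facet:
  assumes S: "length S = Suc m" "set S \<subseteq> cube m"
    and F: "length F = Suc (m + n)" "set F \<subseteq> {..m} \<times> cube n"
  shows "detp cpt (Suc (m + n)) (subst_facet S F) = detp (spt m) (Suc (m + n)) F * detp cpt (Suc m) S"
proof -
  define b where "b = (\<lambda>l x. if l \<le> m then if x \<le> m then cpt (S ! l) x else 0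
    else if x = l then 1 else 0 :: int)"
  let ?N = "Suc (m + n)"
  have "detp cpt ?N (subst_facet S F) =
      detp (spt m) ?N F * Determinant.det (Matrix.mat ?N ?N (\<lambda>(k, x). b k x))"
    unfolding detp_def
  proof (rule det_as_product)
    fix k x assume k: "k < ?N" and x: "x < ?N"
    obtain i w where iw: "F ! k = (i, w)" by (cases "F ! k")
    have "F ! k \<in> set F" using k F by simp
    then have i: "i \<le> m" and w: "w \<in> cube n" using F iw by auto
    have "S ! i \<in> cube m" using S i by (auto simp: subset_iff)
    then have len: "length (S ! i) = m" by (simp add: cube_def)
    have "(\<Sum>l<?N. spt m (i, w) l * b l x) =
        (\<Sum>l\<le>m. if l = i then b l x else 0) + (\<Sum>j<n. w ! j * b (Suc (m + j)) x)"
      unfolding sum_lessThan_Suc_add by (intro arg_cong2[where f = "(+)"] sum.cong) (auto simp: spt_def)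
    also have "(\<Sum>l\<le>m. if l = i then b l x else 0) = b i x" using i by simp
    also have "(\<Sum>j<n. w ! j * b (Suc (m + j)) x) = (if x \<le> m then 0 else w ! (x - Suc m))"
    proof (cases "x \<le> m")
      case False
      then have "(\<Sum>j<n. w ! j * b (Suc (m + j)) x) = (\<Sum>j<n. if j = x - Suc m then w ! j else 0)"
        by (intro sum.cong) (auto simp: b_def)
      also have "\<dots> = w ! (x - Suc m)" using x False by simp
      finally show ?thesis using False by simp
    qed (auto simp: b_def intro!: sum.neutral)
    also have "b i x + (if x \<le> m then 0 else w ! (x - Suc m)) = cpt (S ! i @ w) x"
      using i by (auto simp: b_def cpt_append[OF len])
    finally show "cpt (subst_facet S F ! k) x = (\<Sum>l<?N. spt m (F ! k) l * b l x)"
      using k F iw by (simp add: subst_facet_def)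
  qed
  also have "Determinant.det (Matrix.mat ?N ?N (\<lambda>(k, x). b k x)) =
      Determinant.det (Matrix.mat (Suc m) (Suc m) (\<lambda>(k, x). b k x)) *
      Determinant.det (Matrix.mat n n (\<lambda>(k, x). b (Suc m + k) (Suc m + x)))"
    using det_block_upper[of "Suc m" n b] by (simp add: b_def)
  also have "Determinant.det (Matrix.mat n n (\<lambda>(k, x). b (Suc m + k) (Suc m + x))) = 1"
    by (rule det_unitriangular) (auto simp: b_def)
  also have "Matrix.mat (Suc m) (Suc m) (\<lambda>(k, x). b k x) =
      Matrix.mat (Suc m) (Suc m) (\<lambda>(k, x). cpt (S ! k) x)"
    by (rule eq_matI) (auto simp: b_def)
  finally show ?thesis by (simp add: detp_def)
qed

text \<open>
  The coarse heights are scaled up so that the triangulation refines the subdivision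
  of the product into the cells \<open>conv S \<times> [0,1]^n\<close>.
\<close>

theorem cube_family_prism:
  assumes K: "cube_family m h c \<Phi> u" and G: "prism_family m n g \<gamma> \<Psi> u'"
  shows "\<exists>h c \<Phi>. cube_family (m + n) h c \<Phi> (u * u')"
proof -
  let ?N = "Suc (m + n)"
  have reg: "regular_family cpt (Suc m) (cube m) h \<Phi>"
    and col: "coloured c (Suc m) \<Phi>"
    and vol: "(\<Sum>F\<in>\<Phi>. \<bar>detp cpt (Suc m) F\<bar>) = fact m"
    and sig: "(\<Sum>F\<in>\<Phi>. osgn (detp cpt (Suc m) F)) = u"
    using K unfolding cube_family_def by auto
  have reg': "regular_family (spt m) ?N ({..m} \<times> cube n) g \<Psi>"
    and col': "coloured \<gamma> ?N \<Psi>"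
    and vol': "fact m * (\<Sum>F\<in>\<Psi>. \<bar>detp (spt m) ?N F\<bar>) = fact (m + n)"
    and sig': "(\<Sum>F\<in>\<Psi>. osgn (detp (spt m) ?N F)) = u'"
    using G unfolding prism_family_def by auto
  have fin: "finite \<Phi>" "finite \<Psi>" using reg reg' unfolding regular_family_def by auto
  have lenS: "length S = Suc m" and subS: "set S \<subseteq> cube m" and detS: "detp cpt (Suc m) S \<noteq> 0"
    if "S \<in> \<Phi>" for S using reg that unfolding regular_family_def by auto
  have lenF: "length F = ?N" and subF: "set F \<subseteq> {..m} \<times> cube n" and detF: "detp (spt m) ?N F \<noteq> 0"
    if "F \<in> \<Psi>" for F using reg' that unfolding regular_family_def by auto
  have cS: "c (S ! i) = i" if "S \<in> \<Phi>" "i \<le> m" for S i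
    using col that unfolding coloured_def by auto
  have cF: "\<gamma> (F ! k) = k" if "F \<in> \<Psi>" "k < ?N" for F k
    using col' that unfolding coloured_def by auto
  have Smem: "S ! i \<in> cube m" if "S \<in> \<Phi>" "i \<le> m" for S i
    using subS[OF that(1)] lenS[OF that(1)] that(2) by (auto simp: subset_iff)
  have Slen: "length (S ! i) = m" if "S \<in> \<Phi>" "i \<le> m" for S i
    using Smem[OF that] by (simp add: cube_def)
  have Fmem: "fst (F ! k) \<le> m \<and> snd (F ! k) \<in> cube n" if "F \<in> \<Psi>" "k < ?N" for F k
  proof -
    have "F ! k \<in> set F" using lenF[OF that(1)] that(2) by simp
    then have "F ! k \<in> {..m} \<times> cube n" using subF[OF that(1)] by blast
    then show ?thesis by (auto simp: mem_Times_iff)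
  qed
  have "\<forall>S\<in>\<Phi>. \<exists>a. \<forall>v\<in>cube m. lin (Suc m) a (cpt v) \<le> h v \<and> (lin (Suc m) a (cpt v) = h v \<longleftrightarrow> v \<in> set S)"
    using reg unfolding regular_family_def by auto
  then obtain a where a: "\<And>S v. S \<in> \<Phi> \<Longrightarrow> v \<in> cube m \<Longrightarrow>
      lin (Suc m) (a S) (cpt v) \<le> h v \<and> (lin (Suc m) (a S) (cpt v) = h v \<longleftrightarrow> v \<in> set S)"
    by metis
  have "\<forall>F\<in>\<Psi>. \<exists>b. \<forall>x\<in>{..m} \<times> cube n.
      lin ?N b (spt m x) \<le> g x \<and> (lin ?N b (spt m x) = g x \<longleftrightarrow> x \<in> set F)"
    using reg' unfolding regular_family_def by auto
  then obtain b where b: "\<And>F x. F \<in> \<Psi> \<Longrightarrow> x \<in> {..m} \<times> cube n \<Longrightarrow>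
      lin ?N (b F) (spt m x) \<le> g x \<and> (lin ?N (b F) (spt m x) = g x \<longleftrightarrow> x \<in> set F)"
    by metis
  have "\<forall>S\<in>\<Phi>. \<exists>B. \<forall>k<Suc m. \<forall>l<Suc m. lin (Suc m) (B l) (cpt (S ! k)) = (if k = l then 1 else 0)"
    using detS interpolation by metis
  then obtain B where B: "\<And>S k l. S \<in> \<Phi> \<Longrightarrow> k \<le> m \<Longrightarrow> l \<le> m \<Longrightarrow>
      lin (Suc m) (B S l) (cpt (S ! k)) = (if k = l then 1 else 0)"
    by (metis less_Suc_eq_le)
  define tl where "tl = (\<lambda>F w. \<Sum>j<n. b F (Suc (m + j)) * real_of_int (w ! j))"
  \<comment> \<open>At a vertex over \<open>v\<close> outside \<open>S\<close>, \<open>q\<close> is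
    the amount by which the fine part of the intended supporting function exceeds the fine height;
    \<open>M\<close> times the coarse gap at \<open>v\<close> has to beat it.\<close>
  define q where "q = (\<lambda>(S, F, v, w). (\<Sum>l\<le>m. b F l * lin (Suc m) (B S l) (cpt v)) + tl F w - g (c v, w))"
  define X where "X = {(S, F, v, w). S \<in> \<Phi> \<and> F \<in> \<Psi> \<and> v \<in> cube m \<and> w \<in> cube n \<and> v \<notin> set S}"
  have "finite X"
    by (rule finite_subset[of _ "\<Phi> \<times> \<Psi> \<times> cube m \<times> cube n"])
      (auto simp: X_def fin finite_cube)
  moreover have "0 < (\<lambda>(S, F, v, w). h v - lin (Suc m) (a S) (cpt v)) x" if "x \<in> X" for x
    using that a by (force simp: X_def less_le)
  ultimately obtain M where M: "\<And>x. x \<in> X \<Longrightarrow> q x < M * (\<lambda>(S, F, v, w). h v - lin (Suc m) (a S) (cpt v)) x"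
    using scale_dominates by blast
  \<comment> \<open>The fine height is that of the prism vertex whose index is the colour of the
    base vertex, so it does not depend on the cell.\<close>
  define H where "H = (\<lambda>x. M * h (take m x) + g (c (take m x), drop m x))"
  define C where "C = (\<lambda>x. \<gamma> (c (take m x), drop m x))"
  define \<Theta> where "\<Theta> = (\<lambda>(S, F). subst_facet S F) ` (\<Phi> \<times> \<Psi>)"
  have nth: "subst_facet S F ! k = S ! fst (F ! k) @ snd (F ! k)" if "F \<in> \<Psi>" "k < ?N" for S F k
    using lenF[OF that(1)] that(2) by (simp add: subst_facet_def case_prod_unfold)
  have Fcol: "(c (take m (subst_facet S F ! k)), drop m (subst_facet S F ! k)) = F ! k"
    if "S \<in> \<Phi>" "F \<in> \<Psi>" "k < ?N" for S F k
    using that Fmem[OF that(2,3)] by (simp add: nth Slen cS)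
  have det: "detp cpt ?N (subst_facet S F) = detp (spt m) ?N F * detp cpt (Suc m) S"
    if "S \<in> \<Phi>" "F \<in> \<Psi>" for S F
    using that by (intro detp_subst_facet lenS subS lenF subF)
  \<comment> \<open>An index missing from \<open>F\<close> would leave a zero column in its matrix.
    Hence all of \<open>S\<close> can be read off the substituted facet, which gives
    injectivity.\<close>
  have occurs: "\<exists>k<?N. fst (F ! k) = i" if F: "F \<in> \<Psi>" and i: "i \<le> m" for F i
  proof (rule ccontr)
    assume "\<not> ?thesis"
    then have no: "fst (F ! k) \<noteq> i" if "k < ?N" for k using that by blast
    obtain D where D: "\<And>k l. k < ?N \<Longrightarrow> l < ?N \<Longrightarrow> lin ?N (D l) (spt m (F ! k)) = (if k = l then 1 else 0)"
      using interpolation[OF detF[OF F]] by blast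
    let ?A = "Matrix.mat ?N ?N (\<lambda>(k, j). spt m (F ! k) j)"
    have "Determinant.det ?A = (\<Sum>k<?N. ?A $$ (k, i) * cofactor ?A k i)"
      by (rule laplace_expansion_column) (use i in auto)
    also have "\<dots> = 0"
      using no i by (intro sum.neutral) (auto simp: spt_def case_prod_unfold)
    finally show False using detF[OF F] by (simp add: detp_def)
  qed
  have inj: "inj_on (\<lambda>(S, F). subst_facet S F) (\<Phi> \<times> \<Psi>)"
  proof (rule inj_onI, clarify)
    fix S F S' F' assume mem: "S \<in> \<Phi>" "F \<in> \<Psi>" "S' \<in> \<Phi>" "F' \<in> \<Psi>"
      and eq: "subst_facet S F = subst_facet S' F'"
    have FF: "F = F'"
      using Fcol[OF mem(1,2)] Fcol[OF mem(3,4)] lenF mem eq by (intro nth_equalityI) auto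
    have "S = S'"
    proof (rule nth_equalityI)
      fix i assume "i < length S"
      then have i: "i \<le> m" using lenS mem by auto
      obtain k where k: "k < ?N" "fst (F ! k) = i" using occurs[OF mem(2) i] by blast
      have "take m (subst_facet S F ! k) = take m (subst_facet S' F' ! k)" using eq by simp
      then show "S ! i = S' ! i" using k i mem FF by (simp add: nth Slen)
    qed (use lenS mem in auto)
    with FF show "S = S' \<and> F = F'" by simp
  qed
  have cert: "length L = ?N \<and> set L \<subseteq> cube (m + n) \<and> detp cpt ?N L \<noteq> 0 \<and>
      (\<exists>e. \<forall>x\<in>cube (m + n). lin ?N e (cpt x) \<le> H x \<and> (lin ?N e (cpt x) = H x \<longleftrightarrow> x \<in> set L))"
    if L\<Theta>: "L \<in> \<Theta>" for L
  proof -
    obtain S F where L: "L = subst_facet S F" and mem: "S \<in> \<Phi>" "F \<in> \<Psi>"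
      using L\<Theta> unfolding \<Theta>_def by auto
    have len: "length L = ?N" using lenF mem by (simp add: L subst_facet_def)
    have sub: "set L \<subseteq> cube (m + n)"
    proof
      fix x assume "x \<in> set L"
      then obtain k where k: "k < ?N" "x = L ! k" using len by (auto simp: in_set_conv_nth)
      then show "x \<in> cube (m + n)"
        using mem Fmem[OF mem(2) k(1)] Smem[OF mem(1)] by (simp add: L nth append_mem_cube)
    qed
    \<comment> \<open>The functional of \<open>F\<close> is pulled back along the coordinates
      \<open>B S\<close>. Over vertices of \<open>S\<close> this restores its value exactly; over
      all others the multiple of \<open>a S\<close> takes over.\<close>
    define e where "e = (\<lambda>j. if j \<le> m then M * a S j + (\<Sum>l\<le>m. b F l * B S l j) else b F j)"
    have lin_e: "lin ?N e (cpt (v @ w)) = M * lin (Suc m) (a S) (cpt v) +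
        (\<Sum>l\<le>m. b F l * lin (Suc m) (B S l) (cpt v)) + tl F w" if "length v = m" for v w
    proof -
      have "lin (Suc m) e (cpt v) = lin (Suc m) (\<lambda>j. M * a S j + (\<Sum>l\<le>m. b F l * B S l j)) (cpt v)"
        unfolding lin_def by (rule sum.cong) (auto simp: e_def)
      then show ?thesis
        unfolding lin_cpt_append[OF that] lin_add_scaled lin_sum by (simp add: tl_def e_def)
    qed
    have "lin ?N e (cpt x) \<le> H x \<and> (lin ?N e (cpt x) = H x \<longleftrightarrow> x \<in> set L)" if x: "x \<in> cube (m + n)" for x
    proof -
      define v w where "v = take m x" and "w = drop m x"
      have v: "v \<in> cube m" "length v = m" and w: "w \<in> cube n" and xvw: "x = v @ w"
        using mem_cube_add[OF x] by (auto simp: v_def w_def cube_def)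
      have H: "H x = M * h v + g (c v, w)" by (simp add: H_def v_def w_def)
      show ?thesis
      proof (cases "v \<in> set S")
        case True
        then obtain i where i: "i \<le> m" "v = S ! i"
          using lenS[OF mem(1)] by (auto simp: in_set_conv_nth less_Suc_eq_le)
        have "(\<Sum>l\<le>m. b F l * lin (Suc m) (B S l) (cpt v)) = (\<Sum>l\<le>m. if l = i then b F l else 0)"
          using B[OF mem(1) i(1)] i(2) by (intro sum.cong) auto
        then have "lin ?N e (cpt x) = M * h v + lin ?N (b F) (spt m (i, w))"
          using a[OF mem(1) v(1)] True
          unfolding xvw lin_e[OF v(2)] lin_spt[OF i(1)] by (simp add: i(1) tl_def)
        moreover have "H x = M * h v + g (i, w)" using H cS[OF mem(1) i(1)] i by simp
        moreover have "x \<in> set L \<longleftrightarrow> (i, w) \<in> set F"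
        proof
          assume "x \<in> set L"
          then obtain k where k: "k < ?N" "x = L ! k" using len by (auto simp: in_set_conv_nth)
          have "F ! k = (c (take m x), drop m x)" using Fcol[OF mem k(1)] k by (simp add: L)
          also have "\<dots> = (i, w)" using cS[OF mem(1) i(1)] i by (simp add: v_def w_def)
          finally show "(i, w) \<in> set F" using k lenF[OF mem(2)] by (metis nth_mem)
        next
          assume "(i, w) \<in> set F"
          then show "x \<in> set L" using i by (force simp: L subst_facet_def xvw)
        qed
        ultimately show ?thesis using b[OF mem(2), of "(i, w)"] i(1) w by auto
      next
        case False
        then have "(S, F, v, w) \<in> X" using mem v w by (simp add: X_def)
        then have "lin ?N e (cpt x) < H x"
          using M[of "(S, F, v, w)"] by (simp add: xvw lin_e[OF v(2)] H[unfolded xvw] q_def algebra_simps)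
        moreover have "x \<notin> set L"
        proof
          assume "x \<in> set L"
          then obtain k where k: "k < ?N" "x = L ! k" using len by (auto simp: in_set_conv_nth)
          then have "v = S ! fst (F ! k)"
            using mem Fmem[OF mem(2) k(1)] by (simp add: v_def L nth Slen)
          then show False using False Fmem[OF mem(2) k(1)] lenS[OF mem(1)] by (auto simp: less_Suc_eq_le)
        qed
        ultimately show ?thesis by simp
      qed
    qed
    moreover have "detp cpt ?N L \<noteq> 0" using det[OF mem] detS detF mem by (simp add: L)
    ultimately show ?thesis using len sub by blast
  qed
  have "regular_family cpt ?N (cube (m + n)) H \<Theta>"
    unfolding regular_family_def using cert fin by (simp add: \<Theta>_def finite_cube)
  moreover have "coloured C ?N \<Theta>"
    unfolding coloured_def C_def \<Theta>_def using Fcol cF by auto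
  moreover have "(\<Sum>L\<in>\<Theta>. \<bar>detp cpt ?N L\<bar>) = fact (m + n)"
  proof -
    have "(\<Sum>L\<in>\<Theta>. \<bar>detp cpt ?N L\<bar>) = (\<Sum>(S, F)\<in>\<Phi> \<times> \<Psi>. \<bar>detp cpt (Suc m) S\<bar> * \<bar>detp (spt m) ?N F\<bar>)"
      unfolding \<Theta>_def by (subst sum.reindex[OF inj], rule sum.cong) (auto simp: det abs_mult)
    also have "\<dots> = fact m * (\<Sum>F\<in>\<Psi>. \<bar>detp (spt m) ?N F\<bar>)"
      by (simp flip: sum.cartesian_product vol add: sum_product)
    finally show ?thesis using vol' by simp
  qed
  moreover have "(\<Sum>L\<in>\<Theta>. osgn (detp cpt ?N L)) = u * u'"
  proof -
    have "(\<Sum>L\<in>\<Theta>. osgn (detp cpt ?N L)) =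
        (\<Sum>(S, F)\<in>\<Phi> \<times> \<Psi>. osgn (detp cpt (Suc m) S) * osgn (detp (spt m) ?N F))"
      unfolding \<Theta>_def by (subst sum.reindex[OF inj], rule sum.cong) (auto simp: det osgn_mult)
    also have "\<dots> = u * u'"
      by (simp flip: sum.cartesian_product sig sig' add: sum_product)
    finally show ?thesis .
  qed
  ultimately show ?thesis unfolding cube_family_def by blast
qed

section \<open>Staircases\<close>

text \<open>Monotone lattice paths from \<open>(0, 0)\<close> to \<open>(m, n)\<close>: the facets
  of the staircase triangulation of the product of an \<open>m\<close>-simplex and an
  \<open>n\<close>-simplex.\<close>

fun stairs :: "nat \<Rightarrow> nat \<Rightarrow> (nat \<times> nat) list set" where
  "stairs 0 0 = {[(0, 0)]}"
| "stairs (Suc m) 0 = (\<lambda>P. P @ [(Suc m, 0)]) ` stairs m 0"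
| "stairs 0 (Suc n) = (\<lambda>P. P @ [(0, Suc n)]) ` stairs 0 n"
| "stairs (Suc m) (Suc n) = (\<lambda>P. P @ [(Suc m, Suc n)]) ` (stairs m (Suc n) \<union> stairs (Suc m) n)"

text \<open>The Gaussian binomial coefficient of \<open>m + n\<close> over \<open>m\<close> at
  \<open>q = -1\<close>: a last step to the right at height \<open>n\<close> weighs
  \<open>q ^ n\<close>, a last step up weighs 1.\<close>

fun stair_sum :: "nat \<Rightarrow> nat \<Rightarrow> int" where
  "stair_sum 0 n = 1"
| "stair_sum (Suc m) 0 = 1"
| "stair_sum (Suc m) (Suc n) = (-1) ^ Suc n * stair_sum m (Suc n) + stair_sum (Suc m) n"

text \<open>The row of a point \<open>(i, j)\<close> consists of the unit vectors for
  \<open>i\<close> and \<open>j\<close>, without the entry for \<open>j = 0\<close>; dropping that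
  column makes the matrix square.\<close>

definition stair_det :: "nat \<Rightarrow> nat \<Rightarrow> (nat \<times> nat) list \<Rightarrow> int" where
  "stair_det m n P = Determinant.det (Matrix.mat (Suc (m + n)) (Suc (m + n))
     (\<lambda>(k, x). if x \<le> m then if fst (P ! k) = x then 1 else 0
       else if snd (P ! k) = x - m then 1 else 0))"

text \<open>Merges boundary and interior cases of the recursion: only the direction of the last step
  matters.\<close>

lemma stairs_induct [consumes 1, case_names origin right up]:
  assumes "P \<in> stairs m n"
    and "Q 0 0 [(0, 0)]"
    and "\<And>m n P. P \<in> stairs m n \<Longrightarrow> Q m n P \<Longrightarrow> Q (Suc m) n (P @ [(Suc m, n)])"
    and "\<And>m n P. P \<in> stairs m n \<Longrightarrow> Q m n P \<Longrightarrow> Q m (Suc n) (P @ [(m, Suc n)])"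
  shows "Q m n P"
  using assms(1) by (induction m n arbitrary: P rule: stairs.induct) (auto intro: assms(2-4))

lemma finite_stairs: "finite (stairs m n)"
  by (induction m n rule: stairs.induct) auto

lemma stairs_length: "P \<in> stairs m n \<Longrightarrow> length P = Suc (m + n)"
  by (induction rule: stairs_induct) auto

lemma stairs_bound: "P \<in> stairs m n \<Longrightarrow> set P \<subseteq> {..m} \<times> {..n}"
  by (induction rule: stairs_induct) force+

lemma stairs_last: "P \<in> stairs m n \<Longrightarrow> P ! (m + n) = (m, n)"
  by (induction rule: stairs_induct) (auto simp: nth_append stairs_length)

lemma stairs_nth_sum: "P \<in> stairs m n \<Longrightarrow> k \<le> m + n \<Longrightarrow> fst (P ! k) + snd (P ! k) = k"
  by (induction arbitrary: k rule: stairs_induct) (auto simp: nth_append stairs_length le_Suc_eq)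

lemma stairs_nth_le:
  assumes "P \<in> stairs m n" "k \<le> m + n"
  shows "fst (P ! k) \<le> m" "snd (P ! k) \<le> n"
proof -
  have "P ! k \<in> {..m} \<times> {..n}"
    using stairs_bound[OF assms(1)] nth_mem[of k P] stairs_length[OF assms(1)] assms(2) by auto
  then show "fst (P ! k) \<le> m" "snd (P ! k) \<le> n" by (auto simp: mem_Times_iff)
qed

lemma stairs_onto_snd: "P \<in> stairs m n \<Longrightarrow> j \<le> n \<Longrightarrow> j \<in> snd ` set P"
  by (induction arbitrary: j rule: stairs_induct) (auto simp: le_Suc_eq)

lemma stairs_disjoint: "stairs m (Suc n) \<inter> stairs (Suc m) n = {}"
proof -
  have False if "P \<in> stairs m (Suc n)" "P \<in> stairs (Suc m) n" for P
    using stairs_last[OF that(1)] stairs_last[OF that(2)] by simp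
  then show ?thesis by blast
qed

lemma inj_append_last: "inj_on (\<lambda>P. P @ [x]) A"
  by (simp add: inj_on_def)

lemma card_stairs: "card (stairs m n) = (m + n) choose m"
proof (induction m n rule: stairs.induct)
  case (4 m n)
  then show ?case
    by (simp add: card_image[OF inj_append_last] card_Un_disjoint finite_stairs stairs_disjoint)
qed (simp_all add: card_image[OF inj_append_last])

text \<open>Supporting functions of the staircase triangulation, which is induced by the heights \<open>- i j\<close>.\<close>

lemma stairs_potential:
  assumes "P \<in> stairs m n"
  shows "\<exists>\<alpha> \<beta> :: nat \<Rightarrow> real. \<forall>i\<le>m. \<forall>j\<le>n.
    \<alpha> i + \<beta> j \<le> - real i * real j \<and> (\<alpha> i + \<beta> j = - real i * real j \<longleftrightarrow> (i, j) \<in> set P)"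
  using assms
proof (induction rule: stairs_induct)
  case origin
  then show ?case by (intro exI[of _ "\<lambda>_. 0"]) auto
next
  case (right m n P)
  then obtain \<alpha> \<beta> where ab: "\<And>i j. i \<le> m \<Longrightarrow> j \<le> n \<Longrightarrow> \<alpha> i + \<beta> j \<le> - real i * real j \<and>
      (\<alpha> i + \<beta> j = - real i * real j \<longleftrightarrow> (i, j) \<in> set P)" by blast
  have last: "(m, n) \<in> set P"
    using stairs_last[OF right(1)] stairs_length[OF right(1)] by (metis less_Suc_eq nth_mem)
  have no: "(Suc m, j) \<notin> set P" for j using stairs_bound[OF right(1)] by auto
  show ?case
  \<comment> \<open>The new value is forced by equality at \<open>(Suc m, n)\<close>. For
    \<open>j < n\<close> the heights fall by only \<open>j\<close> from \<open>m\<close> to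
    \<open>Suc m\<close>, while the potential falls by \<open>n\<close>, so the inequality is strict
    there.\<close>
  proof (rule exI[of _ "\<alpha>(Suc m := \<alpha> m - real n)"], rule exI[of _ \<beta>], intro allI impI)
    fix i j assume i: "i \<le> Suc m" and j: "j \<le> n"
    show "(\<alpha>(Suc m := \<alpha> m - real n)) i + \<beta> j \<le> - real i * real j \<and>
      ((\<alpha>(Suc m := \<alpha> m - real n)) i + \<beta> j = - real i * real j \<longleftrightarrow> (i, j) \<in> set (P @ [(Suc m, n)]))"
    proof (cases "i = Suc m")
      case True
      have "\<alpha> m + \<beta> j \<le> - real m * real j" "\<alpha> m + \<beta> n = - real m * real n"
        using ab[of m j] ab[of m n] j last by auto
      moreover have "real j \<le> real n" using j by simp
      ultimately show ?thesis using True no by (auto simp: algebra_simps)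
    qed (use ab[of i j] i j in auto)
  qed
next
  case (up m n P)
  then obtain \<alpha> \<beta> where ab: "\<And>i j. i \<le> m \<Longrightarrow> j \<le> n \<Longrightarrow> \<alpha> i + \<beta> j \<le> - real i * real j \<and>
      (\<alpha> i + \<beta> j = - real i * real j \<longleftrightarrow> (i, j) \<in> set P)" by blast
  have last: "(m, n) \<in> set P"
    using stairs_last[OF up(1)] stairs_length[OF up(1)] by (metis less_Suc_eq nth_mem)
  have no: "(i, Suc n) \<notin> set P" for i using stairs_bound[OF up(1)] by auto
  show ?case
  proof (rule exI[of _ \<alpha>], rule exI[of _ "\<beta>(Suc n := \<beta> n - real m)"], intro allI impI)
    fix i j assume i: "i \<le> m" and j: "j \<le> Suc n"
    show "\<alpha> i + (\<beta>(Suc n := \<beta> n - real m)) j \<le> - real i * real j \<and>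
      (\<alpha> i + (\<beta>(Suc n := \<beta> n - real m)) j = - real i * real j \<longleftrightarrow> (i, j) \<in> set (P @ [(m, Suc n)]))"
    proof (cases "j = Suc n")
      case True
      have "\<alpha> i + \<beta> n \<le> - real i * real n" "\<alpha> m + \<beta> n = - real m * real n"
        using ab[of i n] ab[of m n] i last by auto
      moreover have "real i \<le> real m" using i by simp
      ultimately show ?thesis using True no by (auto simp: algebra_simps)
    qed (use ab[of i j] i j in auto)
  qed
qed

section \<open>Signs of staircases and their sums\<close>

lemma det_column_unit:
  fixes A :: "'a::comm_ring_1 mat"
  assumes "A \<in> carrier_mat (Suc N) (Suc N)" "j < Suc N"
    and "\<And>k. k < N \<Longrightarrow> A $$ (k, j) = 0" "A $$ (N, j) = 1"
  shows "Determinant.det A = (-1) ^ (N + j) * Determinant.det (mat_delete A N j)"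
proof -
  have "Determinant.det A = (\<Sum>k<Suc N. A $$ (k, j) * cofactor A k j)"
    using assms by (intro laplace_expansion_column) auto
  also have "\<dots> = cofactor A N j" using assms by simp
  finally show ?thesis by (simp add: cofactor_def)
qed

text \<open>Earlier points have first coordinate at most \<open>m\<close>, so the column for
  \<open>Suc m\<close> has its only 1 in the last row. The \<open>n\<close> columns of the second
  factor stand to its right, whence \<open>(-1) ^ n\<close>.\<close>

lemma stair_det_right:
  assumes P: "P \<in> stairs m n"
  shows "stair_det (Suc m) n (P @ [(Suc m, n)]) = (-1) ^ n * stair_det m n P"
proof -
  let ?f = "\<lambda>m P k x. if x \<le> m then if fst (P ! k) = x then 1 else 0
       else if snd (P ! k) = x - m then 1 else 0 :: int"
  let ?N = "Suc (m + n)"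
  let ?A = "Matrix.mat (Suc ?N) (Suc ?N) (\<lambda>(k, x). ?f (Suc m) (P @ [(Suc m, n)]) k x)"
  note len = stairs_length[OF P]
  have le: "fst (P ! k) \<le> m" if "k < ?N" for k using stairs_nth_le[OF P, of k] that by simp
  have "Determinant.det ?A = (-1) ^ (?N + Suc m) * Determinant.det (mat_delete ?A ?N (Suc m))"
    using le by (intro det_column_unit) (auto simp: nth_append len dest: le)
  also have "mat_delete ?A ?N (Suc m) = Matrix.mat ?N ?N (\<lambda>(k, x). ?f m P k x)"
    by (rule eq_matI) (auto simp: mat_delete_def nth_append len)
  also have "(-1 :: int) ^ (?N + Suc m) = (-1) ^ n" by (simp add: power_add)
  finally show ?thesis unfolding stair_det_def by simp
qed

text \<open>Here the new column is the last one, so no sign arises.\<close>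

lemma stair_det_up:
  assumes P: "P \<in> stairs m n"
  shows "stair_det m (Suc n) (P @ [(m, Suc n)]) = stair_det m n P"
proof -
  let ?f = "\<lambda>P k x. if x \<le> m then if fst (P ! k) = x then 1 else 0
       else if snd (P ! k) = x - m then 1 else 0 :: int"
  let ?N = "Suc (m + n)"
  let ?A = "Matrix.mat (Suc ?N) (Suc ?N) (\<lambda>(k, x). ?f (P @ [(m, Suc n)]) k x)"
  note len = stairs_length[OF P]
  have le: "snd (P ! k) \<le> n" if "k < ?N" for k using stairs_nth_le[OF P, of k] that by simp
  have "Determinant.det ?A = (-1) ^ (?N + ?N) * Determinant.det (mat_delete ?A ?N ?N)"
    by (intro det_column_unit) (auto simp: nth_append len dest: le)
  also have "mat_delete ?A ?N ?N = Matrix.mat ?N ?N (\<lambda>(k, x). ?f P k x)"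
    by (rule eq_matI) (auto simp: mat_delete_def nth_append len)
  finally show ?thesis unfolding stair_det_def by (simp flip: mult_2 add: power_mult)
qed

lemma abs_stair_det: "P \<in> stairs m n \<Longrightarrow> \<bar>stair_det m n P\<bar> = 1"
proof (induction rule: stairs_induct)
  case origin
  show ?case by (simp add: stair_det_def det_single)
qed (simp_all add: stair_det_right stair_det_up abs_mult power_abs)

lemma stair_sum_0: "stair_sum m 0 = 1"
  by (cases m) auto

lemma sum_stair_det: "(\<Sum>P\<in>stairs m n. stair_det m n P) = stair_sum m n"
proof (induction m n rule: stairs.induct)
  case 1
  show ?case by (simp add: stair_det_def det_single)
next
  case (2 m)
  then show ?case
    by (simp add: sum.reindex[OF inj_append_last] stair_det_right stair_sum_0)
next
  case (3 n)
  then show ?case by (simp add: sum.reindex[OF inj_append_last] stair_det_up)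
next
  case (4 m n)
  have "(\<Sum>P\<in>stairs (Suc m) (Suc n). stair_det (Suc m) (Suc n) P) =
      (\<Sum>P\<in>stairs m (Suc n). stair_det (Suc m) (Suc n) (P @ [(Suc m, Suc n)])) +
      (\<Sum>P\<in>stairs (Suc m) n. stair_det (Suc m) (Suc n) (P @ [(Suc m, Suc n)]))"
    by (simp add: sum.reindex[OF inj_append_last] sum.union_disjoint finite_stairs stairs_disjoint)
  also have "(\<Sum>P\<in>stairs m (Suc n). stair_det (Suc m) (Suc n) (P @ [(Suc m, Suc n)])) =
      (-1) ^ Suc n * stair_sum m (Suc n)"
    by (simp add: stair_det_right sum_distrib_left flip: 4(1) del: power_Suc)
  also have "(\<Sum>P\<in>stairs (Suc m) n. stair_det (Suc m) (Suc n) (P @ [(Suc m, Suc n)])) =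
      stair_sum (Suc m) n"
    by (simp add: stair_det_up flip: 4(2))
  finally show ?case by simp
qed

lemma stair_sum_1: "stair_sum m 1 = (if even m then 1 else 0)"
proof (induction m)
  case (Suc m)
  have "stair_sum (Suc m) 1 = - stair_sum m 1 + 1" by simp
  then show ?case using Suc by simp
qed simp

lemma stair_sum_2: "stair_sum m 2 = int (m div 2) + 1"
proof (induction m)
  case (Suc m)
  have "stair_sum (Suc m) 2 = stair_sum m 2 + stair_sum (Suc m) 1"
    by (simp add: numeral_2_eq_2)
  then show ?case using Suc by (simp only: stair_sum_1) (auto elim!: evenE oddE)
qed simp

lemma stair_sum_3: "stair_sum m 3 = (if even m then int (m div 2) + 1 else 0)"
proof (induction m)
  case (Suc m)
  have "stair_sum (Suc m) 3 = - stair_sum m 3 + stair_sum (Suc m) 2"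
    by (simp add: numeral_3_eq_3 numeral_2_eq_2)
  then show ?case using Suc by (simp only: stair_sum_2) (auto elim!: evenE oddE)
qed simp

lemma stair_sum_4: "2 * stair_sum (2 * k) 4 = (int k + 1) * (int k + 2)"
proof (induction k)
  case (Suc k)
  have "stair_sum (Suc m) 4 = stair_sum m 4 + stair_sum (Suc m) 3" for m
    by (simp add: eval_nat_numeral)
  then have "stair_sum (2 * Suc k) 4 = stair_sum (2 * k) 4 + stair_sum (Suc (2 * k)) 3 + stair_sum (Suc (Suc (2 * k))) 3"
    by simp
  then show ?case using Suc by (simp add: stair_sum_3 algebra_simps)
qed simp

section \<open>Staircases over a triangulated cube\<close>

lemma detp_cpt_diff:
  "detp cpt (Suc n) T =
    Determinant.det (Matrix.mat n n (\<lambda>(k, x). T ! Suc k ! x - T ! 0 ! x))"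
proof -
  \<comment> \<open>Each row is row 0 plus its difference from row 0. The differences vanish in the
    homogeneous coordinate, so the first row and column split off.\<close>
  define r where "r = (\<lambda>k l :: nat. if l = 0 \<or> l = k then 1 else 0 :: int)"
  define b where "b = (\<lambda>l x. if l = 0 then cpt (T ! 0) x else cpt (T ! l) x - cpt (T ! 0) x)"
  have "detp cpt (Suc n) T = Determinant.det (Matrix.mat (Suc n) (Suc n) (\<lambda>(k, x). r k x)) *
      Determinant.det (Matrix.mat (Suc n) (Suc n) (\<lambda>(k, x). b k x))"
    unfolding detp_def
  proof (rule det_as_product)
    fix k x assume k: "k < Suc n"
    have "(\<Sum>l<Suc n. r k l * b l x) = b 0 x + (\<Sum>l<n. if Suc l = k then b k x else 0)"
      unfolding sum.lessThan_Suc_shift by (auto simp: r_def intro!: sum.cong)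
    also have "\<dots> = cpt (T ! k) x" using k by (cases k) (auto simp: b_def)
    finally show "cpt (T ! k) x = (\<Sum>l<Suc n. r k l * b l x)" by simp
  qed
  also have "Determinant.det (Matrix.mat (Suc n) (Suc n) (\<lambda>(k, x). r k x)) = 1"
    by (rule det_unitriangular) (auto simp: r_def)
  also have "Determinant.det (Matrix.mat (Suc n) (Suc n) (\<lambda>(k, x). b k x)) =
      Determinant.det (Matrix.mat 1 1 (\<lambda>(k, x). b k x)) *
      Determinant.det (Matrix.mat n n (\<lambda>(k, x). b (1 + k) (1 + x)))"
    using det_block_upper[of 1 n b] by (simp add: b_def cpt_def)
  also have "Determinant.det (Matrix.mat 1 1 (\<lambda>(k, x). b k x)) = 1"
    by (simp add: det_single b_def cpt_def)
  also have "(\<lambda>(k, x). b (1 + k) (1 + x)) = (\<lambda>(k, x). T ! Suc k ! x - T ! 0 ! x)"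
    by (auto simp: b_def cpt_def)
  finally show ?thesis by simp
qed

definition stair_facet :: "int list list \<Rightarrow> (nat \<times> nat) list \<Rightarrow> (nat \<times> int list) list" where
  "stair_facet T P = map (\<lambda>(i, j). (i, T ! j)) P"

text \<open>\<open>e_i @ T ! j\<close> is \<open>e_i @ T ! 0\<close> plus, for \<open>j > 0\<close>,
  the difference \<open>T ! j - T ! 0\<close> in the last \<open>n\<close> coordinates. The
  coefficients form the matrix of \<open>stair_det\<close>; the basis is block triangular, with an
  identity block and the block of differences.\<close>

lemma detp_stair_facet:
  assumes P: "P \<in> stairs m n"
  shows "detp (spt m) (Suc (m + n)) (stair_facet T P) = stair_det m n P * detp cpt (Suc n) T"
proof -
  let ?N = "Suc (m + n)"
  define r where "r = (\<lambda>k x. if x \<le> m then if fst (P ! k) = x then 1 else 0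
       else if snd (P ! k) = x - m then 1 else 0 :: int)"
  define b where "b = (\<lambda>l x. if l \<le> m then spt m (l, T ! 0) x
    else if x \<le> m then 0 else T ! (l - m) ! (x - Suc m) - T ! 0 ! (x - Suc m))"
  have "detp (spt m) ?N (stair_facet T P) =
      Determinant.det (Matrix.mat ?N ?N (\<lambda>(k, x). r k x)) *
      Determinant.det (Matrix.mat ?N ?N (\<lambda>(k, x). b k x))"
    unfolding detp_def
  proof (rule det_as_product)
    fix k x assume k: "k < ?N"
    obtain i j where ij: "P ! k = (i, j)" by (cases "P ! k")
    have i: "i \<le> m" and j: "j \<le> n" using stairs_nth_le[OF P, of k] k ij by auto
    have "(\<Sum>l<?N. r k l * b l x) =
        (\<Sum>l\<le>m. if l = i then b i x else 0) + (\<Sum>l<n. if Suc l = j then b (m + j) x else 0)"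
      unfolding sum_lessThan_Suc_add
      by (intro arg_cong2[where f = "(+)"] sum.cong) (auto simp: r_def ij)
    also have "\<dots> = b i x + (if j = 0 then 0 else b (m + j) x)"
      using i j by (cases j) auto
    also have "\<dots> = spt m (i, T ! j) x" using i by (auto simp: b_def spt_def)
    finally show "spt m (stair_facet T P ! k) x = (\<Sum>l<?N. r k l * b l x)"
      using k stairs_length[OF P] ij by (simp add: stair_facet_def)
  qed
  also have "Determinant.det (Matrix.mat ?N ?N (\<lambda>(k, x). b k x)) =
      Determinant.det (Matrix.mat (Suc m) (Suc m) (\<lambda>(k, x). b k x)) *
      Determinant.det (Matrix.mat n n (\<lambda>(k, x). b (Suc m + k) (Suc m + x)))"
    using det_block_upper[of "Suc m" n b] by (simp add: b_def)
  also have "Determinant.det (Matrix.mat (Suc m) (Suc m) (\<lambda>(k, x). b k x)) = 1"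
    by (rule det_unitriangular) (auto simp: b_def spt_def)
  also have "Determinant.det (Matrix.mat n n (\<lambda>(k, x). b (Suc m + k) (Suc m + x))) = detp cpt (Suc n) T"
    by (simp add: detp_cpt_diff b_def)
  finally show ?thesis by (simp add: stair_det_def r_def)
qed

text \<open>For odd \<open>K\<close> the modulus is even, so reducing \<open>t\<close> keeps its
  parity; for even \<open>K\<close> both exponents are even.\<close>

lemma minus_one_power_rotation:
  "(-1 :: int) ^ (K * (Suc K - t mod Suc K)) = (-1) ^ (t * K)"
proof (cases "even K")
  case True
  then show ?thesis by simp
next
  case False
  then have "even (Suc K)" by simp
  then have "even (t mod Suc K) \<longleftrightarrow> even t" by (metis dvd_mod_iff)
  moreover have "\<not> Suc K < t mod Suc K" using mod_less_divisor[of "Suc K" t] by linarith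
  ultimately have "even (Suc K - t mod Suc K) \<longleftrightarrow> even t" using \<open>even (Suc K)\<close> by (simp only: even_diff_nat even_add) blast
  then show ?thesis using False by (simp add: minus_one_power_iff)
qed

text \<open>
  A facet whose vertices are ranked \<open>t, \<dots>, t + n\<close> contributes staircases
  with ranks \<open>t, \<dots>, t + m + n\<close>. Colouring by rank modulo \<open>m + n + 1\<close> rotates them,
  which is where the sign \<open>(-1) ^ (t * (m + n))\<close> comes from.
\<close>

theorem prism_family_stairs:
  assumes reg: "regular_family cpt (Suc n) (cube n) h \<Phi>"
    and rank: "\<And>T k. T \<in> \<Phi> \<Longrightarrow> k \<le> n \<Longrightarrow> rk (T ! k) = rk (T ! 0) + k"
    and vol: "(\<Sum>T\<in>\<Phi>. \<bar>detp cpt (Suc n) T\<bar>) = fact n"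
  shows "\<exists>g \<gamma> \<Psi>. prism_family m n g \<gamma> \<Psi>
    ((\<Sum>T\<in>\<Phi>. (-1) ^ (rk (T ! 0) * (m + n)) * osgn (detp cpt (Suc n) T)) * stair_sum m n)"
proof -
  let ?N = "Suc (m + n)"
  let ?V = "{..m} \<times> cube n"
  have fin: "finite \<Phi>" using reg unfolding regular_family_def by auto
  have lenT: "length T = Suc n" and subT: "set T \<subseteq> cube n" and detT: "detp cpt (Suc n) T \<noteq> 0"
    if "T \<in> \<Phi>" for T using reg that unfolding regular_family_def by auto
  have Tmem: "T ! j \<in> cube n" if "T \<in> \<Phi>" "j \<le> n" for T j
    using subT[OF that(1)] lenT[OF that(1)] that(2) by (auto simp: subset_iff)
  have set_nth: "set T = (!) T ` {..n}" if "T \<in> \<Phi>" for T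
    using lenT[OF that] by (auto simp: set_conv_nth less_Suc_eq_le)
  have Tinj: "j = j'" if "T \<in> \<Phi>" "j \<le> n" "j' \<le> n" "T ! j = T ! j'" for T j j'
    using rank[OF that(1,2)] rank[OF that(1,3)] that(4) by (metis add_left_cancel)
  have "\<forall>T\<in>\<Phi>. \<exists>a. \<forall>v\<in>cube n. lin (Suc n) a (cpt v) \<le> h v \<and> (lin (Suc n) a (cpt v) = h v \<longleftrightarrow> v \<in> set T)"
    using reg unfolding regular_family_def by auto
  then obtain a where a: "\<And>T v. T \<in> \<Phi> \<Longrightarrow> v \<in> cube n \<Longrightarrow>
      lin (Suc n) (a T) (cpt v) \<le> h v \<and> (lin (Suc n) (a T) (cpt v) = h v \<longleftrightarrow> v \<in> set T)"
    by metis
  have "\<forall>T\<in>\<Phi>. \<exists>B. \<forall>k<Suc n. \<forall>l<Suc n. lin (Suc n) (B l) (cpt (T ! k)) = (if k = l then 1 else 0)"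
    using detT interpolation by metis
  then obtain B where B: "\<And>T k l. T \<in> \<Phi> \<Longrightarrow> k \<le> n \<Longrightarrow> l \<le> n \<Longrightarrow>
      lin (Suc n) (B T l) (cpt (T ! k)) = (if k = l then 1 else 0)"
    by (metis less_Suc_eq_le)
  have "\<forall>P\<in>stairs m n. \<exists>\<alpha> \<beta>. \<forall>i\<le>m. \<forall>j\<le>n. \<alpha> i + \<beta> j \<le> - real i * real j \<and>
      (\<alpha> i + \<beta> j = - real i * real j \<longleftrightarrow> (i, j) \<in> set P)"
    using stairs_potential by blast
  then obtain \<alpha> \<beta> where ab: "\<And>P i j. P \<in> stairs m n \<Longrightarrow> i \<le> m \<Longrightarrow> j \<le> n \<Longrightarrow>
      \<alpha> P i + \<beta> P j \<le> - real i * real j \<and> (\<alpha> P i + \<beta> P j = - real i * real j \<longleftrightarrow> (i, j) \<in> set P)"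
    by metis
  define A where "A = (\<lambda>M T P j. M * a T j + (\<Sum>l\<le>n. \<beta> P l * B T l j))"
  define Z where "Z = (\<lambda>T P v. \<Sum>l\<le>n. \<beta> P l * lin (Suc n) (B T l) (cpt v))"
  have lin_A: "lin (Suc n) (A M T P) (cpt v) = M * lin (Suc n) (a T) (cpt v) + Z T P v" for M T P v
    unfolding A_def lin_add_scaled lin_sum Z_def ..
  \<comment> \<open>Excess of the fine part of the supporting function over the fine height at
    \<open>(i, w)\<close>, where \<open>w\<close> is no vertex of \<open>T\<close>; it is to be
    beaten by \<open>M\<close> times the gap of \<open>T\<close> at \<open>w\<close>.\<close>
  define q where "q = (\<lambda>(T, P, i, w). \<alpha> P i - real (rk (T ! 0)) * real i + Z T P w + real i * real (rk w))"
  define X where "X = {(T, P, i, w). T \<in> \<Phi> \<and> P \<in> stairs m n \<and> i \<le> m \<and> w \<in> cube n \<and> w \<notin> set T}"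
  have "finite X"
    by (rule finite_subset[of _ "\<Phi> \<times> stairs m n \<times> {..m} \<times> cube n"])
      (auto simp: X_def fin finite_cube finite_stairs)
  moreover have "0 < (\<lambda>(T, P, i, w). h w - lin (Suc n) (a T) (cpt w)) x" if "x \<in> X" for x
    using that a by (force simp: X_def less_le)
  ultimately obtain M where M: "\<And>x. x \<in> X \<Longrightarrow> q x < M * (\<lambda>(T, P, i, w). h w - lin (Suc n) (a T) (cpt w)) x"
    using scale_dominates by blast
  \<comment> \<open>At \<open>w = T ! j\<close> the rank is \<open>t + j\<close>, so
    \<open>- i * rk w\<close> is the staircase height \<open>- i * j\<close> minus
    \<open>t * i\<close>; the latter is linear on the prism and is absorbed by the supporting
    function.\<close>
  define g where "g = (\<lambda>(i, w). M * h w - real i * real (rk w))"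
  define \<gamma> where "\<gamma> = (\<lambda>(i, w). (i + rk w) mod ?N)"
  \<comment> \<open>The point at position \<open>l\<close> of a path has coordinate sum
    \<open>l\<close>, hence colour \<open>t + l\<close> modulo \<open>m + n + 1\<close>; the
    rotation moves it to the position that equals its colour.\<close>
  define L where "L = (\<lambda>(T, P). rotate (?N - rk (T ! 0) mod ?N) (stair_facet T P))"
  define \<Psi> where "\<Psi> = L ` (\<Phi> \<times> stairs m n)"
  have lenL: "length (L (T, P)) = ?N" if "P \<in> stairs m n" for T P
    using stairs_length[OF that] by (simp add: L_def stair_facet_def)
  have setL: "set (L (T, P)) = (\<lambda>(i, j). (i, T ! j)) ` set P" for T P
    by (simp add: L_def stair_facet_def)
  have subL: "set (L (T, P)) \<subseteq> ?V" if "T \<in> \<Phi>" "P \<in> stairs m n" for T P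
    using stairs_bound[OF that(2)] Tmem[OF that(1)] by (auto simp: setL)
  have detL: "detp (spt m) ?N (L (T, P)) =
      (-1) ^ (rk (T ! 0) * (m + n)) * (stair_det m n P * detp cpt (Suc n) T)"
    if "P \<in> stairs m n" for T P
    using detp_rotate[of "stair_facet T P" "m + n" "spt m" "?N - rk (T ! 0) mod ?N"]
      stairs_length[OF that] minus_one_power_rotation[of "m + n" "rk (T ! 0)"]
    by (simp add: L_def stair_facet_def[of T P] flip: detp_stair_facet[OF that])
  have inj: "inj_on L (\<Phi> \<times> stairs m n)"
  proof (rule inj_onI, clarify)
    fix T P T' P' assume mem: "T \<in> \<Phi>" "P \<in> stairs m n" "T' \<in> \<Phi>" "P' \<in> stairs m n"
      and eq: "L (T, P) = L (T', P')"
    have snd_L: "snd ` set (L (T, P)) = set T" if "T \<in> \<Phi>" "P \<in> stairs m n" for T P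
    proof -
      have "snd ` set (L (T, P)) = (!) T ` snd ` set P" by (force simp: setL)
      also have "snd ` set P = {..n}"
        using stairs_bound[OF that(2)] stairs_onto_snd[OF that(2)] by force
      finally show ?thesis by (simp only: set_nth[OF that(1)])
    qed
    have sets: "set T = set T'" using snd_L mem eq by metis
    \<comment> \<open>The ranks are consecutive, so the set determines the least one, and each rank
      then determines a position: \<open>T\<close> is recovered as a list.\<close>
    have rk_set: "rk ` set T = {rk (T ! 0)..rk (T ! 0) + n}" if "T \<in> \<Phi>" for T
    proof -
      have "rk ` set T = (\<lambda>k. rk (T ! k)) ` {..n}"
        by (simp only: set_nth[OF that] image_image)
      also have "\<dots> = (\<lambda>k. rk (T ! 0) + k) ` {..n}"
        by (intro image_cong refl rank[OF that]) simp
      also have "\<dots> = {rk (T ! 0)..rk (T ! 0) + n}"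
        using image_add_atLeastAtMost[of "rk (T ! 0)" 0 n] by (simp add: atLeast0AtMost add.commute)
      finally show ?thesis .
    qed
    have t: "rk (T ! 0) = rk (T' ! 0)"
      using rk_set[OF mem(1)] rk_set[OF mem(3)] sets by (metis Icc_eq_Icc le_add1)
    have TT: "T = T'"
    proof (rule nth_equalityI)
      fix i assume "i < length T"
      then have i: "i \<le> n" using lenT mem by auto
      then have "T ! i \<in> (!) T ` {..n}" by simp
      also have "(!) T ` {..n} = (!) T' ` {..n}" using sets set_nth mem by metis
      finally obtain l where l: "l \<le> n" "T ! i = T' ! l" by auto
      have "i = l" using rank[OF mem(1) i] rank[OF mem(3) l(1)] l(2) t by (metis add_left_cancel)
      then show "T ! i = T' ! i" using l by simp
    qed (use lenT mem in auto)
    then have "stair_facet T P = stair_facet T P'"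
      using eq inj_fn[OF inj_rotate1] unfolding L_def rotate_def by (auto dest: injD)
    then have "map (\<lambda>(i, j). (i, T ! j)) P = map (\<lambda>(i, j). (i, T ! j)) P'"
      by (simp add: stair_facet_def)
    moreover have "inj_on (\<lambda>(i, j). (i, T ! j)) (set P \<union> set P')"
    proof (rule inj_onI)
      fix x y assume xy: "x \<in> set P \<union> set P'" "y \<in> set P \<union> set P'"
        and e: "(\<lambda>(i, j). (i, T ! j)) x = (\<lambda>(i, j). (i, T ! j)) y"
      have "snd x \<le> n" "snd y \<le> n"
        using xy stairs_bound[OF mem(2)] stairs_bound[OF mem(4)] by auto
      moreover have "fst x = fst y" "T ! snd x = T ! snd y" using e by (auto simp: case_prod_unfold)
      ultimately show "x = y" using Tinj[OF mem(1)] by (metis prod.collapse)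
    qed
    ultimately have "P = P'" by (rule map_inj_on)
    with TT show "T = T' \<and> P = P'" by simp
  qed
  have cert: "length K = ?N \<and> set K \<subseteq> ?V \<and> detp (spt m) ?N K \<noteq> 0 \<and>
      (\<exists>e. \<forall>x\<in>?V. lin ?N e (spt m x) \<le> g x \<and> (lin ?N e (spt m x) = g x \<longleftrightarrow> x \<in> set K))"
    if K\<Psi>: "K \<in> \<Psi>" for K
  proof -
    obtain T P where K: "K = L (T, P)" and mem: "T \<in> \<Phi>" "P \<in> stairs m n"
      using K\<Psi> unfolding \<Psi>_def by auto
    define t where "t = rk (T ! 0)"
    \<comment> \<open>The first \<open>m + 1\<close> coordinates of a prism vertex sum to 1, so the
      constant term \<open>A M T P 0\<close> is put into each of their coefficients;
      \<open>- real t * real j\<close> accounts for the rank offset.\<close>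
    define e where "e = (\<lambda>j. if j \<le> m then \<alpha> P j - real t * real j + A M T P 0 else A M T P (j - m))"
    have lin_e: "lin ?N e (spt m (i, w)) =
        \<alpha> P i - real t * real i + (M * lin (Suc n) (a T) (cpt w) + Z T P w)" if "i \<le> m" for i w
    proof -
      have "lin (Suc n) (A M T P) (cpt w) = A M T P 0 + (\<Sum>j<n. A M T P (Suc j) * of_int (w ! j))"
        unfolding lin_def sum.lessThan_Suc_shift by (simp add: cpt_def)
      then show ?thesis unfolding lin_spt[OF that] using that lin_A[of M T P w] by (simp add: e_def)
    qed
    have "lin ?N e (spt m x) \<le> g x \<and> (lin ?N e (spt m x) = g x \<longleftrightarrow> x \<in> set K)" if x: "x \<in> ?V" for x
    proof -
      obtain i w where xw: "x = (i, w)" and i: "i \<le> m" and w: "w \<in> cube n" using x by auto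
      show ?thesis
      proof (cases "w \<in> set T")
        case True
        then obtain j where j: "j \<le> n" "w = T ! j"
          using lenT[OF mem(1)] by (auto simp: in_set_conv_nth less_Suc_eq_le)
        have "Z T P w = (\<Sum>l\<le>n. if l = j then \<beta> P l else 0)"
          unfolding Z_def using B[OF mem(1) j(1)] j(2) by (intro sum.cong) auto
        then have "lin ?N e (spt m x) = M * h w - real t * real i + (\<alpha> P i + \<beta> P j)"
          using a[OF mem(1) w] True j(1) unfolding xw lin_e[OF i] by simp
        moreover have "g x = M * h w - real t * real i + (- real i * real j)"
          using rank[OF mem(1) j(1)] j(2) by (simp add: g_def xw t_def algebra_simps)
        moreover have "x \<in> set K \<longleftrightarrow> (i, j) \<in> set P"
        proof
          assume "x \<in> set K"
          then obtain j' where j': "(i, j') \<in> set P" "w = T ! j'" by (auto simp: K setL xw)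
          then have "j' \<le> n" using stairs_bound[OF mem(2)] by blast
          then show "(i, j) \<in> set P" using Tinj[OF mem(1) j(1)] j j' by metis
        qed (use j in \<open>force simp: K setL xw\<close>)
        ultimately show ?thesis using ab[OF mem(2) i j(1)] by simp
      next
        case False
        then have "(T, P, i, w) \<in> X" using mem i w by (simp add: X_def)
        then have "lin ?N e (spt m x) < g x"
          using M[of "(T, P, i, w)"] unfolding xw lin_e[OF i] by (simp add: q_def g_def t_def algebra_simps)
        moreover have "x \<notin> set K"
          using False stairs_bound[OF mem(2)] lenT[OF mem(1)] by (force simp: K setL xw)
        ultimately show ?thesis by simp
      qed
    qed
    moreover have "detp (spt m) ?N K \<noteq> 0"
      using detL[OF mem(2)] detT[OF mem(1)] abs_stair_det[OF mem(2)] by (auto simp: K)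
    ultimately show ?thesis using lenL[OF mem(2)] subL[OF mem] K by blast
  qed
  have "regular_family (spt m) ?N ?V g \<Psi>"
    unfolding regular_family_def using cert fin by (simp add: \<Psi>_def finite_cube finite_stairs)
  moreover have "coloured \<gamma> ?N \<Psi>"
    unfolding coloured_def \<Psi>_def
  proof clarify
    fix T P k assume mem: "T \<in> \<Phi>" "P \<in> stairs m n" and k: "k < ?N"
    define t where "t = rk (T ! 0)"
    define l where "l = (?N - t mod ?N + k) mod ?N"
    have l: "l < ?N" unfolding l_def by (rule mod_less_divisor) simp
    then have l': "l \<le> m + n" by simp
    have "L (T, P) ! k = stair_facet T P ! l"
      using nth_rotate[of k "stair_facet T P" "?N - t mod ?N"] stairs_length[OF mem(2)] k
      by (simp add: L_def t_def l_def stair_facet_def)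
    also have "\<dots> = (fst (P ! l), T ! snd (P ! l))"
      using stairs_length[OF mem(2)] l by (simp add: stair_facet_def case_prod_unfold)
    finally have "\<gamma> (L (T, P) ! k) = (fst (P ! l) + rk (T ! snd (P ! l))) mod ?N"
      by (simp add: \<gamma>_def)
    also have "fst (P ! l) + rk (T ! snd (P ! l)) = t + l"
      using rank[OF mem(1) stairs_nth_le(2)[OF mem(2) l']] stairs_nth_sum[OF mem(2) l']
      by (simp add: t_def)
    also have "(t + l) mod ?N = (t mod ?N + (?N - t mod ?N + k)) mod ?N"
      unfolding l_def by (simp only: mod_add_left_eq mod_add_right_eq)
    also have "t mod ?N + (?N - t mod ?N + k) = ?N + k"
      using mod_less_divisor[OF zero_less_Suc, of t "m + n"] by linarith
    also have "(?N + k) mod ?N = k" using k by (metis mod_add_self1 mod_less)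
    finally show "\<gamma> (L (T, P) ! k) = k" .
  qed
  moreover have "fact m * (\<Sum>K\<in>\<Psi>. \<bar>detp (spt m) ?N K\<bar>) = fact (m + n)"
  proof -
    have "(\<Sum>K\<in>\<Psi>. \<bar>detp (spt m) ?N K\<bar>) = (\<Sum>(T, P)\<in>\<Phi> \<times> stairs m n. \<bar>detp cpt (Suc n) T\<bar>)"
      unfolding \<Psi>_def by (subst sum.reindex[OF inj], rule sum.cong)
        (auto simp: detL abs_mult abs_stair_det power_abs)
    also have "\<dots> = int (card (stairs m n)) * (\<Sum>T\<in>\<Phi>. \<bar>detp cpt (Suc n) T\<bar>)"
      by (simp only: sum.cartesian_product[symmetric] sum_constant sum_distrib_left)
    also have "\<dots> = int ((m + n) choose m) * fact n" by (simp only: vol card_stairs)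
    finally have "fact m * (\<Sum>K\<in>\<Psi>. \<bar>detp (spt m) ?N K\<bar>) =
        int (fact m * fact n * ((m + n) choose m))" by (simp add: algebra_simps)
    also have "fact m * fact n * ((m + n) choose m) = (fact (m + n) :: nat)"
      using binomial_fact_lemma[of m "m + n"] by simp
    finally show ?thesis by simp
  qed
  moreover have "(\<Sum>K\<in>\<Psi>. osgn (detp (spt m) ?N K)) =
      (\<Sum>T\<in>\<Phi>. (-1) ^ (rk (T ! 0) * (m + n)) * osgn (detp cpt (Suc n) T)) * stair_sum m n"
  proof -
    have sgns: "osgn ((-1) ^ k) = (-1) ^ k" for k by (rule osgn_unit) (simp add: power_abs)
    have "(\<Sum>K\<in>\<Psi>. osgn (detp (spt m) ?N K)) = (\<Sum>(T, P)\<in>\<Phi> \<times> stairs m n.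
        ((-1) ^ (rk (T ! 0) * (m + n)) * osgn (detp cpt (Suc n) T)) * stair_det m n P)"
      unfolding \<Psi>_def by (subst sum.reindex[OF inj], rule sum.cong)
        (auto simp: detL osgn_mult osgn_unit[OF abs_stair_det] sgns)
    also have "\<dots> = (\<Sum>T\<in>\<Phi>. (-1) ^ (rk (T ! 0) * (m + n)) * osgn (detp cpt (Suc n) T)) *
        (\<Sum>P\<in>stairs m n. stair_det m n P)"
      by (simp only: sum.cartesian_product[symmetric] sum_product)
    finally show ?thesis by (simp only: sum_stair_det)
  qed
  ultimately show ?thesis unfolding prism_family_def by blast
qed

section \<open>Explicit triangulations\<close>

fun ldet :: "nat \<Rightarrow> int list list \<Rightarrow> int" where
  "ldet 0 M = 1"
| "ldet (Suc n) M = (\<Sum>i\<leftarrow>[0..<Suc n]. let x = hd (M ! i) in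
    if x = 0 then 0 else (-1) ^ i * x * ldet n (map tl (take i M @ drop (Suc i) M)))"

text \<open>\<open>ldet\<close> is the Laplace expansion along the first column, in a form where
  zero entries prune the evaluation.\<close>

lemma ldet_eq_det:
  assumes "length M = n" "\<forall>r\<in>set M. length r = n"
  shows "ldet n M = Determinant.det (Matrix.mat n n (\<lambda>(k, j). M ! k ! j))"
  using assms
proof (induction n arbitrary: M)
  case 0
  then show ?case by simp
next
  case (Suc n)
  let ?A = "Matrix.mat (Suc n) (Suc n) (\<lambda>(k, j). M ! k ! j)"
  have minor: "ldet n (map tl (take i M @ drop (Suc i) M)) = Determinant.det (mat_delete ?A i 0)"
    if i: "i < Suc n" for i
  proof -
    let ?M = "map tl (take i M @ drop (Suc i) M)"
    have "ldet n ?M = Determinant.det (Matrix.mat n n (\<lambda>(k, j). ?M ! k ! j))"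
      using Suc.prems i by (intro Suc.IH) (auto dest: in_set_takeD in_set_dropD)
    also have "Matrix.mat n n (\<lambda>(k, j). ?M ! k ! j) = mat_delete ?A i 0"
      using Suc.prems i
      by (intro eq_matI) (auto simp: mat_delete_def nth_append nth_tl min_def)
    finally show ?thesis .
  qed
  have hd: "hd (M ! i) = M ! i ! 0" if "i < Suc n" for i
  proof -
    have "M ! i \<in> set M" using Suc.prems(1) that by simp
    then have "length (M ! i) = Suc n" using Suc.prems(2) by blast
    then show ?thesis by (intro hd_conv_nth) auto
  qed
  have "Determinant.det ?A = (\<Sum>i<Suc n. ?A $$ (i, 0) * cofactor ?A i 0)"
    by (rule laplace_expansion_column) auto
  also have "\<dots> = (\<Sum>i<Suc n. let x = hd (M ! i) in
      if x = 0 then 0 else (-1) ^ i * x * ldet n (map tl (take i M @ drop (Suc i) M)))"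
    by (rule sum.cong) (auto simp: minor hd cofactor_def Let_def simp del: take_append map_append)
  also have "\<dots> = ldet (Suc n) M"
    by (simp only: ldet.simps interv_sum_list_conv_sum_set_nat atLeast0LessThan set_upt)
  finally show ?case by simp
qed

definition dot :: "int list \<Rightarrow> int list \<Rightarrow> int" where
  "dot a x = sum_list (map2 (*) a x)"

definition check_facet ::
    "nat \<Rightarrow> ('v \<Rightarrow> int list) \<Rightarrow> 'v list \<Rightarrow> ('v \<Rightarrow> int) \<Rightarrow> 'v list \<times> int list \<Rightarrow> bool" where
  "check_facet N coords vs h = (\<lambda>(F, a). length F = N \<and> length a = N \<and> list_all (\<lambda>v. v \<in> set vs) F \<and>
     ldet N (map coords F) \<noteq> 0 \<and>
     list_all (\<lambda>v. if v \<in> set F then dot a (coords v) = h v else dot a (coords v) < h v) vs)"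

lemma detp_ldet:
  assumes "length F = N" "\<And>v. v \<in> set F \<Longrightarrow> length (coords v) = N"
    "\<And>v j. v \<in> set F \<Longrightarrow> j < N \<Longrightarrow> p v j = coords v ! j"
  shows "detp p N F = ldet N (map coords F)"
proof -
  have "ldet N (map coords F) = Determinant.det (Matrix.mat N N (\<lambda>(k, j). map coords F ! k ! j))"
    by (rule ldet_eq_det) (auto simp: assms)
  also have "Matrix.mat N N (\<lambda>(k, j). map coords F ! k ! j) = Matrix.mat N N (\<lambda>(k, j). p (F ! k) j)"
    by (rule eq_matI) (auto simp: assms)
  finally show ?thesis by (simp add: detp_def)
qed

text \<open>The integer functional stored with each facet witnesses its supporting function, so
  regularity becomes finitely many comparisons of integers.\<close>

lemma regular_family_check:
  assumes chk: "list_all (check_facet N coords vs h) D"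
    and vs: "set vs = V"
    and coords: "\<And>v. v \<in> V \<Longrightarrow> length (coords v) = N"
    and p: "\<And>v j. v \<in> V \<Longrightarrow> j < N \<Longrightarrow> p v j = coords v ! j"
  shows "regular_family p N V (\<lambda>v. real_of_int (h v)) (set (map fst D))"
proof -
  have "length F = N \<and> set F \<subseteq> V \<and> detp p N F \<noteq> 0 \<and>
      (\<exists>a. \<forall>v\<in>V. lin N a (p v) \<le> h v \<and> (lin N a (p v) = h v \<longleftrightarrow> v \<in> set F))"
    if FD: "F \<in> set (map fst D)" for F
  proof -
    obtain a where "(F, a) \<in> set D" using FD by auto
    then have c: "check_facet N coords vs h (F, a)" using chk by (simp add: list_all_iff)
    then have F: "length F = N" "set F \<subseteq> V" "length a = N" "ldet N (map coords F) \<noteq> 0"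
      using vs by (auto simp: check_facet_def list_all_iff)
    have d: "detp p N F = ldet N (map coords F)"
      using F coords p by (intro detp_ldet) auto
    have "lin N (\<lambda>j. of_int (a ! j)) (p v) = of_int (dot a (coords v))" if "v \<in> V" for v
      using F(3) coords[OF that] p[OF that]
      by (auto simp: lin_def dot_def sum_list_sum_nth atLeast0LessThan intro!: sum.cong)
    moreover have "dot a (coords v) \<le> h v \<and> (dot a (coords v) = h v \<longleftrightarrow> v \<in> set F)" if "v \<in> V" for v
      using c that vs by (auto simp: check_facet_def list_all_iff split: if_splits)
    ultimately show ?thesis using F d by (auto intro!: exI[of _ "\<lambda>j. of_int (a ! j)"])
  qed
  moreover have "finite V" using vs by (metis List.finite_set)
  ultimately show ?thesis unfolding regular_family_def by blast
qed

primrec cube_list :: "nat \<Rightarrow> int list list" where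
  "cube_list 0 = [[]]"
| "cube_list (Suc n) = map ((#) 0) (cube_list n) @ map ((#) 1) (cube_list n)"

lemma set_cube_list: "set (cube_list n) = cube n"
proof (induction n)
  case (Suc n)
  have "v \<in> cube (Suc n) \<longleftrightarrow> v \<in> (#) 0 ` cube n \<union> (#) 1 ` cube n" for v
    by (cases v) (auto simp: cube_def)
  then show ?case using Suc by auto
qed (auto simp: cube_def)

primrec bits_value :: "int list \<Rightarrow> nat" where
  "bits_value [] = 0"
| "bits_value (b # v) = (if b = 0 then 0 else 1) + 2 * bits_value v"

definition signature_sums :: "nat \<Rightarrow> ('v \<Rightarrow> int list) \<Rightarrow> ('v list \<times> int list) list \<Rightarrow> int \<times> int" where
  "signature_sums N coords D =
    (\<Sum>F\<leftarrow>map fst D. \<bar>ldet N (map coords F)\<bar>, \<Sum>F\<leftarrow>map fst D. osgn (ldet N (map coords F)))"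

definition coloured_list :: "nat \<Rightarrow> ('v \<Rightarrow> nat) \<Rightarrow> ('v list \<times> int list) list \<Rightarrow> bool" where
  "coloured_list N c D = list_all (\<lambda>(F, a). map c F = [0..<N]) D"

lemma coloured_check:
  assumes "coloured_list N c D"
  shows "coloured c N (set (map fst D))"
  unfolding coloured_def
proof (intro ballI allI impI)
  fix F k assume "F \<in> set (map fst D)" and k: "k < N"
  then have m: "map c F = [0..<N]" using assms by (auto simp: coloured_list_def list_all_iff)
  then have "length F = N" by (metis diff_zero length_map length_upt)
  then show "c (F ! k) = k" using k m by (metis add_0 nth_map nth_upt)
qed

lemma signature_sums_check:
  assumes chk: "list_all (check_facet N coords vs h) D" and dist: "distinct (map fst D)"
    and vs: "set vs = V"
    and coords: "\<And>v. v \<in> V \<Longrightarrow> length (coords v) = N"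
    and p: "\<And>v j. v \<in> V \<Longrightarrow> j < N \<Longrightarrow> p v j = coords v ! j"
    and sums: "signature_sums N coords D = (x, u)"
  shows "(\<Sum>F\<in>set (map fst D). \<bar>detp p N F\<bar>) = x" "(\<Sum>F\<in>set (map fst D). osgn (detp p N F)) = u"
proof -
  have d: "detp p N F = ldet N (map coords F)" if "F \<in> set (map fst D)" for F
  proof -
    have "length F = N" "set F \<subseteq> V"
      using chk that vs by (auto simp: check_facet_def list_all_iff)
    then show ?thesis using coords p by (intro detp_ldet) auto
  qed
  have s: "(\<Sum>F\<in>set (map fst D). f (detp p N F)) = (\<Sum>F\<leftarrow>map fst D. f (ldet N (map coords F)))"
    for f :: "int \<Rightarrow> int"
    unfolding sum.distinct_set_conv_list[OF dist, symmetric] by (rule sum.cong[OF refl]) (simp only: d)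
  show "(\<Sum>F\<in>set (map fst D). \<bar>detp p N F\<bar>) = x" "(\<Sum>F\<in>set (map fst D). osgn (detp p N F)) = u"
    using sums by (simp_all only: s[of abs] s[of osgn] signature_sums_def prod.inject)
qed

lemma cube_family_check:
  assumes "list_all (check_facet (Suc m) ((#) 1) (cube_list m) h) D \<and> distinct (map fst D) \<and>
    coloured_list (Suc m) c D \<and> signature_sums (Suc m) ((#) 1) D = (fact m, u)"
  shows "cube_family m (\<lambda>v. real_of_int (h v)) c (set (map fst D)) u"
proof -
  have len: "length (1 # v) = Suc m" if "v \<in> cube m" for v using that by (simp add: cube_def)
  have p: "cpt v j = (1 # v) ! j" for v j by (simp add: cpt_def)
  show ?thesis unfolding cube_family_def
    using assms regular_family_check[where coords = "(#) 1" and p = cpt, OF _ set_cube_list len p] coloured_check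
      signature_sums_check[where coords = "(#) 1" and p = cpt, OF _ _ set_cube_list len p]
    by blast
qed

definition prism_list :: "nat \<Rightarrow> nat \<Rightarrow> (nat \<times> int list) list" where
  "prism_list m n = List.product [0..<Suc m] (cube_list n)"

definition prism_vec :: "nat \<Rightarrow> nat \<times> int list \<Rightarrow> int list" where
  "prism_vec m = (\<lambda>(i, w). map (\<lambda>j. if j = i then 1 else 0) [0..<Suc m] @ w)"

lemma prism_family_check:
  assumes "list_all (check_facet (Suc (m + n)) (prism_vec m) (prism_list m n) h) D \<and> distinct (map fst D) \<and>
    coloured_list (Suc (m + n)) c D \<and> signature_sums (Suc (m + n)) (prism_vec m) D = (x, u) \<and>
    fact m * x = fact (m + n)"
  shows "prism_family m n (\<lambda>v. real_of_int (h v)) c (set (map fst D)) u"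
proof -
  have V: "set (prism_list m n) = {..m} \<times> cube n"
    by (auto simp: prism_list_def set_cube_list simp del: upt_Suc)
  have len: "length (prism_vec m v) = Suc (m + n)" if "v \<in> {..m} \<times> cube n" for v
    using that by (auto simp: cube_def prism_vec_def)
  have p: "spt m v j = prism_vec m v ! j" if "v \<in> {..m} \<times> cube n" "j < Suc (m + n)" for v j
    using that by (auto simp: spt_def prism_vec_def nth_append simp del: upt_Suc)
  show ?thesis unfolding prism_family_def
    using assms regular_family_check[where coords = "prism_vec m" and p = "spt m", OF _ V len p] coloured_check
      signature_sums_check[where coords = "prism_vec m" and p = "spt m", OF _ _ V len p]
    by blast
qed

text \<open>
  Heights and colours are indexed by the number \<open>v\<^sub>0 + 2 v\<^sub>1 + 4 v\<^sub>2 + \<dots>\<close> of a vertex \<open>v\<close>, and for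
  \<open>(i, w)\<close> by \<open>4 i\<close> plus the number of \<open>w\<close>; each facet comes with the homogeneous coefficients of its
  supporting function. The triangulation of the 3-cube cuts off four corners of the central tetrahedron;
  the other two were found by a computer search over the heights.
\<close>

definition cube3_heights :: "int list" where
  "cube3_heights = [0, 1, 1, 0, 1, 0, 0, 1]"

definition cube3_colours :: "nat list" where
  "cube3_colours = [0, 1, 3, 2, 2, 3, 1, 0]"

definition cube3_facets :: "(int list list \<times> int list) list" where
  "cube3_facets = [
    ([[0,0,0],[1,0,0],[1,1,0],[1,0,1]],[0,1,-1,-1]),
    ([[0,0,0],[0,1,1],[1,1,0],[0,1,0]],[0,-1,1,-1]),
    ([[0,0,0],[0,1,1],[1,1,0],[1,0,1]],[0,0,0,0]),
    ([[0,0,0],[0,1,1],[0,0,1],[1,0,1]],[0,-1,-1,1]),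
    ([[1,1,1],[0,1,1],[1,1,0],[1,0,1]], [-2,1,1,1])]"

definition cube4_heights :: "int list" where
  "cube4_heights = [0, 12, 14, 12, 10, 6, 4, 12, 14, 0, 14, 16, 14, 2, 2, 14]"

definition cube4_colours :: "nat list" where
  "cube4_colours = [0, 1, 4, 2, 4, 3, 1, 0, 2, 4, 1, 0, 1, 2, 3, 1]"

definition cube4_facets :: "(int list list \<times> int list) list" where
  "cube4_facets = [
    ([[0,0,0,0],[1,0,0,0],[1,1,0,0],[1,0,1,0],[1,0,0,1]],[0,12,0,-6,-12]),
    ([[0,0,0,0],[0,1,1,0],[1,1,0,0],[0,1,1,1],[0,1,0,0]],[0,-2,14,-10,-2]),
    ([[0,0,0,0],[0,1,0,1],[1,1,0,0],[0,1,1,1],[0,1,0,0]],[0,-2,14,-12,0]),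
    ([[0,0,0,0],[0,1,1,0],[1,1,0,0],[1,0,1,0],[1,0,0,1]],[0,7,5,-1,-7]),
    ([[0,0,0,0],[0,1,1,0],[1,1,0,0],[0,1,1,1],[1,0,0,1]],[0,2,10,-6,-2]),
    ([[0,0,0,0],[0,1,0,1],[1,1,0,0],[0,1,1,1],[1,0,0,1]],[0,-1,13,-12,1]),
    ([[0,0,0,0],[0,1,1,0],[1,0,1,1],[1,0,1,0],[0,0,1,0]],[0,-4,-6,10,-4]),
    ([[0,0,0,0],[0,1,1,0],[1,0,1,1],[0,1,1,1],[0,0,1,0]],[0,-6,-6,10,-2]),
    ([[0,0,0,0],[0,0,1,1],[1,0,1,1],[0,1,1,1],[0,0,1,0]],[0,-12,-12,10,4]),
    ([[0,0,0,0],[0,1,1,0],[1,0,1,1],[1,0,1,0],[1,0,0,1]],[0,4,2,2,-4]),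
    ([[0,0,0,0],[0,1,1,0],[1,0,1,1],[0,1,1,1],[1,0,0,1]],[0,2,2,2,-2]),
    ([[0,0,0,0],[0,1,0,1],[0,0,0,1],[0,1,1,1],[1,0,0,1]],[0,-14,0,-12,14]),
    ([[0,0,0,0],[0,0,1,1],[0,0,0,1],[0,1,1,1],[1,0,0,1]],[0,-14,-12,0,14]),
    ([[0,0,0,0],[0,0,1,1],[1,0,1,1],[0,1,1,1],[1,0,0,1]],[0,-12,-12,2,12]),
    ([[1,1,1,0],[0,1,1,0],[1,1,0,0],[1,0,1,0],[1,0,0,1]], [-2,8,6,0,-6]),
    ([[1,1,1,0],[0,1,1,0],[1,1,0,0],[0,1,1,1],[1,0,0,1]], [-6,8,10,0,-2]),
    ([[1,1,1,0],[1,1,1,1],[1,1,0,0],[0,1,1,1],[1,0,0,1]], [-14,12,14,0,2]),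
    ([[1,1,0,1],[0,1,0,1],[1,1,0,0],[0,1,1,1],[1,0,0,1]], [-6,2,16,-12,4]),
    ([[1,1,0,1],[1,1,1,1],[1,1,0,0],[0,1,1,1],[1,0,0,1]], [-16,12,16,-2,4]),
    ([[1,1,1,0],[0,1,1,0],[1,0,1,1],[1,0,1,0],[1,0,0,1]], [-4,8,6,2,-4]),
    ([[1,1,1,0],[0,1,1,0],[1,0,1,1],[0,1,1,1],[1,0,0,1]], [-6,8,8,2,-2]),
    ([[1,1,1,0],[1,1,1,1],[1,0,1,1],[0,1,1,1],[1,0,0,1]], [-14,12,12,2,2])]"

definition prism42_heights :: "int list" where
  "prism42_heights = [2, 12, 6, 2, 6, 0, 0, 10, 0, 6, 12, 4, 10, 6, 10, 12, 12, 2, 4, 10]"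

definition prism42_colours :: "nat list" where
  "prism42_colours = [0, 1, 5, 2, 5, 3, 4, 6, 1, 4, 2, 0, 2, 5, 6, 1, 4, 6, 3, 5]"

definition prism42_facets :: "((nat \<times> int list) list \<times> int list) list" where
  "prism42_facets = [
    ([(0,[0,0]),(0,[1,0]),(0,[1,1]),(1,[1,0]),(2,[1,0]),(3,[1,0]),(4,[1,0])],[2,-10,-4,-4,-8,10,-10]),
    ([(0,[0,0]),(2,[0,0]),(0,[1,1]),(4,[0,1]),(1,[0,1]),(0,[0,1]),(3,[0,1])],[2,-4,0,6,0,-4,4]),
    ([(0,[0,0]),(2,[0,0]),(0,[1,1]),(1,[1,0]),(1,[0,1]),(3,[1,0]),(4,[1,0])],[2,0,0,6,2,0,0]),
    ([(0,[0,0]),(2,[0,0]),(0,[1,1]),(1,[1,0]),(2,[1,0]),(3,[1,0]),(4,[1,0])],[2,-6,0,0,-4,6,-6]),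
    ([(0,[0,0]),(2,[0,0]),(0,[1,1]),(4,[0,1]),(1,[0,1]),(3,[1,0]),(3,[0,1])],[2,-2,0,8,2,-2,2]),
    ([(0,[0,0]),(2,[0,0]),(0,[1,1]),(4,[0,1]),(1,[0,1]),(3,[1,0]),(4,[1,0])],[2,-1,0,7,3,-1,1]),
    ([(0,[0,0]),(2,[0,0]),(3,[0,0]),(1,[1,0]),(1,[0,1]),(1,[0,0]),(4,[1,0])],[2,6,0,10,8,-6,-6]),
    ([(0,[0,0]),(2,[0,0]),(3,[0,0]),(4,[0,1]),(1,[0,1]),(1,[0,0]),(4,[1,0])],[2,6,0,10,10,-8,-6]),
    ([(0,[0,0]),(2,[0,0]),(3,[0,0]),(4,[0,1]),(4,[0,0]),(1,[0,0]),(4,[1,0])],[2,6,0,10,12,-10,-8]),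
    ([(0,[0,0]),(2,[0,0]),(3,[0,0]),(1,[1,0]),(1,[0,1]),(3,[1,0]),(4,[1,0])],[2,4,0,10,6,-4,-4]),
    ([(0,[0,0]),(2,[0,0]),(3,[0,0]),(4,[0,1]),(1,[0,1]),(3,[1,0]),(3,[0,1])],[2,0,0,10,4,-4,0]),
    ([(0,[0,0]),(2,[0,0]),(3,[0,0]),(4,[0,1]),(1,[0,1]),(3,[1,0]),(4,[1,0])],[2,2,0,10,6,-4,-2]),
    ([(2,[1,1]),(2,[0,0]),(0,[1,1]),(4,[0,1]),(1,[0,1]),(0,[0,1]),(3,[0,1])], [-2,-8,0,2,-4,-4,8]),
    ([(2,[1,1]),(2,[0,0]),(2,[0,1]),(4,[0,1]),(1,[0,1]),(0,[0,1]),(3,[0,1])], [-6,-12,0,-2,-8,-8,12]),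
    ([(2,[1,1]),(3,[1,1]),(0,[1,1]),(1,[1,0]),(1,[0,1]),(4,[1,1]),(1,[1,1])], [-18,-10,-16,-8,-10,10,10]),
    ([(2,[1,1]),(2,[0,0]),(0,[1,1]),(1,[1,0]),(1,[0,1]),(3,[1,0]),(4,[1,0])], [-2,-2,0,4,0,2,2]),
    ([(2,[1,1]),(3,[1,1]),(0,[1,1]),(1,[1,0]),(1,[0,1]),(3,[1,0]),(4,[1,0])], [-10,-6,-8,0,-4,6,6]),
    ([(2,[1,1]),(3,[1,1]),(0,[1,1]),(1,[1,0]),(1,[0,1]),(4,[1,1]),(4,[1,0])], [-14,-8,-12,-4,-6,8,8]),
    ([(2,[1,1]),(2,[0,0]),(0,[1,1]),(1,[1,0]),(2,[1,0]),(3,[1,0]),(4,[1,0])], [-2,-6,0,0,-4,6,-2]),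
    ([(2,[1,1]),(2,[0,0]),(0,[1,1]),(4,[0,1]),(1,[0,1]),(3,[1,0]),(3,[0,1])], [-2,-4,0,6,0,0,4]),
    ([(2,[1,1]),(2,[0,0]),(0,[1,1]),(4,[0,1]),(1,[0,1]),(3,[1,0]),(4,[1,0])], [-2,-3,0,5,1,1,3]),
    ([(2,[1,1]),(3,[1,1]),(0,[1,1]),(4,[0,1]),(1,[0,1]),(3,[1,0]),(3,[0,1])], [-6,-6,-4,4,-2,2,6]),
    ([(2,[1,1]),(3,[1,1]),(0,[1,1]),(4,[0,1]),(1,[0,1]),(3,[1,0]),(4,[1,0])], [-8,-6,-6,2,-2,4,6]),
    ([(2,[1,1]),(3,[1,1]),(0,[1,1]),(4,[0,1]),(1,[0,1]),(4,[1,1]),(4,[1,0])], [-12,-8,-10,-2,-4,6,8])]"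


lemma cube3_family:
  "cube_family 3 (\<lambda>v. real_of_int (cube3_heights ! bits_value v)) (\<lambda>v. cube3_colours ! bits_value v)
    (set (map fst cube3_facets)) 4"
  by (rule cube_family_check) code_simp

lemma cube4_family:
  "cube_family 4 (\<lambda>v. real_of_int (cube4_heights ! bits_value v)) (\<lambda>v. cube4_colours ! bits_value v)
    (set (map fst cube4_facets)) 2"
  by (rule cube_family_check) code_simp

lemma prism42_family:
  "prism_family 4 2 (\<lambda>(i, w). real_of_int (prism42_heights ! (4 * i + bits_value w)))
    (\<lambda>(i, w). prism42_colours ! (4 * i + bits_value w)) (set (map fst prism42_facets)) 2"
proof -
  have "prism_family 4 2 (\<lambda>v. real_of_int (case v of (i, w) \<Rightarrow> prism42_heights ! (4 * i + bits_value w)))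
    (\<lambda>(i, w). prism42_colours ! (4 * i + bits_value w)) (set (map fst prism42_facets)) 2"
    \<comment> \<open>30 = 6! / 4!, the total that the volume condition prescribes.\<close>
    by (rule prism_family_check[where x = 30]) code_simp
  then show ?thesis by (simp add: case_prod_unfold)
qed

section \<open>Triangulations of all cubes\<close>

text \<open>
  The two triangles of the square have opposite orientations, so their signed contributions cancel in
  the square. Ranking the vertices along a zigzag, with ranks \<open>0, 1, 2\<close> and \<open>1, 2, 3\<close>, turns the second
  sign around in every product with an odd-dimensional simplex.
\<close>

definition zigzag_rank :: "int list \<Rightarrow> nat" where
  "zigzag_rank v = [0, 1, 2, 3] ! bits_value v"

definition zigzag_facets :: "(int list list \<times> int list) list" where
  "zigzag_facets = [([[0,0],[1,0],[0,1]], [1,-1,-1]), ([[1,0],[0,1],[1,1]], [-1,1,1])]"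

lemma zigzag_prism:
  assumes "odd m"
  shows "\<exists>g \<gamma> \<Psi>. prism_family m 2 g \<gamma> \<Psi> (int m + 1)"
proof -
  let ?h = "\<lambda>v. [1, 0, 0, 1] ! bits_value v :: int"
  let ?\<Phi> = "set (map fst zigzag_facets)"
  have len: "length (1 # v) = Suc 2" if "v \<in> cube 2" for v using that by (simp add: cube_def)
  have p: "cpt v j = (1 # v) ! j" for v j by (simp add: cpt_def)
  have chk: "list_all (check_facet (Suc 2) ((#) 1) (cube_list 2) ?h) zigzag_facets" by code_simp
  have dist: "distinct (map fst zigzag_facets)" by code_simp
  \<comment> \<open>The total 2 = 2! says that the triangles fill the square; 0 is the cancellation
    that the ranks undo.\<close>
  have sums: "signature_sums (Suc 2) ((#) 1) zigzag_facets = (2, 0)" by code_simp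
  have det: "detp cpt (Suc 2) [[0,0],[1,0],[0,1]] = 1" "detp cpt (Suc 2) [[1,0],[0,1],[1,1]] = -1"
    by (subst detp_ldet[where coords = "(#) 1" and p = cpt], (auto simp: cpt_def)[3], code_simp)+
  have reg: "regular_family cpt (Suc 2) (cube 2) (\<lambda>v. real_of_int (?h v)) ?\<Phi>"
    by (rule regular_family_check[where coords = "(#) 1" and p = cpt, OF chk set_cube_list len p])
  have vol: "(\<Sum>T\<in>?\<Phi>. \<bar>detp cpt (Suc 2) T\<bar>) = fact 2"
    using signature_sums_check(1)[where coords = "(#) 1" and p = cpt, OF chk dist set_cube_list len p sums]
    by (simp add: fact_2)
  have rank: "zigzag_rank (T ! k) = zigzag_rank (T ! 0) + k" if "T \<in> ?\<Phi>" "k \<le> 2" for T k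
    using that by (auto simp: zigzag_facets_def zigzag_rank_def le_Suc_eq numeral_2_eq_2)
  \<comment> \<open>The second triangle has least rank 1 and determinant -1; for odd
    \<open>m\<close> its factor \<open>(-1) ^ (m + 2)\<close> is -1 too, so both triangles
    contribute 1.\<close>
  have "(\<Sum>T\<in>?\<Phi>. (-1) ^ (zigzag_rank (T ! 0) * (m + 2)) * osgn (detp cpt (Suc 2) T)) = 2"
    using assms det by (simp add: zigzag_facets_def zigzag_rank_def osgn_def)
  moreover have "2 * stair_sum m 2 = int m + 1"
    using assms unfolding stair_sum_2 by (auto elim!: oddE)
  ultimately show ?thesis
    using prism_family_stairs[OF reg rank vol, of m] by simp
qed

text \<open>The colours 0 to 4 of a facet serve as its ranks. All rotation signs are 1, and the
  signed sum 2 of the 4-cube clears the denominator of the binomial coefficient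
  \<open>stair_sum (2 * j) 4\<close>.\<close>

lemma cube4_prism:
  "\<exists>g \<gamma> \<Psi>. prism_family (2 * j) 4 g \<gamma> \<Psi> ((int j + 1) * (int j + 2))"
proof -
  define h where "h = (\<lambda>v. real_of_int (cube4_heights ! bits_value v))"
  define c where "c = (\<lambda>v. cube4_colours ! bits_value v)"
  define \<Phi> where "\<Phi> = set (map fst cube4_facets)"
  have F: "cube_family 4 h c \<Phi> 2" unfolding h_def c_def \<Phi>_def by (rule cube4_family)
  then have reg: "regular_family cpt (Suc 4) (cube 4) h \<Phi>"
    and col: "coloured c (Suc 4) \<Phi>"
    and vol: "(\<Sum>F\<in>\<Phi>. \<bar>detp cpt (Suc 4) F\<bar>) = fact 4"
    and sig: "(\<Sum>F\<in>\<Phi>. osgn (detp cpt (Suc 4) F)) = 2"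
    unfolding cube_family_def by auto
  have rank: "c (T ! k) = c (T ! 0) + k" if "T \<in> \<Phi>" "k \<le> 4" for T k
    using col that unfolding coloured_def by auto
  have "(-1 :: int) ^ (t * (2 * j + 4)) = 1" for t by (simp add: minus_one_power_iff)
  then have "(\<Sum>T\<in>\<Phi>. (-1) ^ (c (T ! 0) * (2 * j + 4)) * osgn (detp cpt (Suc 4) T)) = 2"
    by (simp only: mult_1 sig)
  then show ?thesis
    using prism_family_stairs[OF reg rank vol, of "2 * j"] by (simp only: stair_sum_4)
qed

lemma cube_family_odd: "\<exists>h c \<Phi>. cube_family (2 * k + 3) h c \<Phi> (2 ^ (k + 2) * fact (k + 1))"
proof (induction k)
  case 0
  then show ?case using cube3_family by auto
next
  case (Suc k)
  then obtain h c \<Phi> where "cube_family (2 * k + 3) h c \<Phi> (2 ^ (k + 2) * fact (k + 1))" by blast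
  moreover obtain g \<gamma> \<Psi> where "prism_family (2 * k + 3) 2 g \<gamma> \<Psi> (int (2 * k + 3) + 1)"
    using zigzag_prism[of "2 * k + 3"] by auto
  ultimately have "\<exists>h c \<Phi>. cube_family (2 * k + 3 + 2) h c \<Phi>
      (2 ^ (k + 2) * fact (k + 1) * (int (2 * k + 3) + 1))"
    by (rule cube_family_prism)
  moreover have "2 ^ (k + 2) * fact (k + 1) * (int (2 * k + 3) + 1) = 2 ^ (Suc k + 2) * fact (Suc k + 1)"
    by (simp add: algebra_simps)
  moreover have "2 * k + 3 + 2 = 2 * Suc k + 3" by simp
  ultimately show ?case by metis
qed

lemma cube_family_add_4:
  assumes "\<exists>h c \<Phi>. cube_family (2 * j) h c \<Phi> u"
  shows "\<exists>h c \<Phi>. cube_family (2 * (j + 2)) h c \<Phi> (u * ((int j + 1) * (int j + 2)))"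
proof -
  have "\<exists>h c \<Phi>. cube_family (2 * j + 4) h c \<Phi> (u * ((int j + 1) * (int j + 2)))"
    using assms cube4_prism cube_family_prism by blast
  moreover have "2 * j + 4 = 2 * (j + 2)" by simp
  ultimately show ?thesis by metis
qed

lemma fact_add_2: "(fact (n + 2) :: int) = fact n * ((int n + 1) * (int n + 2))"
  by (simp add: algebra_simps)

lemma cube_family_0_mod_4: "\<exists>h c \<Phi>. cube_family (2 * (2 * k + 2)) h c \<Phi> (fact (2 * k + 2))"
proof (induction k)
  case 0
  then show ?case using cube4_family by (auto simp: fact_2)
next
  case (Suc k)
  have "\<exists>h c \<Phi>. cube_family (2 * (2 * k + 2 + 2)) h c \<Phi> (fact (2 * k + 2 + 2))"
    using cube_family_add_4[OF Suc] unfolding fact_add_2 .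
  moreover have "2 * k + 2 + 2 = 2 * Suc k + 2" by simp
  ultimately show ?case by metis
qed

text \<open>Multiplied by 3 to stay in the integers. The 6-cube yields \<open>2 * 2\<close> in place
  of 3!, and later steps preserve this ratio.\<close>

lemma cube_family_2_mod_4:
  "\<exists>h c \<Phi> u. cube_family (2 * (2 * k + 3)) h c \<Phi> u \<and> 3 * u = 2 * fact (2 * k + 3)"
proof (induction k)
  case 0
  have "\<exists>h c \<Phi>. cube_family (4 + 2) h c \<Phi> (2 * 2)"
    using cube_family_prism[OF cube4_family prism42_family] .
  then show ?case by (auto simp: fact_numeral)
next
  case (Suc k)
  then obtain u where u: "\<exists>h c \<Phi>. cube_family (2 * (2 * k + 3)) h c \<Phi> u" "3 * u = 2 * fact (2 * k + 3)"
    by blast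
  have "3 * (u * ((int (2 * k + 3) + 1) * (int (2 * k + 3) + 2))) =
      (3 * u) * ((int (2 * k + 3) + 1) * (int (2 * k + 3) + 2))" by simp
  also have "\<dots> = 2 * fact (2 * k + 3 + 2)"
    unfolding u(2) fact_add_2 by simp
  finally have "3 * (u * ((int (2 * k + 3) + 1) * (int (2 * k + 3) + 2))) = 2 * fact (2 * k + 3 + 2)" .
  moreover have "2 * k + 3 + 2 = 2 * Suc k + 3" by simp
  ultimately show ?case using cube_family_add_4[OF u(1)] by metis
qed

theorem cube_family_exists:
  assumes "d \<ge> 3"
  shows "\<exists>h c \<Phi> u. cube_family d h c \<Phi> u \<and> real_of_int u \<ge>
    (if d mod 2 = 1 then 2 ^ ((d + 1) div 2) * fact ((d - 1) div 2)
     else if d mod 4 = 0 then fact (d div 2)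
     else 2 / 3 * fact (d div 2))"
proof -
  consider k where "d = 2 * k + 3" | k where "d = 2 * (2 * k + 2)" | k where "d = 2 * (2 * k + 3)"
  proof -
    assume th: "\<And>k. d = 2 * k + 3 \<Longrightarrow> thesis" "\<And>k. d = 2 * (2 * k + 2) \<Longrightarrow> thesis"
      "\<And>k. d = 2 * (2 * k + 3) \<Longrightarrow> thesis"
    \<comment> \<open>The subtracted 3, 4 and 6 are the base dimensions of the three
      inductions.\<close>
    have "d = 2 * ((d - 3) div 2) + 3 \<or> d = 2 * (2 * ((d - 4) div 4) + 2) \<or> d = 2 * (2 * ((d - 6) div 4) + 3)"
      using assms by presburger
    then show thesis using th by blast
  qed
  then show ?thesis
  proof cases
    case (1 k)
    obtain h c \<Phi> where "cube_family d h c \<Phi> (2 ^ (k + 2) * fact (k + 1))"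
      using cube_family_odd 1 by blast
    moreover have "d mod 2 = 1" "(d + 1) div 2 = k + 2" "(d - 1) div 2 = k + 1" using 1 by presburger+
    ultimately show ?thesis by (intro exI conjI) auto
  next
    case (2 k)
    obtain h c \<Phi> where "cube_family d h c \<Phi> (fact (2 * k + 2))"
      using cube_family_0_mod_4 2 by blast
    moreover have "d mod 2 = 0" "d mod 4 = 0" "d div 2 = 2 * k + 2" using 2 by presburger+
    ultimately show ?thesis by (intro exI conjI) auto
  next
    case (3 k)
    obtain h c \<Phi> u where u: "cube_family d h c \<Phi> u" "3 * u = 2 * fact (2 * k + 3)"
      using cube_family_2_mod_4 3 by blast
    have d: "d mod 2 = 0" "d mod 4 \<noteq> 0" "d div 2 = 2 * k + 3" using 3 by presburger+
    have "3 * real_of_int u = 2 * fact (2 * k + 3)"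
      using arg_cong[OF u(2), of real_of_int] by simp
    then have "real_of_int u = 2 / 3 * fact (d div 2)" unfolding d(3) by simp
    with d u(1) show ?thesis by (intro exI conjI) auto
  qed
qed

section \<open>Signs of adjacent facets\<close>

text \<open>This is the coefficient matrix of a facet with respect to a neighbour that differs from
  it in the \<open>k\<close>-th vertex only.\<close>

lemma det_replaced_row:
  assumes "k < N" "\<And>l j. l < N \<Longrightarrow> j < N \<Longrightarrow> l \<noteq> k \<Longrightarrow> r l j = (if l = j then 1 else 0)"
  shows "Determinant.det (Matrix.mat N N (\<lambda>(l, j). r l j)) = (r k k :: 'a::idom)"
proof -
  let ?R = "Matrix.mat N N (\<lambda>(l, j). r l j)"
  have "Determinant.det ?R = (\<Sum>l<N. ?R $$ (l, k) * cofactor ?R l k)"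
    using assms by (intro laplace_expansion_column) auto
  also have "\<dots> = (\<Sum>l<N. if l = k then r k k * cofactor ?R k k else 0)"
    using assms by (intro sum.cong) auto
  also have "\<dots> = r k k * Determinant.det (mat_delete ?R k k)"
    using assms(1) by (simp add: cofactor_def flip: mult_2 add: power_mult)
  also have "mat_delete ?R k k = Matrix.mat (N - 1) (N - 1) (\<lambda>(l, j). if l = j then 1 else 0)"
    using assms by (intro eq_matI) (auto simp: mat_delete_def)
  finally show ?thesis by (simp add: det_id_mat_fun)
qed

text \<open>
  If \<open>G\<close> arises from \<open>F\<close> by exchanging the \<open>k\<close>-th vertex, then \<open>det G = \<lambda> det F\<close> for the
  \<open>k\<close>-th coordinate \<open>\<lambda>\<close> of the new vertex with respect to \<open>F\<close>; comparing the supporting functions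
  of \<open>F\<close> and \<open>G\<close> at the two exchanged vertices gives \<open>\<lambda> < 0\<close>.
\<close>

lemma adjacent_facets_opposite:
  assumes reg: "regular_family p N V h \<Phi>" and F: "F \<in> \<Phi>" and G: "G \<in> \<Phi>"
    and k: "k < N" and same: "\<And>l. l < N \<Longrightarrow> l \<noteq> k \<Longrightarrow> F ! l = G ! l"
    and new: "F ! k \<notin> set G" "G ! k \<notin> set F"
  shows "detp p N F * detp p N G < 0"
proof -
  have len: "length F = N" "length G = N" and sub: "set F \<subseteq> V" "set G \<subseteq> V"
    and det: "detp p N F \<noteq> 0" "detp p N G \<noteq> 0"
    using reg F G unfolding regular_family_def by auto
  obtain a where a: "\<And>v. v \<in> V \<Longrightarrow> lin N a (p v) \<le> h v \<and> (lin N a (p v) = h v \<longleftrightarrow> v \<in> set F)"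
    using reg F unfolding regular_family_def by meson
  obtain b where b: "\<And>v. v \<in> V \<Longrightarrow> lin N b (p v) \<le> h v \<and> (lin N b (p v) = h v \<longleftrightarrow> v \<in> set G)"
    using reg G unfolding regular_family_def by meson
  obtain B where B: "\<And>k l. k < N \<Longrightarrow> l < N \<Longrightarrow> lin N (B l) (p (F ! k)) = (if k = l then 1 else 0)"
    and expand: "\<And>y x. x < N \<Longrightarrow> real_of_int (y x) = (\<Sum>j<N. lin N (B j) y * of_int (p (F ! j) x))"
    using dual_basis[OF det(1)] by metis
  define r where "r = (\<lambda>l j. lin N (B j) (p (G ! l)))"
  have lin_expand: "lin N f y = (\<Sum>j<N. lin N (B j) y * lin N f (p (F ! j)))" for f y
  proof -
    have "lin N f y = (\<Sum>x<N. f x * (\<Sum>j<N. lin N (B j) y * of_int (p (F ! j) x)))"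
      unfolding lin_def[of N f y] by (rule sum.cong) (auto simp: expand)
    also have "\<dots> = (\<Sum>j<N. lin N (B j) y * lin N f (p (F ! j)))"
      unfolding lin_def[of N f] sum_distrib_left by (subst sum.swap) (simp add: mult_ac)
    finally show ?thesis .
  qed
  have mem: "F ! l \<in> V" "G ! l \<in> V" "F ! l \<in> set F" "G ! l \<in> set G" if "l < N" for l
    using that len sub by auto
  have "real_of_int (detp p N G) = Determinant.det (Matrix.mat N N (\<lambda>(l, x). real_of_int (p (G ! l) x)))"
    unfolding detp_def of_int_hom.hom_det[symmetric]
    by (rule arg_cong[where f = Determinant.det], rule eq_matI) auto
  also have "\<dots> = Determinant.det (Matrix.mat N N (\<lambda>(l, x). r l x)) *
      Determinant.det (Matrix.mat N N (\<lambda>(l, x). real_of_int (p (F ! l) x)))"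
    by (rule det_as_product) (simp add: r_def expand)
  also have "Determinant.det (Matrix.mat N N (\<lambda>(l, x). r l x)) = r k k"
    using k by (rule det_replaced_row) (auto simp: r_def B simp flip: same)
  also have "Determinant.det (Matrix.mat N N (\<lambda>(l, x). real_of_int (p (F ! l) x))) = real_of_int (detp p N F)"
    unfolding detp_def of_int_hom.hom_det[symmetric]
    by (rule arg_cong[where f = Determinant.det], rule eq_matI) auto
  finally have prod: "real_of_int (detp p N G) = r k k * real_of_int (detp p N F)" .
  \<comment> \<open>The contribution of the shared vertices, where both supporting functions equal
    the heights; it is common to both expansions at \<open>G ! k\<close> and cancels.\<close>
  define s where "s = (\<Sum>j\<in>{..<N} - {k}. r k j * h (F ! j))"
  have split: "(\<Sum>j<N. r k j * f j) = r k k * f k + (\<Sum>j\<in>{..<N} - {k}. r k j * f j)" for f :: "nat \<Rightarrow> real"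
    using k by (simp add: sum.remove)
  have "lin N a (p (G ! k)) = (\<Sum>j<N. r k j * h (F ! j))"
    unfolding lin_expand[of a "p (G ! k)"]
  proof (rule sum.cong[OF refl])
    fix j assume "j \<in> {..<N}"
    then have "lin N a (p (F ! j)) = h (F ! j)" using a mem[of j] by blast
    then show "lin N (B j) (p (G ! k)) * lin N a (p (F ! j)) = r k j * h (F ! j)"
      by (simp add: r_def)
  qed
  then have "lin N a (p (G ! k)) = r k k * h (F ! k) + s" by (simp only: split s_def)
  moreover have "lin N a (p (G ! k)) < h (G ! k)"
    using a[of "G ! k"] mem[OF k] new(2) by (simp add: less_le)
  moreover have "lin N b (p (G ! k)) = r k k * lin N b (p (F ! k)) + s"
  proof -
    have "lin N b (p (F ! j)) = h (F ! j)" if "j < N" "j \<noteq> k" for j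
      using b[of "F ! j"] mem[OF that(1)] same[OF that] by simp
    then have "(\<Sum>j\<in>{..<N} - {k}. r k j * lin N b (p (F ! j))) = s"
      unfolding s_def by (intro sum.cong) auto
    moreover have "lin N b (p (G ! k)) = (\<Sum>j<N. r k j * lin N b (p (F ! j)))"
      unfolding r_def by (rule lin_expand)
    ultimately show ?thesis by (simp only: split)
  qed
  moreover have "lin N b (p (G ! k)) = h (G ! k)" using b mem[OF k] by blast
  moreover have "lin N b (p (F ! k)) < h (F ! k)"
    using b[of "F ! k"] mem[OF k] new(1) by (simp add: less_le)
  \<comment> \<open>At \<open>G ! k\<close> the function of \<open>F\<close> lies strictly below the
    height and that of \<open>G\<close> attains it:
    \<open>r k k * h (F ! k) + s < r k k * lin N b (p (F ! k)) + s\<close>.\<close>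
  ultimately have "r k k * (h (F ! k) - lin N b (p (F ! k))) < 0" "0 < h (F ! k) - lin N b (p (F ! k))"
    by (auto simp: algebra_simps)
  then have "r k k < 0" by (simp add: mult_less_0_iff)
  then have "r k k * (real_of_int (detp p N F))\<^sup>2 < 0" using det(1) by (simp add: mult_neg_pos)
  then have "real_of_int (detp p N F * detp p N G) < 0"
    by (simp add: prod power2_eq_square mult_ac)
  then show ?thesis by (simp only: of_int_less_0_iff)
qed

text \<open>A common vertex occupies the position of its colour in both lists, so sharing all but
  one vertex means differing in exactly one position.\<close>

lemma shared_ridge_opposite:
  assumes reg: "regular_family p N V h \<Phi>" and col: "coloured c N \<Phi>"
    and F: "F \<in> \<Phi>" and G: "G \<in> \<Phi>" and card: "Suc (card (set F \<inter> set G)) = N"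
  shows "detp p N F * detp p N G < 0"
proof -
  have len: "length F = N" "length G = N" using reg F G unfolding regular_family_def by auto
  have cF: "c (F ! l) = l" "c (G ! l) = l" if "l < N" for l
    using col F G that unfolding coloured_def by auto
  have inF: "v = F ! c v \<and> c v < N" if "v \<in> set F" for v
    using that len cF by (auto simp: in_set_conv_nth)
  have inG: "v = G ! c v \<and> c v < N" if "v \<in> set G" for v
    using that len cF by (auto simp: in_set_conv_nth)
  define A where "A = {l. l < N \<and> F ! l = G ! l}"
  have "A = c ` (set F \<inter> set G)"
  proof
    show "A \<subseteq> c ` (set F \<inter> set G)"
    proof
      fix l assume "l \<in> A"
      then have "l < N" "F ! l = G ! l" by (auto simp: A_def)
      then have "F ! l \<in> set F \<inter> set G" "l = c (F ! l)" using len cF by (auto simp: in_set_conv_nth)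
      then show "l \<in> c ` (set F \<inter> set G)" by blast
    qed
    show "c ` (set F \<inter> set G) \<subseteq> A"
      using inF inG by (auto simp: A_def)
  qed
  moreover have "inj_on c (set F \<inter> set G)"
    by (rule inj_onI) (use inF in \<open>metis IntD1\<close>)
  ultimately have "Suc (card A) = N" using card by (simp add: card_image)
  moreover have "A \<subseteq> {..<N}" by (auto simp: A_def)
  ultimately have "card ({..<N} - A) = 1" by (simp add: card_Diff_subset finite_subset)
  then obtain k where k: "{..<N} - A = {k}" by (auto simp: card_1_singleton_iff)
  then have kN: "k < N" and ne: "F ! k \<noteq> G ! k" by (auto simp: A_def)
  show ?thesis
  proof (rule adjacent_facets_opposite[OF reg F G kN])
    show "F ! l = G ! l" if "l < N" "l \<noteq> k" for l
      using that k by (auto simp: A_def)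
    show "F ! k \<notin> set G" "G ! k \<notin> set F"
      using inF inG cF[OF kN] ne by metis+
  qed
qed

section \<open>Regular subdivisions\<close>

text \<open>The left side is a face, hence the hull of some of the generators, and these must lie on
  the hyperplane.\<close>

lemma convex_hull_Int_supporting:
  fixes G :: "'a::euclidean_space set"
  assumes "finite G" "\<And>z. z \<in> G \<Longrightarrow> b \<le> c \<bullet> z"
  shows "convex hull G \<inter> {z. c \<bullet> z = b} = convex hull (G \<inter> {z. c \<bullet> z = b})"
proof
  have ge: "b \<le> c \<bullet> z" if "z \<in> convex hull G" for z
  proof -
    have "convex hull G \<subseteq> {z. c \<bullet> z \<ge> b}"
      using assms(2) by (intro hull_minimal convex_halfspace_ge) auto
    then show ?thesis using that by blast
  qed
  then have "(convex hull G \<inter> {z. c \<bullet> z = b}) face_of convex hull G"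
    by (intro face_of_Int_supporting_hyperplane_ge) auto
  then obtain S where S: "S \<subseteq> G" "convex hull G \<inter> {z. c \<bullet> z = b} = convex hull S"
    using face_of_convex_hull_subset finite_imp_compact[OF assms(1)] by metis
  then have "S \<subseteq> G \<inter> {z. c \<bullet> z = b}" using hull_subset[of S convex] by auto
  then show "convex hull G \<inter> {z. c \<bullet> z = b} \<subseteq> convex hull (G \<inter> {z. c \<bullet> z = b})"
    unfolding S(2) by (rule hull_mono)
  show "convex hull (G \<inter> {z. c \<bullet> z = b}) \<subseteq> convex hull G \<inter> {z. c \<bullet> z = b}"
    using hull_subset[of G convex] by (intro hull_minimal convex_Int convex_hyperplane) auto
qed

lemma affine_le_on_hull:
  assumes "\<And>w. w \<in> W \<Longrightarrow> c \<bullet> w + e \<le> 0" "x \<in> convex hull W"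
  shows "c \<bullet> x + e \<le> (0 :: real)"
proof -
  have "convex hull W \<subseteq> {z. c \<bullet> z \<le> - e}"
    using assms(1) by (intro hull_minimal convex_halfspace_le) force
  then show ?thesis using assms(2) by force
qed

lemma affine_zero_on_hull:
  assumes "\<And>w. w \<in> W \<Longrightarrow> c \<bullet> w + e = (0 :: real)" "x \<in> affine hull W"
  shows "c \<bullet> x + e = 0"
proof -
  have "affine hull W \<subseteq> {z. c \<bullet> z = - e}"
    using assms(1) by (intro hull_minimal affine_hyperplane) force
  then show ?thesis using assms(2) by force
qed

text \<open>Counterpart of \<open>regular_family\<close> for sets of points.
  \<open>facet_dual\<close> provides barycentric coordinates and thereby encodes affine
  independence.\<close>

locale regular_system =
  fixes V :: "'a::euclidean_space set" and h :: "'a \<Rightarrow> real" and \<Phi> :: "'a set set"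
  assumes finite_V: "finite V"
    and facet_subset: "\<And>S. S \<in> \<Phi> \<Longrightarrow> S \<subseteq> V"
    and facet_card: "\<And>S. S \<in> \<Phi> \<Longrightarrow> card S = Suc DIM('a)"
    and facet_dual: "\<And>S s. S \<in> \<Phi> \<Longrightarrow> s \<in> S \<Longrightarrow> \<exists>c e. \<forall>t\<in>S. c \<bullet> t + e = (if t = s then 1 else 0)"
    and facet_support: "\<And>S. S \<in> \<Phi> \<Longrightarrow> \<exists>a b. \<forall>v\<in>V. a \<bullet> v + b \<le> h v \<and> (a \<bullet> v + b = h v \<longleftrightarrow> v \<in> S)"
begin

lemma finite_facet: "S \<in> \<Phi> \<Longrightarrow> finite S"
  using facet_subset finite_V finite_subset by blast

lemma facets_in_Pow: "\<Phi> \<subseteq> Pow V"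
  using facet_subset by blast

lemma finite_facets: "finite \<Phi>"
  using facets_in_Pow finite_V finite_subset by blast

text \<open>If \<open>s\<close> were not in \<open>W\<close>, its barycentric coordinate would
  vanish on \<open>W\<close>, hence on the affine hull, but it is 1 at \<open>s\<close>.\<close>

lemma mem_affine_hull_facet:
  assumes S: "S \<in> \<Phi>" and s: "s \<in> S" and W: "W \<subseteq> S" "s \<in> affine hull W"
  shows "s \<in> W"
proof (rule ccontr)
  assume "s \<notin> W"
  obtain c e where ce: "\<forall>t\<in>S. c \<bullet> t + e = (if t = s then 1 else 0 :: real)"
    using facet_dual[OF S s] by blast
  then have "c \<bullet> w + e = 0" if "w \<in> W" for w using that W(1) \<open>s \<notin> W\<close> by auto
  then have "c \<bullet> s + e = 0" using W(2) by (rule affine_zero_on_hull)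
  then show False using ce s by auto
qed

lemma mem_convex_hull_facet:
  assumes "S \<in> \<Phi>" "s \<in> S" "W \<subseteq> S" "s \<in> convex hull W"
  shows "s \<in> W"
  using mem_affine_hull_facet[OF assms(1-3)] assms(4) convex_hull_subset_affine_hull by blast

lemma affine_independent_facet:
  assumes "S \<in> \<Phi>"
  shows "\<not> affine_dependent S"
  unfolding affine_dependent_def
proof
  assume "\<exists>x\<in>S. x \<in> affine hull (S - {x})"
  then obtain x where "x \<in> S" "x \<in> affine hull (S - {x})" by blast
  then show False using mem_affine_hull_facet[OF assms, of x "S - {x}"] by auto
qed

lemma face_independent: "S \<in> \<Phi> \<Longrightarrow> W \<subseteq> S \<Longrightarrow> \<not> affine_dependent W"
  using affine_independent_facet affine_independent_subset by blast

lemma simplex_face: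
  assumes "S \<in> \<Phi>" "W \<subseteq> S"
  shows "n simplex (convex hull W) \<longleftrightarrow> int (card W) = n + 1"
proof
  assume "n simplex (convex hull W)"
  then have "aff_dim W = n" using aff_dim_simplex aff_dim_convex_hull by metis
  then show "int (card W) = n + 1"
    using aff_dim_affine_independent[OF face_independent[OF assms]] by simp
qed (simp add: simplex_convex_hull face_independent[OF assms])

lemma Int_faces_same_facet:
  assumes S: "S \<in> \<Phi>" and W: "W \<subseteq> S" "W' \<subseteq> S"
  shows "convex hull W \<inter> convex hull W' = convex hull (W \<inter> W')"
proof
  have "(convex hull W) face_of (convex hull S)" "(convex hull W') face_of (convex hull S)"
    using face_of_convex_hull_affine_independent[OF affine_independent_facet[OF S]] W by blast+
  then have "(convex hull W \<inter> convex hull W') face_of (convex hull S)" by (rule face_of_Int)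
  then obtain c where c: "c \<subseteq> S" "convex hull W \<inter> convex hull W' = convex hull c"
    using face_of_convex_hull_affine_independent[OF affine_independent_facet[OF S]] by blast
  have "c \<subseteq> W \<inter> W'"
  proof
    fix s assume s: "s \<in> c"
    then have "s \<in> convex hull W \<inter> convex hull W'" unfolding c(2) by (rule hull_inc)
    then show "s \<in> W \<inter> W'" using mem_convex_hull_facet[OF S] s c(1) W by blast
  qed
  then show "convex hull W \<inter> convex hull W' \<subseteq> convex hull (W \<inter> W')"
    unfolding c(2) by (rule hull_mono)
  show "convex hull (W \<inter> W') \<subseteq> convex hull W \<inter> convex hull W'"
    by (simp add: hull_mono)
qed

text \<open>The supporting function of \<open>S\<close> dominates that of \<open>S'\<close> on
  \<open>W\<close>, and the reverse holds on \<open>W'\<close>; so they agree at every common point.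
  Such a point lies in the hull of the vertices of \<open>W\<close> where they agree, and these
  belong to \<open>S'\<close>. This reduces the claim to two faces of the single facet
  \<open>S'\<close>.\<close>

lemma Int_faces:
  assumes S: "S \<in> \<Phi>" "W \<subseteq> S" and S': "S' \<in> \<Phi>" "W' \<subseteq> S'"
  shows "convex hull W \<inter> convex hull W' = convex hull (W \<inter> W')"
proof
  obtain a b where ab: "\<And>v. v \<in> V \<Longrightarrow> a \<bullet> v + b \<le> h v \<and> (a \<bullet> v + b = h v \<longleftrightarrow> v \<in> S)"
    using facet_support[OF S(1)] by blast
  obtain a' b' where ab': "\<And>v. v \<in> V \<Longrightarrow> a' \<bullet> v + b' \<le> h v \<and> (a' \<bullet> v + b' = h v \<longleftrightarrow> v \<in> S')"
    using facet_support[OF S'(1)] by blast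
  have WV: "w \<in> V" if "w \<in> W" for w using that S facet_subset by blast
  have WV': "w \<in> V" if "w \<in> W'" for w using that S' facet_subset by blast
  have dW: "b' - b \<le> (a - a') \<bullet> w" if "w \<in> W" for w
  proof -
    have "a \<bullet> w + b = h w" using ab[OF WV[OF that]] that S by blast
    then show ?thesis using ab'[OF WV[OF that]] by (simp add: inner_diff_left)
  qed
  show "convex hull W \<inter> convex hull W' \<subseteq> convex hull (W \<inter> W')"
  proof
    fix x assume x: "x \<in> convex hull W \<inter> convex hull W'"
    have "(a' - a) \<bullet> x + (b' - b) \<le> 0"
    proof (rule affine_le_on_hull[of W])
      show "(a' - a) \<bullet> w + (b' - b) \<le> 0" if "w \<in> W" for w
        using dW[OF that] by (simp add: inner_diff_left)
    qed (use x in blast)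
    moreover have "(a - a') \<bullet> x + (b - b') \<le> 0"
    proof (rule affine_le_on_hull[of W'])
      fix w assume w: "w \<in> W'"
      have "a' \<bullet> w + b' = h w" using ab'[OF WV'[OF w]] w S' by blast
      then show "(a - a') \<bullet> w + (b - b') \<le> 0" using ab[OF WV'[OF w]] by (simp add: inner_diff_left)
    qed (use x in blast)
    ultimately have "(a - a') \<bullet> x = b' - b" by (simp add: inner_diff_left)
    then have "x \<in> convex hull (W \<inter> {z. (a - a') \<bullet> z = b' - b})"
      using convex_hull_Int_supporting[of W "b' - b" "a - a'"] dW x
        finite_subset[OF S(2) finite_facet[OF S(1)]] by blast
    moreover have "W \<inter> {z. (a - a') \<bullet> z = b' - b} \<subseteq> S' \<inter> W"
    proof
      fix w assume "w \<in> W \<inter> {z. (a - a') \<bullet> z = b' - b}"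
      then have w: "w \<in> W" "(a - a') \<bullet> w = b' - b" by auto
      then have "a' \<bullet> w + b' = h w" using ab[OF WV[OF w(1)]] S(2) by (auto simp: inner_diff_left)
      then show "w \<in> S' \<inter> W" using ab'[OF WV[OF w(1)]] w by blast
    qed
    ultimately have "x \<in> convex hull (S' \<inter> W)" using hull_mono by blast
    then have "x \<in> convex hull (S' \<inter> W) \<inter> convex hull W'" using x by blast
    then have "x \<in> convex hull (S' \<inter> W \<inter> W')"
      using Int_faces_same_facet[OF S'(1) _ S'(2), of "S' \<inter> W"] by simp
    then show "x \<in> convex hull (W \<inter> W')" using hull_mono[of "S' \<inter> W \<inter> W'" "W \<inter> W'" convex] by blast
  qed
  show "convex hull (W \<inter> W') \<subseteq> convex hull W \<inter> convex hull W'"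
    by (simp add: hull_mono)
qed

lemma inj_on_convex_hull_facets: "inj_on ((hull) convex) \<Phi>"
proof (rule inj_onI)
  have sub: "S \<subseteq> T" if "S \<in> \<Phi>" "T \<in> \<Phi>" "convex hull S = convex hull T" for S T
  proof
    fix s assume s: "s \<in> S"
    have "s \<in> convex hull S \<inter> convex hull T" unfolding that(3)[symmetric] using s by (simp add: hull_inc)
    then have "s \<in> convex hull (S \<inter> T)" using Int_faces[of S S T T] that by simp
    then show "s \<in> T" using mem_convex_hull_facet[OF that(1) s, of "S \<inter> T"] by blast
  qed
  then show "S = T" if "S \<in> \<Phi>" "T \<in> \<Phi>" "convex hull S = convex hull T" for S T
    using that by (metis subset_antisym)
qed

text \<open>The intersection is the hull of at most \<open>DIM('a)\<close> points, so its interior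
  is empty.\<close>

lemma negligible_Int_facets:
  assumes "S \<in> \<Phi>" "T \<in> \<Phi>" "S \<noteq> T"
  shows "negligible (convex hull S \<inter> convex hull T)"
proof -
  have "\<not> S \<subseteq> T" using assms facet_card finite_facet by (metis card_subset_eq)
  then have "card (S \<inter> T) < card S"
    by (intro psubset_card_mono finite_facet assms) blast
  then have "card (S \<inter> T) \<le> DIM('a)" using facet_card[OF assms(1)] by simp
  then have "interior (convex hull (S \<inter> T)) = {}"
    by (intro empty_interior_convex_hull) (auto simp: finite_facet assms)
  then have "negligible (convex hull (S \<inter> T))" by (simp add: negligible_convex_interior)
  then show ?thesis using Int_faces[of S S T T] assms by simp
qed

end

text \<open>Kept apart from \<open>regular_system\<close> because the covering is itself derived
  there, from volumes. \<open>extreme\<close> makes every point of \<open>V\<close> a vertex of the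
  triangulation.\<close>

locale regular_covering = regular_system +
  assumes cover: "convex hull V = (\<Union>S\<in>\<Phi>. convex hull S)"
    and nonempty: "V \<noteq> {}"
    and extreme: "\<And>v S. S \<subseteq> V \<Longrightarrow> v \<in> V \<Longrightarrow> v \<in> convex hull S \<Longrightarrow> v \<in> S"
begin

definition cells :: "'a set set" where
  "cells = {convex hull W | W. \<exists>S\<in>\<Phi>. W \<subseteq> S}"

lemma facets_nonempty: "\<Phi> \<noteq> {}"
  using cover nonempty by (metis UN_empty convex_hull_eq_empty)

text \<open>The barycentre \<open>x\<close> of \<open>W\<close> lies in some facet \<open>S\<close>.
  The affine function \<open>b - a \<bullet> z\<close> minus the supporting function of
  \<open>S\<close> is at most 0 on \<open>S\<close>, hence at \<open>x\<close>, but at least 0 on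
  \<open>W\<close>. Its mean over \<open>W\<close> is its value at \<open>x\<close>, so it vanishes
  on all of \<open>W\<close>.\<close>

lemma supported_subset:
  assumes W: "W = {v \<in> V. a \<bullet> v + h v = b}" and ge: "\<And>v. v \<in> V \<Longrightarrow> b \<le> a \<bullet> v + h v"
  shows "\<exists>S\<in>\<Phi>. W \<subseteq> S"
proof (cases "W = {}")
  case True
  then show ?thesis using facets_nonempty by blast
next
  case False
  have fW: "finite W" using finite_V W by simp
  define n where "n = real (card W)"
  have n: "n > 0" using False fW by (simp add: n_def card_gt_0_iff)
  define x where "x = (\<Sum>w\<in>W. (1 / n) *\<^sub>R w)"
  have "x \<in> convex hull W" unfolding x_def
    by (rule convex_sum[OF fW convex_convex_hull]) (use n in \<open>auto simp: n_def hull_inc\<close>)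
  then have "x \<in> convex hull V" using hull_mono[of W V convex] W by blast
  then obtain S where S: "S \<in> \<Phi>" "x \<in> convex hull S" using cover by blast
  obtain a' b' where ab: "\<And>v. v \<in> V \<Longrightarrow> a' \<bullet> v + b' \<le> h v \<and> (a' \<bullet> v + b' = h v \<longleftrightarrow> v \<in> S)"
    using facet_support[OF S(1)] by blast
  have "(- a - a') \<bullet> x + (b - b') \<le> 0"
  proof (rule affine_le_on_hull[OF _ S(2)])
    fix s assume "s \<in> S"
    then have "s \<in> V" "a' \<bullet> s + b' = h s" using facet_subset[OF S(1)] ab by blast+
    then show "(- a - a') \<bullet> s + (b - b') \<le> 0" using ge[of s] by (simp add: inner_diff_left)
  qed
  moreover have "(- a - a') \<bullet> x + (b - b') = (\<Sum>w\<in>W. (1 / n) * ((- a - a') \<bullet> w + (b - b')))"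
  proof -
    have "(- a - a') \<bullet> x = (\<Sum>w\<in>W. (1 / n) * ((- a - a') \<bullet> w))"
      unfolding x_def inner_sum_right inner_scaleR_right by (rule refl)
    moreover have "(\<Sum>w\<in>W. (1 / n) * (b - b')) = b - b'"
      using n by (simp add: n_def)
    ultimately show ?thesis by (simp only: distrib_left sum.distrib)
  qed
  moreover have nonneg: "0 \<le> (1 / n) * ((- a - a') \<bullet> w + (b - b'))" if "w \<in> W" for w
    using that ab[of w] W n by (simp add: inner_diff_left)
  moreover have "0 \<le> (\<Sum>w\<in>W. (1 / n) * ((- a - a') \<bullet> w + (b - b')))"
    by (rule sum_nonneg) (rule nonneg)
  ultimately have "(\<Sum>w\<in>W. (1 / n) * ((- a - a') \<bullet> w + (b - b'))) = 0" by linarith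
  then have zero: "(- a - a') \<bullet> w + (b - b') = 0" if "w \<in> W" for w
    using sum_nonneg_eq_0_iff[OF fW nonneg] that n by auto
  have "W \<subseteq> S"
  proof
    fix w assume w: "w \<in> W"
    then have "w \<in> V" "a \<bullet> w + h w = b" using W by auto
    then show "w \<in> S" using zero[OF w] ab[of w] by (simp add: inner_diff_left)
  qed
  then show ?thesis using S by blast
qed

text \<open>The supporting function of \<open>S\<close> is tilted by an affine function that is 0 on
  \<open>W\<close> and 1 on the rest of \<open>S\<close>; scaling the gaps outside \<open>S\<close>
  first keeps the tilt harmless there.\<close>

lemma subset_supported:
  assumes S: "S \<in> \<Phi>" and W: "W \<subseteq> S"
  shows "\<exists>a b. W = {v \<in> V. a \<bullet> v + h v = b} \<and> (\<forall>v\<in>V. b \<le> a \<bullet> v + h v)"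
proof -
  obtain a b where ab: "\<And>v. v \<in> V \<Longrightarrow> a \<bullet> v + b \<le> h v \<and> (a \<bullet> v + b = h v \<longleftrightarrow> v \<in> S)"
    using facet_support[OF S] by blast
  have "\<forall>s\<in>S. \<exists>c e. \<forall>t\<in>S. c \<bullet> t + e = (if t = s then 1 else 0)" using facet_dual[OF S] by blast
  then obtain c e where ce: "\<And>s t. s \<in> S \<Longrightarrow> t \<in> S \<Longrightarrow> c s \<bullet> t + e s = (if t = s then 1 else 0 :: real)"
    by metis
  \<comment> \<open>\<open>C\<close> and \<open>E\<close> give the sum of the barycentric
    coordinates of the vertices in \<open>S - W\<close>.\<close>
  define C where "C = (\<Sum>s\<in>S - W. c s)"
  define E where "E = (\<Sum>s\<in>S - W. e s)"
  have CE: "C \<bullet> t + E = (if t \<in> W then 0 else 1)" if t: "t \<in> S" for t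
  proof -
    have "C \<bullet> t + E = (\<Sum>s\<in>S - W. if t = s then 1 else 0)"
      using ce t by (simp add: C_def E_def inner_sum_left sum.distrib[symmetric])
    also have "\<dots> = (if t \<in> W then 0 else 1)"
      using t finite_facet[OF S] by (simp add: sum.delta)
    finally show ?thesis .
  qed
  have gap: "0 < h v - (a \<bullet> v + b)" if "v \<in> V - S" for v
  proof -
    have "a \<bullet> v + b \<le> h v" "a \<bullet> v + b \<noteq> h v" using ab[of v] that by blast+
    then show ?thesis by linarith
  qed
  obtain M where M: "\<And>v. v \<in> V - S \<Longrightarrow> - (C \<bullet> v + E) < M * (h v - (a \<bullet> v + b))"
    using scale_dominates[where X = "V - S" and f = "\<lambda>v. h v - (a \<bullet> v + b)" and e = "\<lambda>v. - (C \<bullet> v + E)"]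
      finite_V gap by blast
  \<comment> \<open>The maximum with 1 makes \<open>N\<close> positive, so that division by
    \<open>N\<close> restores the height coefficient 1 of a lower face.\<close>
  define N where "N = max M 1"
  have N: "N > 0" by (simp add: N_def)
  define k where "k = (\<lambda>v. N * (h v - (a \<bullet> v + b)) + (C \<bullet> v + E))"
  have k: "(k v = 0 \<longleftrightarrow> v \<in> W) \<and> 0 \<le> k v" if v: "v \<in> V" for v
  proof (cases "v \<in> S")
    case True
    then have "a \<bullet> v + b = h v" using ab[OF v] by blast
    then have "k v = (if v \<in> W then 0 else 1)" using CE[OF True] by (simp add: k_def)
    then show ?thesis by simp
  next
    case False
    then have VS: "v \<in> V - S" using v by simp
    have "M * (h v - (a \<bullet> v + b)) \<le> N * (h v - (a \<bullet> v + b))"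
      using less_imp_le[OF gap[OF VS]] by (intro mult_right_mono) (auto simp: N_def)
    then have "0 < k v" using M[OF VS] by (simp add: k_def)
    then show ?thesis using False W by auto
  qed
  define A where "A = (1 / N) *\<^sub>R C - a"
  define B where "B = b - E / N"
  have eq: "A \<bullet> v + h v = B + k v / N" for v
    using N by (simp add: A_def B_def k_def inner_diff_left field_simps)
  have "A \<bullet> v + h v = B \<longleftrightarrow> v \<in> W" "B \<le> A \<bullet> v + h v" if "v \<in> V" for v
    using k[OF that] N unfolding eq by simp_all
  moreover have "W \<subseteq> V" using W facet_subset[OF S] by blast
  ultimately have "W = {v \<in> V. A \<bullet> v + h v = B} \<and> (\<forall>v\<in>V. B \<le> A \<bullet> v + h v)" by blast
  then show ?thesis by blast
qed

text \<open>The hyperplane is \<open>(a, 1) \<bullet> z = b\<close> in the product space; its face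
  is spanned by the lifted points on it, and projection commutes with the hull.\<close>

lemma fst_lower_face:
  assumes "\<And>v. v \<in> V \<Longrightarrow> b \<le> a \<bullet> v + h v"
  shows "fst ` (lifted_polytope h V \<inter> {(x, t). a \<bullet> x + t = b}) = convex hull {v \<in> V. a \<bullet> v + h v = b}"
proof -
  let ?G = "(\<lambda>v. (v, h v)) ` V"
  have H: "{(x, t). a \<bullet> x + t = b} = {z. (a, 1) \<bullet> z = b}" by (auto simp: inner_Pair)
  have "lifted_polytope h V \<inter> {(x, t). a \<bullet> x + t = b} = convex hull (?G \<inter> {z. (a, 1) \<bullet> z = b})"
    unfolding H lifted_polytope_def
    by (rule convex_hull_Int_supporting) (use assms finite_V in \<open>auto simp: inner_Pair\<close>)
  then have "fst ` (lifted_polytope h V \<inter> {(x, t). a \<bullet> x + t = b}) =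
      convex hull (fst ` (?G \<inter> {z. (a, 1) \<bullet> z = b}))"
    by (simp add: convex_hull_linear_image linear_fst)
  also have "fst ` (?G \<inter> {z. (a, 1) \<bullet> z = b}) = {v \<in> V. a \<bullet> v + h v = b}"
    by (force simp: inner_Pair)
  finally show ?thesis .
qed

lemma lifted_polytope_above:
  "lifted_polytope h V \<subseteq> {(x, t). b \<le> a \<bullet> x + t} \<longleftrightarrow> (\<forall>v\<in>V. b \<le> a \<bullet> v + h v)"
proof -
  have H: "{(x, t). b \<le> a \<bullet> x + t} = {z. (a, 1) \<bullet> z \<ge> b}" by (auto simp: inner_Pair)
  have "convex {(x, t). b \<le> a \<bullet> x + t}" unfolding H by (rule convex_halfspace_ge)
  then have "lifted_polytope h V \<subseteq> {(x, t). b \<le> a \<bullet> x + t} \<longleftrightarrow>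
      (\<lambda>v. (v, h v)) ` V \<subseteq> {(x, t). b \<le> a \<bullet> x + t}"
    unfolding lifted_polytope_def by (meson hull_minimal hull_subset order_trans)
  then show ?thesis by auto
qed

theorem induced_subdivision_eq: "induced_subdivision h V = cells"
proof
  show "induced_subdivision h V \<subseteq> cells"
  proof
    fix X assume "X \<in> induced_subdivision h V"
    then obtain a b where ge: "\<forall>v\<in>V. b \<le> a \<bullet> v + h v"
      and X: "X = fst ` (lifted_polytope h V \<inter> {(x, t). a \<bullet> x + t = b})"
      unfolding induced_subdivision_def lower_face_def lifted_polytope_above by blast
    have "X = convex hull {v \<in> V. a \<bullet> v + h v = b}" unfolding X using ge by (intro fst_lower_face) auto
    then show "X \<in> cells"
      using supported_subset[OF refl, of b a] ge unfolding cells_def by blast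
  qed
  show "cells \<subseteq> induced_subdivision h V"
  proof
    fix X assume "X \<in> cells"
    then obtain W S where W: "S \<in> \<Phi>" "W \<subseteq> S" and X: "X = convex hull W" unfolding cells_def by blast
    obtain a b where ab: "W = {v \<in> V. a \<bullet> v + h v = b}" "\<forall>v\<in>V. b \<le> a \<bullet> v + h v"
      using subset_supported[OF W] by blast
    have "X = fst ` (lifted_polytope h V \<inter> {(x, t). a \<bullet> x + t = b})"
      unfolding X ab(1) using ab(2) by (intro fst_lower_face[symmetric]) auto
    then show "X \<in> induced_subdivision h V"
      using ab(2) unfolding induced_subdivision_def lower_face_def lifted_polytope_above by blast
  qed
qed

lemma simplicial_complex_cells: "simplicial_complex cells"
  unfolding simplicial_complex_def
proof (intro conjI ballI allI impI)
  have "cells \<subseteq> (hull) convex ` Pow V" unfolding cells_def using facet_subset by blast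
  then show "finite cells" using finite_V by (meson finite_Pow_iff finite_imageI finite_subset)
next
  fix X assume "X \<in> cells"
  then obtain W S where W: "S \<in> \<Phi>" "W \<subseteq> S" and X: "X = convex hull W" unfolding cells_def by blast
  show "\<exists>n. n simplex X"
    unfolding X by (rule exI[of _ "int (card W) - 1"]) (simp add: simplex_face[OF W])
next
  fix F X assume "X \<in> cells \<and> F face_of X"
  then obtain W S where W: "S \<in> \<Phi>" "W \<subseteq> S" and F: "F face_of convex hull W"
    unfolding cells_def by blast
  then obtain W' where "W' \<subseteq> W" "F = convex hull W'"
    using face_of_convex_hull_affine_independent[OF face_independent[OF W]] by blast
  then show "F \<in> cells" using W unfolding cells_def by blast
next
  fix X X' assume "X \<in> cells \<and> X' \<in> cells"
  then obtain W S W' S' where W: "S \<in> \<Phi>" "W \<subseteq> S" and W': "S' \<in> \<Phi>" "W' \<subseteq> S'"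
    and X: "X = convex hull W" "X' = convex hull W'" unfolding cells_def by blast
  show "(X \<inter> X') face_of X"
    unfolding X Int_faces[OF W W'] face_of_convex_hull_affine_independent[OF face_independent[OF W]]
    by blast
qed

lemma Union_cells: "\<Union>cells = convex hull V"
proof
  show "\<Union>cells \<subseteq> convex hull V"
    unfolding cells_def using facet_subset hull_mono[of _ V convex] by blast
  show "convex hull V \<subseteq> \<Union>cells"
    unfolding cover cells_def by blast
qed

lemma vertices_cells: "vertices cells = V"
proof
  show "vertices cells \<subseteq> V"
  proof
    fix v assume "v \<in> vertices cells"
    then obtain W S where W: "S \<in> \<Phi>" "W \<subseteq> S" and v: "{v} = convex hull W"
      unfolding cells_def vertices_def by blast
    then have "W \<subseteq> {v}" "W \<noteq> {}" using hull_subset[of W convex] by auto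
    then show "v \<in> V" using W facet_subset by blast
  qed
  show "V \<subseteq> vertices cells"
  proof
    fix v assume v: "v \<in> V"
    then have "v \<in> convex hull V" by (rule hull_inc)
    then obtain S where S: "S \<in> \<Phi>" "v \<in> convex hull S" using cover by blast
    then have "{v} \<subseteq> S" using extreme[OF facet_subset[OF S(1)] v] by blast
    then have "convex hull {v} \<in> cells" using S(1) unfolding cells_def by blast
    then show "v \<in> vertices cells" unfolding vertices_def by simp
  qed
qed

lemma facets_cells: "facets cells = (hull) convex ` \<Phi>"
proof
  show "facets cells \<subseteq> (hull) convex ` \<Phi>"
  proof
    fix X assume "X \<in> facets cells"
    then obtain W S where W: "S \<in> \<Phi>" "W \<subseteq> S" and X: "X = convex hull W" "int DIM('a) simplex X"
      unfolding cells_def facets_def by blast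
    then have "card W = card S" using simplex_face[OF W, of "int DIM('a)"] facet_card[OF W(1)] by simp
    then have "W = S" using card_subset_eq[OF finite_facet[OF W(1)] W(2)] by simp
    then show "X \<in> (hull) convex ` \<Phi>" using X W by blast
  qed
  show "(hull) convex ` \<Phi> \<subseteq> facets cells"
  proof
    fix X assume "X \<in> (hull) convex ` \<Phi>"
    then obtain S where S: "S \<in> \<Phi>" "X = convex hull S" by blast
    then show "X \<in> facets cells"
      unfolding facets_def cells_def
      using simplex_face[OF S(1) subset_refl, of "int DIM('a)"] facet_card[OF S(1)] by auto
  qed
qed

lemma adjacent_card:
  assumes "S \<in> \<Phi>" "T \<in> \<Phi>" "adjacent_facets (convex hull S) (convex hull T)"
  shows "card (S \<inter> T) = DIM('a)"
proof -
  have "(int DIM('a) - 1) simplex (convex hull (S \<inter> T))"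
    using assms(3) Int_faces[of S S T T] assms(1,2) unfolding adjacent_facets_def by simp
  then show ?thesis using simplex_face[OF assms(1), of "S \<inter> T"] by simp
qed

lemma edge_in_facet:
  assumes "u \<in> V" "v \<in> V" "closed_segment u v \<in> cells"
  shows "\<exists>S\<in>\<Phi>. u \<in> S \<and> v \<in> S"
proof -
  obtain W S where W: "S \<in> \<Phi>" "W \<subseteq> S" and X: "closed_segment u v = convex hull W"
    using assms(3) unfolding cells_def by blast
  have WV: "W \<subseteq> V" using W facet_subset by blast
  have "u \<in> convex hull W" "v \<in> convex hull W" unfolding X[symmetric] by auto
  then have "u \<in> W" "v \<in> W" using extreme[OF WV] assms(1,2) by blast+
  then show ?thesis using W by blast
qed

end

section \<open>Volumes of simplices\<close>

text \<open>
  The library's volume formula for simplices requires a well-ordered index type, which a mere finite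
  type is not; hence the indices are copied to a well-ordered type.
\<close>

typedef 'a well_index = "UNIV :: 'a set" by auto

instance well_index :: (finite) finite
  by standard (metis finite_imageI finite type_definition.Abs_image[OF type_definition_well_index])

instantiation well_index :: (finite) wellorder
begin

definition less_eq_well_index :: "'a well_index \<Rightarrow> 'a well_index \<Rightarrow> bool" where
  "x \<le> y \<longleftrightarrow> to_nat_on UNIV (Rep_well_index x) \<le> to_nat_on UNIV (Rep_well_index y)"

definition less_well_index :: "'a well_index \<Rightarrow> 'a well_index \<Rightarrow> bool" where
  "x < y \<longleftrightarrow> to_nat_on UNIV (Rep_well_index x) < to_nat_on UNIV (Rep_well_index y)"

instance
proof
  fix x y :: "'a well_index"
  show "x = y" if "x \<le> y" "y \<le> x"
    using that by (simp add: less_eq_well_index_def Rep_well_index_inject countable_finite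
        eq_iff[symmetric] to_nat_on_inj)
next
  fix P :: "'a well_index \<Rightarrow> bool" and a
  assume step: "\<And>x. (\<And>y. y < x \<Longrightarrow> P y) \<Longrightarrow> P x"
  show "P a"
    by (induction a rule: measure_induct_rule[where f = "\<lambda>x. to_nat_on UNIV (Rep_well_index x)"])
      (auto intro: step simp: less_well_index_def)
qed (auto simp: less_eq_well_index_def less_well_index_def)

end

lemma Rep_well_index_bij: "bij Rep_well_index"
  by (metis bijI' Rep_well_index_inject Rep_well_index_cases UNIV_I)

definition relabel :: "real ^ 'n \<Rightarrow> real ^ 'n::finite well_index" where
  "relabel x = (\<chi> i. x $ Rep_well_index i)"

lemma relabel_nth [simp]: "relabel x $ i = x $ Rep_well_index i"
  by (simp add: relabel_def)

lemma linear_relabel: "linear relabel"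
  by (rule linearI) (simp_all add: Finite_Cartesian_Product.vec_eq_iff)

lemma inj_relabel: "inj relabel"
  by (rule injI) (metis (no_types, lifting) Abs_well_index_inverse UNIV_I relabel_nth Finite_Cartesian_Product.vec_eq_iff)

lemma emeasure_lborel_box_cart:
  fixes l u :: "real ^ 'n::finite"
  shows "emeasure lborel (box l u) = (if \<forall>i. l $ i \<le> u $ i then \<Prod>i\<in>UNIV. ennreal (u $ i - l $ i) else 0)"
proof (cases "\<forall>i. l $ i \<le> u $ i")
  case True
  then have le: "l \<bullet> b \<le> u \<bullet> b" if "b \<in> Basis" for b
    using that by (auto simp: Basis_vec_def inner_axis)
  have "emeasure lborel (box l u) = ennreal (\<Prod>b\<in>Basis. (u - l) \<bullet> b)"
    using le by simp
  also have "(\<Prod>b\<in>Basis. (u - l) \<bullet> b) = (\<Prod>i\<in>UNIV. u $ i - l $ i)"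
    by (simp add: Basis_vec_def cart_eq_inner_axis axis_eq_axis prod.UNION_disjoint inner_diff_left)
  also have "ennreal \<dots> = (\<Prod>i\<in>UNIV. ennreal (u $ i - l $ i))"
    using True by (intro prod_ennreal[symmetric]) auto
  finally show ?thesis using True by simp
next
  case False
  then have "\<not> (\<forall>b\<in>Basis. l \<bullet> b \<le> u \<bullet> b)" by (auto simp: Basis_vec_def inner_axis)
  then show ?thesis using False by (simp only: emeasure_lborel_box_eq if_False ennreal_0)
qed

text \<open>Renaming coordinates carries boxes to boxes of the same volume, and boxes determine
  Lebesgue measure.\<close>

lemma lborel_relabel: "lborel = distr lborel borel (relabel :: real ^ 'n::finite \<Rightarrow> _)"
proof (rule lborel_eqI)
  fix l u :: "real ^ 'n well_index"
  assume le: "\<And>b. b \<in> Basis \<Longrightarrow> l \<bullet> b \<le> u \<bullet> b"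
  then have le': "l $ i \<le> u $ i" for i
    using le[of "axis i 1"] by (auto simp: Basis_vec_def inner_axis)
  define l' u' where "l' = (\<chi> i. l $ Abs_well_index i)" and "u' = (\<chi> i. u $ Abs_well_index i)"
  have "relabel -` box l u = box l' u'"
    unfolding l'_def u'_def by (auto simp: mem_box_cart)
      (metis Rep_well_index_inverse Abs_well_index_inverse UNIV_I)+
  then have "emeasure (distr lborel borel relabel) (box l u) = emeasure lborel (box l' u')"
    using linear_continuous_on[OF linear_relabel[THEN linear_conv_bounded_linear[THEN iffD1]], of UNIV]
    by (subst emeasure_distr) (auto intro: borel_measurable_continuous_onI)
  also have "\<dots> = (\<Prod>i\<in>UNIV. ennreal (u' $ i - l' $ i))"
    using le' by (simp add: emeasure_lborel_box_cart l'_def u'_def)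
  also have "\<dots> = (\<Prod>i\<in>UNIV. ennreal (u $ i - l $ i))"
    by (rule prod.reindex_bij_betw[OF Rep_well_index_bij, symmetric, THEN trans])
      (simp add: l'_def u'_def Rep_well_index_inverse)
  also have "\<dots> = emeasure lborel (box l u)" using le' by (simp add: emeasure_lborel_box_cart)
  also have "\<dots> = (\<Prod>b\<in>Basis. (u - l) \<bullet> b)" using le by simp
  finally show "emeasure (distr lborel borel relabel) (box l u) = (\<Prod>b\<in>Basis. (u - l) \<bullet> b)" .
qed simp

lemma content_relabel:
  fixes S :: "(real ^ 'n::finite) set"
  assumes "compact S"
  shows "measure lborel (relabel ` S) = measure lborel S"
proof -
  have bl: "bounded_linear (relabel :: real ^ 'n \<Rightarrow> _)"
    using linear_relabel linear_conv_bounded_linear by blast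
  have meas: "relabel \<in> borel_measurable (lborel :: (real ^ 'n) measure)"
    using linear_continuous_on[OF bl] by (auto intro: borel_measurable_continuous_onI)
  have "compact (relabel ` S)"
    using linear_continuous_on[OF bl] assms by (intro compact_continuous_image) auto
  then have "relabel ` S \<in> sets borel" by (simp add: borel_compact)
  then have "measure (distr lborel borel relabel) (relabel ` S) = measure lborel (relabel -` relabel ` S)"
    using meas by (subst measure_distr) auto
  then show ?thesis
    using inj_vimage_image_eq[OF inj_relabel, of S] by (simp flip: lborel_relabel)
qed

section \<open>Simplex volumes as integer determinants\<close>

lemma det_cart_eq_det_mat:
  fixes f :: "nat \<Rightarrow> nat \<Rightarrow> real" and idx :: "'n::finite \<Rightarrow> nat"
  assumes idx: "bij_betw idx UNIV {0..<n}"
  shows "Determinants.det (\<chi> i j. f (idx i) (idx j)) = Determinant.det (Matrix.mat n n (\<lambda>(i, j). f i j))"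
proof -
  let ?m = "map_permutation UNIV idx"
  let ?inv = "inv_into UNIV idx"
  have inj: "inj idx" using idx by (rule bij_betw_imp_inj_on)
  have inv: "bij_betw ?inv {0..<n} UNIV" using idx by (rule bij_betw_inv_into)
  have "Determinants.det (\<chi> i j. f (idx i) (idx j)) =
      (\<Sum>p | p permutes (UNIV :: 'n set). of_int (sign p) * (\<Prod>i\<in>UNIV. f (idx i) (idx (p i))))"
    by (simp add: Determinants.det_def)
  \<comment> \<open>Transporting permutations along \<open>idx\<close> preserves signs and matches
    the two Leibniz sums term by term.\<close>
  also have "\<dots> = (\<Sum>p | p permutes {0..<n}. of_int (sign p) * (\<Prod>i = 0..<n. f i (p i)))"
  proof (rule sum.reindex_bij_witness[where j = ?m and i = "map_permutation {0..<n} ?inv"])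
    fix p assume "p \<in> {p. p permutes (UNIV :: 'n set)}"
    then have p: "p permutes UNIV" by simp
    show "map_permutation {0..<n} ?inv (?m p) = p"
      by (rule map_permutation_compose_inv[OF idx p]) (simp add: inv_f_f[OF inj])
    show "?m p \<in> {p. p permutes {0..<n}}" using map_permutation_permutes[OF idx p] by simp
    have "(\<Prod>i = 0..<n. f i (?m p i)) = (\<Prod>i\<in>UNIV. f (idx i) (?m p (idx i)))"
      by (rule prod.reindex_bij_betw[OF idx, symmetric])
    also have "\<dots> = (\<Prod>i\<in>UNIV. f (idx i) (idx (p i)))"
      by (simp add: map_permutation_apply[OF inj])
    finally show "of_int (sign (?m p)) * (\<Prod>i = 0..<n. f i (?m p i)) =
        of_int (sign p) * (\<Prod>i\<in>UNIV. f (idx i) (idx (p i)))"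
      by (simp add: sign_map_permutation[OF inj p])
  next
    fix p assume "p \<in> {p. p permutes {0..<n}}"
    then have p: "p permutes {0..<n}" by simp
    show "?m (map_permutation {0..<n} ?inv p) = p"
      by (rule map_permutation_compose_inv[OF inv p]) (use bij_betw_inv_into_right[OF idx] in simp)
    show "map_permutation {0..<n} ?inv p \<in> {p. p permutes UNIV}"
      using map_permutation_permutes[OF inv p] by simp
  qed
  also have "\<dots> = Determinant.det (Matrix.mat n n (\<lambda>(i, j). f i j))"
  proof -
    have "(\<Prod>i = 0..<n. f i (p i)) = (\<Prod>i = 0..<n. Matrix.mat n n (\<lambda>(i, j). f i j) $$ (i, p i))"
      if "p permutes {0..<n}" for p
      using permutes_in_image[OF that] by (intro prod.cong) auto
    then show ?thesis
      by (subst det_def'[of _ n]) (auto intro!: sum.cong)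
  qed
  finally show ?thesis .
qed

definition embed :: "('n \<Rightarrow> nat) \<Rightarrow> int list \<Rightarrow> real ^ 'n::finite" where
  "embed idx v = (\<chi> i. of_int (v ! idx i))"

lemma relabel_embed: "relabel (embed idx v) = embed (idx \<circ> Rep_well_index) v"
  by (simp add: embed_def Finite_Cartesian_Product.vec_eq_iff)

lemma measure_embedded_simplex_wellorder:
  fixes idx :: "'n::{finite, wellorder} \<Rightarrow> nat"
  assumes idx: "bij_betw idx UNIV {0..<n}" and T: "length T = Suc n"
    and inj: "inj_on (embed idx) (set T)" and dist: "distinct T"
  shows "measure lborel (convex hull (embed idx ` set T)) = \<bar>real_of_int (detp cpt (Suc n) T)\<bar> / fact n"
proof -
  let ?X = "embed idx ` set T"
  \<comment> \<open>The volume formula takes the vertices other than the base point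
    \<open>T ! 0\<close> indexed by the coordinate type itself; \<open>Suc \<circ> idx\<close>
    provides this.\<close>
  let ?f = "\<lambda>j. embed idx (T ! Suc (idx j))"
  have card_n: "CARD('n) = n" using bij_betw_same_card[OF idx] by simp
  have bij: "bij_betw ?f UNIV (?X - {embed idx (T ! 0)})"
  proof -
    have "bij_betw (embed idx) (set T) ?X" using inj by (simp add: bij_betw_def)
    moreover have "bij_betw ((!) T) {..<Suc n} (set T)"
      using bij_betw_nth[OF dist _ refl, of "{..<Suc n}"] T by simp
    ultimately have b: "bij_betw (embed idx \<circ> (!) T) {..<Suc n} ?X" by (rule bij_betw_trans[rotated])
    have "bij_betw (embed idx \<circ> (!) T) ({..<Suc n} - {0}) (?X - {embed idx (T ! 0)})"
      using bij_betw_DiffI[OF b, of "{0}" "{embed idx (T ! 0)}"] nth_mem[of 0 T] T by simp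
    moreover have "bij_betw (Suc \<circ> idx) UNIV ({..<Suc n} - {0})"
    proof (rule bij_betw_trans[OF idx])
      show "bij_betw Suc {0..<n} ({..<Suc n} - {0})"
        by (rule bij_betwI[where g = "\<lambda>k. k - 1"]) auto
    qed
    ultimately have "bij_betw ((embed idx \<circ> (!) T) \<circ> (Suc \<circ> idx)) UNIV (?X - {embed idx (T ! 0)})"
      by (rule bij_betw_trans[rotated])
    then show ?thesis by (simp add: comp_def)
  qed
  have "measure lborel (convex hull ?X) =
      \<bar>Determinants.det (\<chi> i j. ?f j $ i - embed idx (T ! 0) $ i)\<bar> / fact CARD('n)"
  proof (rule content_simplex[OF _ _ _ bij])
    show "card ?X = Suc CARD('n)"
      using inj dist T card_n by (simp add: card_image distinct_card)
  qed (use T in auto)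
  also have "(\<chi> i j. ?f j $ i - embed idx (T ! 0) $ i) =
      Finite_Cartesian_Product.transpose (\<chi> k x. real_of_int (T ! Suc (idx k) ! idx x - T ! 0 ! idx x))"
    by (simp add: Finite_Cartesian_Product.transpose_def embed_def Finite_Cartesian_Product.vec_eq_iff)
  also have "Determinants.det \<dots> =
      Determinants.det (\<chi> k x. real_of_int (T ! Suc (idx k) ! idx x - T ! 0 ! idx x))"
    by (rule Determinants.det_transpose)
  also have "\<dots> = Determinant.det (Matrix.mat n n (\<lambda>(k, x). real_of_int (T ! Suc k ! x - T ! 0 ! x)))"
    by (rule det_cart_eq_det_mat[OF idx])
  also have "\<dots> = Determinant.det (map_mat real_of_int (Matrix.mat n n (\<lambda>(k, x). T ! Suc k ! x - T ! 0 ! x)))"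
    by (rule arg_cong[where f = Determinant.det], rule eq_matI) auto
  also have "\<dots> = real_of_int (detp cpt (Suc n) T)"
    by (simp only: of_int_hom.hom_det detp_cpt_diff)
  finally show ?thesis by (simp add: card_n)
qed

lemma measure_embedded_simplex:
  fixes idx :: "'n::finite \<Rightarrow> nat"
  assumes idx: "bij_betw idx UNIV {0..<n}" and T: "length T = Suc n"
    and inj: "inj_on (embed idx) (set T)" and dist: "distinct T"
  shows "measure lborel (convex hull (embed idx ` set T)) = \<bar>real_of_int (detp cpt (Suc n) T)\<bar> / fact n"
proof -
  let ?idx = "idx \<circ> Rep_well_index"
  have "measure lborel (convex hull (embed idx ` set T)) =
      measure lborel (relabel ` (convex hull (embed idx ` set T)))"
    by (rule content_relabel[symmetric]) (auto intro: compact_convex_hull finite_imp_compact)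
  also have "relabel ` (convex hull (embed idx ` set T)) = convex hull (embed ?idx ` set T)"
    by (simp add: convex_hull_linear_image linear_relabel image_image relabel_embed)
  also have "measure lborel \<dots> = \<bar>real_of_int (detp cpt (Suc n) T)\<bar> / fact n"
  proof (rule measure_embedded_simplex_wellorder[OF _ T _ dist])
    show "bij_betw ?idx UNIV {0..<n}" by (rule bij_betw_trans[OF Rep_well_index_bij idx])
    show "inj_on (embed ?idx) (set T)"
      using inj inj_relabel by (auto simp: inj_on_def simp flip: relabel_embed)
  qed
  finally show ?thesis .
qed

section \<open>The triangulation of the cube\<close>

context regular_system
begin

text \<open>Facets overlap in null sets, so their closed union \<open>U\<close> has the full measure
  of the box. A missed point would leave a nonempty open part of the box outside \<open>U\<close>,
  of positive measure.\<close>

lemma covering_by_volume: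
  assumes V: "convex hull V = cbox p q" and ne: "box p q \<noteq> {}"
    and vol: "(\<Sum>S\<in>\<Phi>. measure lborel (convex hull S)) = measure lborel (cbox p q)"
  shows "convex hull V = (\<Union>S\<in>\<Phi>. convex hull S)"
proof
  define U where "U = (\<Union>S\<in>\<Phi>. convex hull S)"
  have sub: "U \<subseteq> cbox p q"
    unfolding U_def V[symmetric] using facet_subset hull_mono[of _ V convex] by blast
  then show "(\<Union>S\<in>\<Phi>. convex hull S) \<subseteq> convex hull V" unfolding U_def V .
  have comp: "compact (convex hull S)" if "S \<in> \<Phi>" for S
    using finite_facet[OF that] by (intro finite_imp_compact_convex_hull)
  have "measure lebesgue U = (\<Sum>X\<in>(hull) convex ` \<Phi>. measure lebesgue X)"
    unfolding U_def
  proof (rule measure_negligible_finite_Union)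
    show "finite ((hull) convex ` \<Phi>)" using finite_facets by simp
    show "X \<in> lmeasurable" if "X \<in> (hull) convex ` \<Phi>" for X
      using that comp lmeasurable_compact by blast
    show "pairwise (\<lambda>S T. negligible (S \<inter> T)) ((hull) convex ` \<Phi>)"
      using negligible_Int_facets by (auto simp: pairwise_def)
  qed
  also have "\<dots> = (\<Sum>S\<in>\<Phi>. measure lebesgue (convex hull S))"
    by (simp add: sum.reindex[OF inj_on_convex_hull_facets])
  also have "\<dots> = (\<Sum>S\<in>\<Phi>. measure lborel (convex hull S))"
    using comp by (intro sum.cong refl measure_completion) (simp add: borel_compact)
  also have "\<dots> = measure lebesgue (cbox p q)" using vol by (simp add: measure_completion)
  finally have mU: "measure lebesgue U = measure lebesgue (cbox p q)" .
  have cU: "compact U" unfolding U_def using finite_facets comp by (intro compact_UN) auto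
  have "cbox p q \<subseteq> U"
  proof (rule ccontr)
    assume "\<not> cbox p q \<subseteq> U"
    then obtain x where x: "x \<in> cbox p q" "x \<notin> U" by blast
    define O' where "O' = - U \<inter> box p q"
    have op: "open (- U)" using compact_imp_closed[OF cU] by (rule open_Compl)
    have "x \<in> closure (box p q)" using x(1) closure_box[OF ne] by simp
    then have "O' \<noteq> {}"
      using open_Int_closure_eq_empty[OF op, of "box p q"] x unfolding O'_def by blast
    moreover have "open O'" unfolding O'_def using op by (intro open_Int open_box)
    moreover have O'sub: "O' \<subseteq> cbox p q" unfolding O'_def using box_subset_cbox by blast
    then have Ol: "O' \<in> lmeasurable"
      using \<open>open O'\<close> bounded_cbox bounded_subset lmeasurable_open by blast
    ultimately have "measure lebesgue O' > 0"
      using open_not_negligible negligible_iff_measure zero_less_measure_iff by blast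
    moreover have "measure lebesgue (U \<union> O') = measure lebesgue U + measure lebesgue O'"
    proof (rule measure_Union)
      show "U \<inter> O' = {}" by (auto simp: O'_def)
      show "emeasure lebesgue U \<noteq> \<infinity>" "emeasure lebesgue O' \<noteq> \<infinity>"
        unfolding infinity_ennreal_def using Ol lmeasurable_compact[OF cU] by (blast dest: fmeasurableD2)+
      show "U \<in> sets lebesgue" "O' \<in> sets lebesgue"
        using Ol lmeasurable_compact[OF cU] by (blast dest: fmeasurableD)+
    qed
    moreover have "measure lebesgue (U \<union> O') \<le> measure lebesgue (cbox p q)"
      using sub O'sub Ol cU by (intro measure_mono_fmeasurable) (auto intro: lmeasurable_compact fmeasurableD)
    ultimately show False using mU by linarith
  qed
  then show "convex hull V \<subseteq> (\<Union>S\<in>\<Phi>. convex hull S)" unfolding V U_def .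
qed

end

lemma facets_subset_hulls:
  fixes K :: "'a::euclidean_space set set"
  assumes "simplicial_complex K"
  shows "facets K \<subseteq> (hull) convex ` Pow (vertices K)"
proof
  fix S assume S: "S \<in> facets K"
  then obtain C where C: "\<not> affine_dependent C" "S = convex hull C"
    unfolding facets_def simplex_def by blast
  have "C \<subseteq> vertices K"
  proof
    fix v assume "v \<in> C"
    then have "(convex hull {v}) face_of S"
      unfolding C(2) face_of_convex_hull_affine_independent[OF C(1)] by blast
    then have "{v} \<in> K" using assms S unfolding simplicial_complex_def facets_def by auto
    then show "v \<in> vertices K" by (simp add: vertices_def)
  qed
  then show "S \<in> (hull) convex ` Pow (vertices K)" using C(2) by blast
qed

text \<open>All facets are hulls of subsets of one finite set. Finiteness is what makes
  \<open>Max\<close> an upper bound for a signature that is exhibited.\<close>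

lemma finite_signatures:
  fixes P :: "'a::euclidean_space set"
  assumes "finite (P \<inter> integer_lattice)"
  shows "finite {bipartition_signature B W | K B W. rdf_triangulation P K \<and> dual_bipartition K B W}"
proof (rule finite_subset)
  let ?X = "(hull) convex ` Pow (P \<inter> integer_lattice)"
  show "{bipartition_signature B W | K B W. rdf_triangulation P K \<and> dual_bipartition K B W} \<subseteq>
      (\<lambda>(B, W). bipartition_signature B W) ` (Pow ?X \<times> Pow ?X)"
  proof clarify
    fix K B W assume K: "rdf_triangulation P K" and BW: "dual_bipartition K B W"
    have "facets K \<subseteq> ?X"
      using K facets_subset_hulls[of K]
      unfolding rdf_triangulation_def polytope_triangulation_def dense_triangulation_def by simp
    then have "(B, W) \<in> Pow ?X \<times> Pow ?X" using BW unfolding dual_bipartition_def by blast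
    then show "bipartition_signature B W \<in> (\<lambda>(B, W). bipartition_signature B W) ` (Pow ?X \<times> Pow ?X)"
      by force
  qed
  show "finite ((\<lambda>(B, W). bipartition_signature B W) ` (Pow ?X \<times> Pow ?X))"
    by (intro finite_imageI finite_cartesian_product finite_Pow_iff[THEN iffD2] assms)
qed

section \<open>The vertices of the cube in \<open>real ^ 'n\<close>\<close>

lemma embed_nth [simp]: "embed idx v $ i = of_int (v ! idx i)"
  by (simp add: embed_def)

lemma inj_on_embed:
  assumes "bij_betw idx UNIV {0..<n}"
  shows "inj_on (embed idx) (cube n)"
proof (rule inj_onI)
  fix v w assume v: "v \<in> cube n" and w: "w \<in> cube n" and eq: "embed idx v = embed idx w"
  show "v = w"
  proof (rule nth_equalityI)
    fix k assume "k < length v"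
    then have "k \<in> idx ` UNIV" using v bij_betw_imp_surj_on[OF assms] by (simp add: cube_def)
    then obtain i where "k = idx i" by blast
    then show "v ! k = w ! k" using arg_cong[OF eq, of "\<lambda>x. x $ i"] by simp
  qed (use v w in \<open>simp add: cube_def\<close>)
qed

lemma cube_vertices_cart:
  "cbox 0 1 \<inter> integer_lattice = {x :: real ^ 'n::finite. \<forall>i. x $ i = 0 \<or> x $ i = 1}"
proof -
  have lat: "x \<in> integer_lattice \<longleftrightarrow> (\<forall>i. x $ i \<in> \<int>)" for x :: "real ^ 'n"
    by (auto simp: integer_lattice_def Basis_vec_def inner_axis)
  have int01: "0 \<le> t \<and> t \<le> 1 \<and> t \<in> \<int> \<longleftrightarrow> t = 0 \<or> t = (1::real)" for t
  proof
    assume "0 \<le> t \<and> t \<le> 1 \<and> t \<in> \<int>"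
    then obtain k :: int where "t = of_int k" "0 \<le> k" "k \<le> 1" by (auto elim!: Ints_cases)
    then have "k = 0 \<or> k = 1" by linarith
    then show "t = 0 \<or> t = 1" using \<open>t = of_int k\<close> by auto
  qed auto
  have "x \<in> cbox 0 1 \<inter> integer_lattice \<longleftrightarrow> (\<forall>i. 0 \<le> x $ i \<and> x $ i \<le> 1 \<and> x $ i \<in> \<int>)" for x :: "real ^ 'n"
    by (auto simp: lat mem_box_cart)
  then show ?thesis unfolding int01 by blast
qed

lemma embed_cube:
  assumes idx: "bij_betw idx (UNIV :: 'n::finite set) {0..<n}"
  shows "embed idx ` cube n = cbox 0 1 \<inter> integer_lattice"
  unfolding cube_vertices_cart
proof
  have lt: "idx i < n" for i using bij_betwE[OF idx] by auto
  show "embed idx ` cube n \<subseteq> {x. \<forall>i. x $ i = 0 \<or> x $ i = 1}"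
  proof clarify
    fix v i assume v: "v \<in> cube n" and "embed idx v $ i \<noteq> 1"
    have "v ! idx i \<in> set v" using lt v by (simp add: cube_def)
    then have "v ! idx i \<in> {0, 1}" using v by (auto simp: cube_def)
    then show "embed idx v $ i = 0" using \<open>embed idx v $ i \<noteq> 1\<close> by auto
  qed
  show "{x. \<forall>i. x $ i = 0 \<or> x $ i = 1} \<subseteq> embed idx ` cube n"
  proof
    fix x :: "real ^ 'n" assume x: "x \<in> {x. \<forall>i. x $ i = 0 \<or> x $ i = 1}"
    define v where "v = map (\<lambda>k. if x $ inv_into UNIV idx k = 0 then 0 else 1 :: int) [0..<n]"
    have "v \<in> cube n" by (auto simp: v_def cube_def)
    moreover have "inv_into UNIV idx (idx i) = i" for i
      using bij_betw_imp_inj_on[OF idx] by simp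
    then have "embed idx v = x"
      using lt x by (auto simp: Finite_Cartesian_Product.vec_eq_iff v_def)
    ultimately show "x \<in> embed idx ` cube n" by blast
  qed
qed

text \<open>The functional with entry 1 where \<open>v $ i = 1\<close> and -1 elsewhere drops by 1
  for each coordinate in which a vertex differs from \<open>v\<close>, so it separates
  \<open>v\<close> from all other vertices.\<close>

lemma cube_vertex_extreme:
  fixes v :: "real ^ 'n::finite"
  assumes S: "S \<subseteq> cbox 0 1 \<inter> integer_lattice" and v: "v \<in> cbox 0 1 \<inter> integer_lattice"
    and hull: "v \<in> convex hull S"
  shows "v \<in> S"
proof (rule ccontr)
  assume "v \<notin> S"
  define c :: "real ^ 'n" where "c = (\<chi> i. if v $ i = 1 then 1 else -1)"
  have inner: "c \<bullet> x = (\<Sum>i\<in>UNIV. if v $ i = 1 then x $ i else - x $ i)" for x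
    unfolding c_def inner_vec_def by (rule sum.cong) auto
  have v01: "v $ i = 0 \<or> v $ i = 1" for i using v unfolding cube_vertices_cart by blast
  have "c \<bullet> w + (1 - c \<bullet> v) \<le> 0" if "w \<in> S" for w
  proof -
    have w01: "w $ i = 0 \<or> w $ i = 1" for i using S that unfolding cube_vertices_cart by blast
    have "w \<noteq> v" using that \<open>v \<notin> S\<close> by blast
    then obtain i where i: "w $ i \<noteq> v $ i" by (auto simp: Finite_Cartesian_Product.vec_eq_iff)
    let ?f = "\<lambda>i. (if v $ i = 1 then v $ i else - v $ i) - (if v $ i = 1 then w $ i else - w $ i)"
    have "?f j \<ge> 0" for j using v01[of j] w01[of j] by auto
    then have "?f i \<le> (\<Sum>j\<in>UNIV. ?f j)" by (intro member_le_sum) auto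
    moreover have "?f i = 1" using v01[of i] w01[of i] i by auto
    moreover have "(\<Sum>j\<in>UNIV. ?f j) = c \<bullet> v - c \<bullet> w" by (simp only: inner sum_subtractf)
    ultimately show ?thesis by linarith
  qed
  then have "c \<bullet> v + (1 - c \<bullet> v) \<le> 0" using hull by (rule affine_le_on_hull)
  then show False by simp
qed

lemma lin_embed:
  assumes idx: "bij_betw idx (UNIV :: 'n::finite set) {0..<n}"
  shows "lin (Suc n) a (cpt v) = (\<chi> i. a (Suc (idx i))) \<bullet> embed idx v + a 0"
proof -
  have "lin (Suc n) a (cpt v) = a 0 + (\<Sum>j\<in>{0..<n}. a (Suc j) * of_int (v ! j))"
    unfolding lin_def sum.lessThan_Suc_shift by (simp add: cpt_def atLeast0LessThan)
  also have "(\<Sum>j\<in>{0..<n}. a (Suc j) * of_int (v ! j)) = (\<Sum>i\<in>UNIV. a (Suc (idx i)) * of_int (v ! idx i))"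
    by (rule sum.reindex_bij_betw[OF idx, symmetric])
  finally show ?thesis by (simp add: inner_vec_def)
qed

lemma osgn_sum_eq:
  assumes "finite A"
  shows "(\<Sum>x\<in>A. osgn (f x)) = int (card {x \<in> A. 0 < f x \<and> odd (f x)}) - int (card {x \<in> A. f x < 0 \<and> odd (f x)})"
proof -
  have "(\<Sum>x\<in>A. osgn (f x)) =
      (\<Sum>x\<in>A. if 0 < f x \<and> odd (f x) then 1 else 0) - (\<Sum>x\<in>A. if f x < 0 \<and> odd (f x) then 1 else 0)"
    unfolding sum_subtractf[symmetric] by (rule sum.cong) (auto simp: osgn_def sgn_if)
  also have "\<dots> = int (card {x \<in> A. 0 < f x \<and> odd (f x)}) - int (card {x \<in> A. f x < 0 \<and> odd (f x)})"
    using assms by (simp add: sum.If_cases Int_def conj_commute)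
  finally show ?thesis .
qed

text \<open>Facets of positive determinant form one class and those of negative determinant the
  other, so the embedded triangulation has signature \<open>\<bar>u\<bar>\<close>.\<close>

theorem cube_family_signature:
  assumes fam: "cube_family d h c \<Phi> u" and d: "CARD('n::finite) = d"
  shows "u \<le> polytope_signature (cbox 0 1 :: (real ^ 'n) set)"
proof -
  let ?N = "Suc d"
  let ?C = "cbox 0 1 :: (real ^ 'n) set"
  obtain idx :: "'n \<Rightarrow> nat" where idx: "bij_betw idx UNIV {0..<d}"
    using ex_bij_betw_finite_nat[OF finite_class.finite_UNIV] d by metis
  define e where "e = (embed idx :: int list \<Rightarrow> real ^ 'n)"
  define V where "V = ?C \<inter> integer_lattice"
  have reg: "regular_family cpt ?N (cube d) h \<Phi>" and col: "coloured c ?N \<Phi>"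
    and vol: "(\<Sum>F\<in>\<Phi>. \<bar>detp cpt ?N F\<bar>) = fact d" and sig: "(\<Sum>F\<in>\<Phi>. osgn (detp cpt ?N F)) = u"
    using fam unfolding cube_family_def by auto
  have fin\<Phi>: "finite \<Phi>" using reg unfolding regular_family_def by blast
  have len: "length F = ?N" and sub: "set F \<subseteq> cube d" and det: "detp cpt ?N F \<noteq> 0" if "F \<in> \<Phi>" for F
    using reg that unfolding regular_family_def by auto
  have cF: "c (F ! k) = k" if "F \<in> \<Phi>" "k < ?N" for F k
    using col that unfolding coloured_def by blast
  have dist: "distinct F" if "F \<in> \<Phi>" for F
    using cF[OF that] len[OF that] by (metis distinct_conv_nth)
  have inj: "inj_on e (cube d)" unfolding e_def by (rule inj_on_embed[OF idx])
  have eV: "e ` cube d = V" unfolding e_def V_def by (rule embed_cube[OF idx])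
  define g where "g = inv_into (cube d) e"
  have g: "g (e v) = v" if "v \<in> cube d" for v using inv_into_f_f[OF inj that] by (simp add: g_def)
  define H where "H = h \<circ> g"
  define X where "X = (\<lambda>F. e ` set F)"
  define \<Psi> where "\<Psi> = X ` \<Phi>"
  have mem_X: "e v \<in> X F \<longleftrightarrow> v \<in> set F" if "v \<in> cube d" "F \<in> \<Phi>" for v F
    unfolding X_def using inj_on_image_mem_iff[OF inj that(1) sub[OF that(2)]] by simp
  \<comment> \<open>Colours fix the order of the vertices, so passing from lists to vertex sets
    identifies no two facets and the counts survive.\<close>
  have set_inj: "F = G" if "F \<in> \<Phi>" "G \<in> \<Phi>" "set F = set G" for F G
  proof (rule nth_equalityI)
    show "length F = length G" using len that by simp
    fix k assume "k < length F"
    then have k: "k < ?N" using len that by simp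
    then have "F ! k \<in> set G" using len that by auto
    moreover have "length G = ?N" using len that by simp
    ultimately obtain l where l: "l < ?N" "F ! k = G ! l" by (metis in_set_conv_nth)
    then show "F ! k = G ! k" using cF that k by metis
  qed
  have injX: "inj_on X \<Phi>"
    using inj_on_image_eq_iff[OF inj sub sub] set_inj by (auto simp: inj_on_def X_def)
  interpret regular_system V H \<Psi>
  proof
    show "finite V" using finite_cube by (simp flip: eV)
    show "S \<subseteq> V" if "S \<in> \<Psi>" for S using that sub by (auto simp: \<Psi>_def X_def simp flip: eV)
    show "card S = Suc DIM(real ^ 'n)" if "S \<in> \<Psi>" for S
    proof -
      obtain F where F: "F \<in> \<Phi>" "S = e ` set F" using \<open>S \<in> \<Psi>\<close> by (auto simp: \<Psi>_def X_def)
      have "card S = card (set F)" unfolding F(2) by (rule card_image) (rule inj_on_subset[OF inj sub[OF F(1)]])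
      then show ?thesis using dist len F(1) d by (simp add: distinct_card)
    qed
    show "\<exists>b f. \<forall>t\<in>S. b \<bullet> t + f = (if t = s then 1 else 0)" if S: "S \<in> \<Psi>" and s: "s \<in> S" for S s
    proof -
      obtain F where F: "F \<in> \<Phi>" "S = e ` set F" using S by (auto simp: \<Psi>_def X_def)
      obtain l where l: "l < ?N" "s = e (F ! l)"
        using s len[OF F(1)] unfolding F(2) by (auto simp: in_set_conv_nth)
      obtain B where B: "\<And>k l. k < ?N \<Longrightarrow> l < ?N \<Longrightarrow> lin ?N (B l) (cpt (F ! k)) = (if k = l then 1 else 0)"
        using interpolation[OF det[OF F(1)]] by blast
      have "(\<chi> i. B l (Suc (idx i))) \<bullet> t + B l 0 = (if t = s then 1 else 0)" if "t \<in> S" for t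
      proof -
        obtain k where k: "k < ?N" "t = e (F ! k)"
          using \<open>t \<in> S\<close> len[OF F(1)] unfolding F(2) by (auto simp: in_set_conv_nth)
        have "F ! k \<in> cube d" "F ! l \<in> cube d" using sub[OF F(1)] len[OF F(1)] k l by auto
        then have "t = s \<longleftrightarrow> F ! k = F ! l" unfolding k l using inj by (auto dest: inj_onD)
        also have "\<dots> \<longleftrightarrow> k = l" using dist[OF F(1)] len[OF F(1)] k l by (simp add: nth_eq_iff_index_eq)
        finally show ?thesis
          using B[OF k(1) l(1)] unfolding lin_embed[OF idx] k(2) e_def by simp
      qed
      then show ?thesis by blast
    qed
    show "\<exists>a b. \<forall>v\<in>V. a \<bullet> v + b \<le> H v \<and> (a \<bullet> v + b = H v \<longleftrightarrow> v \<in> S)" if S: "S \<in> \<Psi>" for S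
    proof -
      obtain F where F: "F \<in> \<Phi>" "S = X F" using S by (auto simp: \<Psi>_def)
      obtain a where a: "\<forall>v\<in>cube d. lin ?N a (cpt v) \<le> h v \<and> (lin ?N a (cpt v) = h v \<longleftrightarrow> v \<in> set F)"
        using reg F(1) unfolding regular_family_def by blast
      have "(\<chi> i. a (Suc (idx i))) \<bullet> x + a 0 \<le> H x \<and> ((\<chi> i. a (Suc (idx i))) \<bullet> x + a 0 = H x \<longleftrightarrow> x \<in> S)"
        if "x \<in> V" for x
      proof -
        obtain v where v: "v \<in> cube d" "x = e v" using \<open>x \<in> V\<close> unfolding eV[symmetric] by blast
        have "(\<chi> i. a (Suc (idx i))) \<bullet> x + a 0 = lin ?N a (cpt v)"
          unfolding lin_embed[OF idx] v(2) e_def ..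
        moreover have "H x = h v" using g[OF v(1)] by (simp add: H_def v(2))
        moreover have "x \<in> S \<longleftrightarrow> v \<in> set F" unfolding v(2) F(2) by (rule mem_X[OF v(1) F(1)])
        ultimately show ?thesis using a v(1) by simp
      qed
      then show ?thesis by blast
    qed
  qed
  have V01: "V = {x. \<forall>i. x $ i = 0 \<or> x $ i = 1}" unfolding V_def by (rule cube_vertices_cart)
  have hullV: "convex hull V = ?C"
    unfolding V01 Cart_1 unit_interval_convex_hull
    by (rule arg_cong[where f = "\<lambda>S. convex hull S"]) (auto simp: Basis_vec_def inner_axis)
  have meas: "measure lborel (convex hull (X F)) = \<bar>real_of_int (detp cpt ?N F)\<bar> / fact d" if "F \<in> \<Phi>" for F
    unfolding X_def e_def
    by (rule measure_embedded_simplex[OF idx len[OF that] _ dist[OF that]])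
      (rule inj_on_subset[OF inj[unfolded e_def] sub[OF that]])
  interpret regular_covering V H \<Psi>
  proof
    have box_ne: "box 0 (1 :: real ^ 'n) \<noteq> {}" by (simp add: interval_ne_empty_cart)
    have "(\<Sum>S\<in>\<Psi>. measure lborel (convex hull S)) = (\<Sum>F\<in>\<Phi>. \<bar>real_of_int (detp cpt ?N F)\<bar> / fact d)"
      unfolding \<Psi>_def by (simp add: sum.reindex[OF injX] meas)
    also have "\<dots> = real_of_int (\<Sum>F\<in>\<Phi>. \<bar>detp cpt ?N F\<bar>) / fact d"
      by (simp add: sum_divide_distrib)
    also have "\<dots> = 1" unfolding vol by simp
    also have "1 = measure lborel ?C"
      by (subst content_cbox_cart) (simp_all add: interval_ne_empty_cart)
    finally show "convex hull V = (\<Union>S\<in>\<Psi>. convex hull S)"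
      using covering_by_volume[OF hullV box_ne] by blast
    show "V \<noteq> {}" using hullV box_ne box_subset_cbox[of 0 "1 :: real ^ 'n"] by auto
    show "v \<in> S" if "S \<subseteq> V" "v \<in> V" "v \<in> convex hull S" for v S
      using cube_vertex_extreme that unfolding V_def .
  qed
  have "lattice_polytope ?C"
    unfolding lattice_polytope_def
  proof
    show "\<exists>W. finite W \<and> W \<subseteq> integer_lattice \<and> ?C = convex hull W"
      using finite_V hullV unfolding V_def by (intro exI[of _ "?C \<inter> integer_lattice"]) auto
    have "interior ?C \<noteq> {}" by (simp add: interior_cbox interval_ne_empty_cart)
    then show "aff_dim ?C = int DIM(real ^ 'n)" by (rule aff_dim_nonempty_interior)
  qed
  then have tri: "polytope_triangulation ?C cells"
    unfolding polytope_triangulation_def using simplicial_complex_cells Union_cells hullV by simp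
  have regc: "regular_triangulation cells"
    unfolding regular_triangulation_def vertices_cells using induced_subdivision_eq by metis
  have dense: "dense_triangulation ?C cells"
    unfolding dense_triangulation_def vertices_cells V_def ..
  have colour: "\<exists>k<?N. v = e (F ! k) \<and> c (g v) = k" if F: "F \<in> \<Phi>" and v: "v \<in> X F" for F v
  proof -
    obtain k where k: "k < ?N" "v = e (F ! k)"
      using v len[OF F] by (auto simp: X_def in_set_conv_nth)
    have "F ! k \<in> cube d" using sub[OF F] len[OF F] k by auto
    then show ?thesis using k cF[OF F k(1)] g by auto
  qed
  have fold: "foldable_triangulation cells"
    unfolding foldable_triangulation_def vertices_cells
  proof (intro exI[of _ "c \<circ> g"] conjI ballI impI)
    fix v assume v: "v \<in> V"
    then have "{v} \<in> cells" using vertices_cells unfolding vertices_def by blast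
    \<comment> \<open>The degenerate segment from \<open>v\<close> to \<open>v\<close> is
      \<open>{v}\<close>, so the lemma on edges also finds a facet through a single vertex.\<close>
    then obtain S where "S \<in> \<Psi>" "v \<in> S" using edge_in_facet[OF v v] by auto
    then obtain F where "F \<in> \<Phi>" "v \<in> X F" unfolding \<Psi>_def by blast
    then show "(c \<circ> g) v < DIM(real ^ 'n) + 1" using colour d by fastforce
  next
    fix x y assume xy: "x \<in> V" "y \<in> V" "x \<noteq> y \<and> closed_segment x y \<in> cells"
    then obtain S where "S \<in> \<Psi>" "x \<in> S" "y \<in> S" using edge_in_facet by blast
    then obtain F where F: "F \<in> \<Phi>" "x \<in> X F" "y \<in> X F" unfolding \<Psi>_def by blast
    show "(c \<circ> g) x \<noteq> (c \<circ> g) y"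
      using colour[OF F(1,2)] colour[OF F(1,3)] xy(3) by auto
  qed
  have rdf: "rdf_triangulation ?C cells"
    unfolding rdf_triangulation_def using tri regc dense fold by blast
  define Y where "Y = (\<lambda>F. convex hull X F)"
  have facetsY: "facets cells = Y ` \<Phi>"
    unfolding facets_cells by (simp add: \<Psi>_def Y_def image_image)
  have injY: "inj_on Y \<Phi>"
    using comp_inj_on[OF injX inj_on_convex_hull_facets[unfolded \<Psi>_def]] by (simp add: Y_def comp_def)
  define B where "B = Y ` {F \<in> \<Phi>. 0 < detp cpt ?N F}"
  define W where "W = Y ` {F \<in> \<Phi>. detp cpt ?N F < 0}"
  have memB: "Y F \<in> B \<longleftrightarrow> 0 < detp cpt ?N F" and memW: "Y F \<in> W \<longleftrightarrow> detp cpt ?N F < 0" if "F \<in> \<Phi>" for F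
    using that injY by (auto simp: B_def W_def dest: inj_onD)
  have bip: "dual_bipartition cells B W"
    unfolding dual_bipartition_def
  proof (intro conjI ballI impI)
    show "B \<union> W = facets cells"
      using det unfolding facetsY B_def W_def by (force simp: neq_iff)
    have "S \<notin> W" if "S \<in> B" for S using that by (auto simp: B_def memW)
    then show "B \<inter> W = {}" by blast
    fix S T assume "S \<in> facets cells" "T \<in> facets cells" and adj: "adjacent_facets S T"
    then obtain F G where F: "F \<in> \<Phi>" "S = Y F" and G: "G \<in> \<Phi>" "T = Y G" unfolding facetsY by blast
    have "card (X F \<inter> X G) = DIM(real ^ 'n)"
      using adjacent_card[of "X F" "X G"] adj F G by (simp add: \<Psi>_def Y_def)
    moreover have "X F \<inter> X G = e ` (set F \<inter> set G)"
      unfolding X_def using inj_on_image_Int[OF inj sub[OF F(1)] sub[OF G(1)]] by simp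
    moreover have "card (e ` (set F \<inter> set G)) = card (set F \<inter> set G)"
      by (rule card_image) (rule inj_on_subset[OF inj], use sub[OF F(1)] in blast)
    ultimately have "Suc (card (set F \<inter> set G)) = ?N" using d by simp
    then have "detp cpt ?N F * detp cpt ?N G < 0"
      by (rule shared_ridge_opposite[OF reg col F(1) G(1)])
    then show "S \<in> B \<longleftrightarrow> T \<in> W"
      unfolding F(2) G(2) memB[OF F(1)] memW[OF G(1)] by (auto simp: mult_less_0_iff)
  qed
  have odd: "odd_simplex (Y F) \<longleftrightarrow> odd (detp cpt ?N F)" if "F \<in> \<Phi>" for F
  proof -
    have "normalized_volume (Y F) = real_of_int \<bar>detp cpt ?N F\<bar>"
      unfolding normalized_volume_def Y_def meas[OF that] using d by simp
    then have "odd_simplex (Y F) \<longleftrightarrow> odd \<bar>detp cpt ?N F\<bar>"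
      unfolding odd_simplex_def by (metis of_int_eq_iff)
    then show ?thesis by simp
  qed
  have card_odd: "card {S \<in> Y ` {F \<in> \<Phi>. P F}. odd_simplex S} = card {F \<in> \<Phi>. P F \<and> odd (detp cpt ?N F)}" for P
  proof -
    have "{S \<in> Y ` {F \<in> \<Phi>. P F}. odd_simplex S} = Y ` {F \<in> \<Phi>. P F \<and> odd (detp cpt ?N F)}"
      using odd by auto
    then show ?thesis using card_image inj_on_subset[OF injY] by (metis (no_types, lifting) mem_Collect_eq subsetI)
  qed
  have "bipartition_signature B W = \<bar>u\<bar>"
    unfolding bipartition_signature_def B_def W_def card_odd sig[symmetric] osgn_sum_eq[OF fin\<Phi>] ..
  then have "\<bar>u\<bar> \<in> {bipartition_signature B W | K B W. rdf_triangulation ?C K \<and> dual_bipartition K B W}"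
    using rdf bip by force
  then have "\<bar>u\<bar> \<le> polytope_signature ?C"
    unfolding polytope_signature_def
    using finite_signatures finite_V unfolding V_def by (intro Max_ge) auto
  then show ?thesis by linarith
qed

theorem theorem6p3:
  fixes d :: nat
  assumes "CARD('n::finite) = d" and "d \<ge> 3"
  shows "real_of_int (polytope_signature (cbox 0 1 :: (real ^ 'n) set)) \<ge>
    (if d mod 2 = 1 then 2 ^ ((d + 1) div 2) * fact ((d - 1) div 2)
     else if d mod 4 = 0 then fact (d div 2)
     else 2 / 3 * fact (d div 2))"
proof -
  obtain h c \<Phi> u where fam: "cube_family d h c \<Phi> u"
    and u: "real_of_int u \<ge> (if d mod 2 = 1 then 2 ^ ((d + 1) div 2) * fact ((d - 1) div 2)
     else if d mod 4 = 0 then fact (d div 2) else 2 / 3 * fact (d div 2))"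
    using cube_family_exists[OF assms(2)] by blast
  have "real_of_int u \<le> real_of_int (polytope_signature (cbox 0 1 :: (real ^ 'n) set))"
    using cube_family_signature[OF fam assms(1)] by simp
  with u show ?thesis by (rule order_trans)
qed

end
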